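(* Let $\nu$ be a probability measure on $\mathbb{R}^d$ that is absolutely continuous with respect to the Lebesgue measure and has a finite second moment, and suppose that $\nu$ is $\beta$-semi-log-convex for some $\beta>0$ and $\kappa$-semi-log-concave for some $\kappa>0$ with $\mathrm{supp}(\nu)=\mathbb{R}^d$. Let $X_1$ be the time-one flow map of the Gaussian interpolation flow and $X_1^*$ the time-one map of the time-reversed flow. (i) If $\nu$ is $\kappa$-semi-log-concave for some $\kappa>0$, then $X_1$ is a Lipschitz mapping, that is, $$\|\nabla_xX_1(x)\|_{2,2}\le\frac{1}{\sqrt{\kappa a_0^2+b_0^2}},\quad\forall x\in\mathbb{R}^d.$$ In particular, if $a_0=1$ and $b_0=0$, then $\|\nabla_xX_1(x)\|_{2,2}\le\frac{1}{\sqrt\kappa}$ for all $x\in\mathbb{R}^d$. (ii) If $\nu$ is $\beta$-semi-log-convex for some $\beta>0$, then $X_1^*$ is a Lipschitz mapping, that is, $$\|\nabla_xX_1^*(x)\|_{2,2}\le\sqrt{\beta a_0^2+b_0^2},\quad\forall x\in\mathrm{supp}(\nu).$$ In particular, if $a_0=1$ and $b_0=0$, then $\|\nabla_xX_1^*(x)\|_{2,2}\le\sqrt\beta$ for all $x\in\mathrm{supp}(\nu)$.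
   Context: Fix functions $a_t,b_t$ of $t\in[0,1]$ (a dot denotes the time derivative) satisfying: $\dot a_t\le 0$, $\dot b_t\ge 0$, $a_0>0$, $b_0\ge 0$, $a_1=0$, $b_1=1$; $a_t>0$ and $b_t>0$ for all $t\in(0,1)$; $a_t,b_t\in C^2([0,1))$, $a_t^2\in C^1([0,1])$, $b_t\in C^1([0,1])$. Let $\mathsf{Z}\sim N(0,\mathbf{I}_d)$ and $\mathsf{X}_1\sim\nu$ be independent, and $\mathsf{X}_t=a_t\mathsf{Z}+b_t\mathsf{X}_1$. The velocity field is $v(t,x)=\mathbb{E}[\dot a_t\mathsf{Z}+\dot b_t\mathsf{X}_1\mid\mathsf{X}_t=x]$ for $t\in(0,1)$, $v(0,x)=\lim_{t\downarrow0}v(t,x)$, $v(1,x)=\lim_{t\uparrow1}v(t,x)$. The Gaussian interpolation flow is the solution $X_t(x)$ of $\frac{d}{dt}X_t(x)=v(t,X_t(x))$, $X_0(x)=x$, $t\in[0,1]$; the time-reversed flow is the solution $X_t^*(x)$ of $\frac{d}{dt}X_t^*(x)=-v(1-t,X_t^*(x))$, $X_0^*(x)=x$, $t\in[0,1]$. A probability measure $\exp(-U)\,dx$ is $\kappa$-semi-log-concave ($\kappa\in\mathbb{R}$) if its support $\Omega\subseteq\mathbb{R}^d$ is convex and $U\in C^2(\Omega)$ satisfies $\nabla^2U(x)\succeq\kappa\mathbf{I}_d$ on $\Omega$; it is $\beta$-semi-log-convex ($\beta>0$) if its support $\Omega$ is convex and $U\in C^2(\Omega)$ satisfies $\nabla^2U(x)\preceq\beta\mathbf{I}_d$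 on $\Omega$. $\|\cdot\|_{2,2}$ is the spectral norm. *)

theory Defs
  imports "HOL-Probability.Probability"
begin

text \<open>One-sided derivatives are used at those endpoints that belong to the interval.\<close>

definition C1_on :: "real set \<Rightarrow> (real \<Rightarrow> real) \<Rightarrow> bool" where
  "C1_on S f \<longleftrightarrow>
     (\<exists>f'. (\<forall>t\<in>S. (f has_real_derivative f' t) (at t within S)) \<and> continuous_on S f')"

definition C2_on :: "real set \<Rightarrow> (real \<Rightarrow> real) \<Rightarrow> bool" where
  "C2_on S f \<longleftrightarrow>
     (\<exists>f'. (\<forall>t\<in>S. (f has_real_derivative f' t) (at t within S)) \<and> C1_on S f')"

definition time_deriv :: "(real \<Rightarrow> real) \<Rightarrow> real \<Rightarrow> real" where
  "time_deriv f t = vector_derivative f (at t within {0..1})"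

text \<open>The sign condition on the derivative of \<open>a\<close> is imposed on \<open>[0,1)\<close> only: \<open>a\<close> need
  not be differentiable at \<open>1\<close>, as for \<open>a t = sqrt (1 - t\<^sup>2)\<close>.\<close>

definition interpolation_schedule :: "(real \<Rightarrow> real) \<Rightarrow> (real \<Rightarrow> real) \<Rightarrow> bool" where
  "interpolation_schedule a b \<longleftrightarrow>
     (\<forall>t\<in>{0..<1}. time_deriv a t \<le> 0) \<and>
     (\<forall>t\<in>{0..1}. time_deriv b t \<ge> 0) \<and>
     a 0 > 0 \<and> b 0 \<ge> 0 \<and> a 1 = 0 \<and> b 1 = 1 \<and>
     (\<forall>t\<in>{0<..<1}. a t > 0 \<and> b t > 0) \<and>
     C2_on {0..<1} a \<and> C2_on {0..<1} b \<and>
     C1_on {0..1} (\<lambda>t. (a t)\<^sup>2) \<and> C1_on {0..1} b"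

definition measure_support :: "'a::topological_space measure \<Rightarrow> 'a set" where
  "measure_support M = {x. \<forall>S. open S \<longrightarrow> x \<in> S \<longrightarrow> emeasure M S > 0}"

text \<open>\<open>U\<close> is of class \<open>C\<^sup>2\<close> on \<open>\<Omega>\<close> with Hessian \<open>H\<close>. Derivatives are taken within \<open>\<Omega>\<close>; the
  definition is used for convex \<open>\<Omega>\<close> of positive Lebesgue measure, for which they are unique
  also at boundary points.\<close>

definition C2_with_Hessian ::
  "'a::euclidean_space set \<Rightarrow> ('a \<Rightarrow> real) \<Rightarrow> ('a \<Rightarrow> 'a \<Rightarrow>\<^sub>L 'a) \<Rightarrow> bool" where
  "C2_with_Hessian \<Omega> U H \<longleftrightarrow>
     (\<exists>G. \<forall>x\<in>\<Omega>. (U has_derivative (\<lambda>h. G x \<bullet> h)) (at x within \<Omega>) \<and>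
                  (G has_derivative blinfun_apply (H x)) (at x within \<Omega>)) \<and>
     continuous_on \<Omega> H"

definition has_potential :: "'a::euclidean_space measure \<Rightarrow> ('a \<Rightarrow> real) \<Rightarrow> bool" where
  "has_potential \<nu> U \<longleftrightarrow>
     \<nu> = density lborel (\<lambda>x. ennreal (indicator (measure_support \<nu>) x * exp (- U x)))"

definition semi_log_concave :: "real \<Rightarrow> 'a::euclidean_space measure \<Rightarrow> bool" where
  "semi_log_concave \<kappa> \<nu> \<longleftrightarrow>
     prob_space \<nu> \<and> convex (measure_support \<nu>) \<and>
     (\<exists>U H. has_potential \<nu> U \<and> C2_with_Hessian (measure_support \<nu>) U H \<and>
        (\<forall>x\<in>measure_support \<nu>. \<forall>h. h \<bullet> blinfun_apply (H x) h \<ge> \<kappa> * (h \<bullet> h)))"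

definition semi_log_convex :: "real \<Rightarrow> 'a::euclidean_space measure \<Rightarrow> bool" where
  "semi_log_convex \<beta> \<nu> \<longleftrightarrow>
     prob_space \<nu> \<and> convex (measure_support \<nu>) \<and>
     (\<exists>U H. has_potential \<nu> U \<and> C2_with_Hessian (measure_support \<nu>) U H \<and>
        (\<forall>x\<in>measure_support \<nu>. \<forall>h. h \<bullet> blinfun_apply (H x) h \<le> \<beta> * (h \<bullet> h)))"

definition std_gaussian :: "'a::euclidean_space measure" where
  "std_gaussian = density lborel (\<lambda>x. ennreal (\<Prod>i\<in>Basis. std_normal_density (x \<bullet> i)))"

text \<open>\<open>f\<close> is the continuous version of \<open>x \<mapsto> E[Y | W = x]\<close>. Conditional expectations
  determine \<open>f\<close> only almost everywhere with respect to the law of \<open>W\<close>; continuity determines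
  it everywhere as soon as this law has full support.\<close>

definition continuous_cond_exp_given ::
  "'w measure \<Rightarrow> ('w \<Rightarrow> 'a::euclidean_space) \<Rightarrow> ('w \<Rightarrow> 'a) \<Rightarrow> ('a \<Rightarrow> 'a) \<Rightarrow> bool" where
  "continuous_cond_exp_given M Y W f \<longleftrightarrow>
     continuous_on UNIV f \<and>
     (\<forall>i\<in>Basis. AE \<omega> in M.
        real_cond_exp M (vimage_algebra (space M) W borel) (\<lambda>\<omega>. Y \<omega> \<bullet> i) \<omega> = f (W \<omega>) \<bullet> i)"

text \<open>\<open>Z\<close> is the Gaussian variable, \<open>Y\<close> the variable with the target law. For \<open>0 < t < 1\<close> the
  interpolant has an everywhere positive density, so \<open>v\<close> is unique on \<open>[0,1]\<close>.\<close>

definition velocity_field ::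
  "(real \<Rightarrow> real) \<Rightarrow> (real \<Rightarrow> real) \<Rightarrow> 'w measure \<Rightarrow> ('w \<Rightarrow> 'a::euclidean_space) \<Rightarrow> ('w \<Rightarrow> 'a)
     \<Rightarrow> (real \<Rightarrow> 'a \<Rightarrow> 'a) \<Rightarrow> bool" where
  "velocity_field a b M Z Y v \<longleftrightarrow>
     (\<forall>t\<in>{0<..<1}. continuous_cond_exp_given M
        (\<lambda>\<omega>. time_deriv a t *\<^sub>R Z \<omega> + time_deriv b t *\<^sub>R Y \<omega>)
        (\<lambda>\<omega>. a t *\<^sub>R Z \<omega> + b t *\<^sub>R Y \<omega>) (v t)) \<and>
     (\<forall>x. v 0 x = Lim (at_right 0) (\<lambda>t. v t x)) \<and>
     (\<forall>x. v 1 x = Lim (at_left 1) (\<lambda>t. v t x))"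

definition flow_of :: "(real \<Rightarrow> 'a::euclidean_space \<Rightarrow> 'a) \<Rightarrow> (real \<Rightarrow> 'a \<Rightarrow> 'a) \<Rightarrow> bool" where
  "flow_of v X \<longleftrightarrow>
     (\<forall>x. X 0 x = x \<and>
        (\<forall>t\<in>{0..1}. ((\<lambda>s. X s x) has_vector_derivative v t (X t x)) (at t within {0..1})))"

text \<open>Spectral norm of the Jacobian; meaningful only where \<open>f\<close> is differentiable.\<close>

definition jacobian_norm :: "('a::euclidean_space \<Rightarrow> 'a) \<Rightarrow> 'a \<Rightarrow> real" where
  "jacobian_norm f x = onorm (frechet_derivative f (at x))"

end

theory Submission
  imports Defs
begin

text \<open>
  Completing the square in the Gaussian density shows that the law of the target variable given
  \<open>X\<^sub>t = x\<close> is \<open>\<nu>\<close> tilted by \<open>exp (\<xi> \<bullet> y - \<tau> |y|\<^sup>2 / 2)\<close> with \<open>\<xi> = b x / a\<^sup>2\<close> and \<open>\<tau> = b\<^sup>2 / a\<^sup>2\<close>, so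
  \<open>v\<close> is affine in the mean of this measure and its Jacobian is affine in the covariance. The
  potential of the tilted measure has Hessian between \<open>\<kappa> + \<tau>\<close> and \<open>\<beta> + \<tau>\<close>, hence the covariance
  lies between \<open>1 / (\<beta> + \<tau>)\<close> and \<open>1 / (\<kappa> + \<tau>)\<close>. Both bounds are read off, to second order in
  \<open>s\<close>, from estimates of \<open>E exp (s \<bullet> y) * E exp (- s \<bullet> y)\<close> by \<open>exp (|s|\<^sup>2 / c)\<close>: from above by the
  Prekopa--Leindler inequality, from below by Cauchy--Schwarz after a translation. With
  \<open>q = k a\<^sup>2 + b\<^sup>2\<close> they say that the Jacobian of \<open>v\<close> is at most \<open>q' / (2 q)\<close> for \<open>k = \<kappa>\<close> and at
  least \<open>q' / (2 q)\<close> for \<open>k = \<beta>\<close>, so the squared distance of two trajectories divided by \<open>q\<close> is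
  monotone. Differentiability of the flow in the initial point does not use the variational
  equation: Gronwall's inequality shows that a linear relation between small increments of the
  initial point persists up to a small error, which makes the difference quotients converge.
\<close>

section \<open>The Prekopa--Leindler inequality\<close>

text \<open>Classically the covariance bounds come from the Brascamp--Lieb and Cramer--Rao
  inequalities, which integrate by parts and need control of \<open>U\<close> at infinity. Here only
  second differences of the potential enter, through integral inequalities for measurable functions.
  The product of the transforms at \<open>s\<close> and \<open>- s\<close> is unchanged by
  translating the measure: the unknown mean drops out, and a bound on the product yields finiteness
  of each factor.

  The obstacle in time is the endpoint \<open>1\<close>: since \<open>a 1 = 0\<close>, single terms
  of the Jacobian of \<open>v\<close> are unbounded there. Their sum is squeezed between half the
  logarithmic derivatives of two functions \<open>q\<close> that are positive and continuously
  differentiable on the closed interval, which gives one Lipschitz constant for all times. A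
  quadratic remainder is available uniformly only away from the endpoints, so differentiability uses
  the Lipschitz bound alone on two short time layers and the remainder in between. For this one pair
  of curvature bounds is fixed; the final estimates hold for every admissible \<kappa> and
  \<beta>.\<close>

lemma emeasure_lborel_affine_vimage:
  fixes A :: "real set"
  assumes [measurable]: "A \<in> sets borel" and "c > 0"
  shows "emeasure lborel A = ennreal c * emeasure lborel ((\<lambda>x. t + c * x) -` A)"
proof -
  have m: "(\<lambda>x. t + c * x) -` A \<in> sets borel"
    using measurable_sets_borel[of "\<lambda>x. t + c * x" borel A] by simp
  have "emeasure lborel A = (\<integral>\<^sup>+x. indicator A x \<partial>lborel)"
    by simp
  also have "\<dots> = \<bar>c\<bar> * (\<integral>\<^sup>+x. indicator A (t + c * x) \<partial>lborel)"
    by (rule nn_integral_real_affine) (use assms in auto)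
  also have "(\<integral>\<^sup>+x. indicator A (t + c * x) \<partial>lborel)
      = (\<integral>\<^sup>+x. indicator ((\<lambda>x. t + c * x) -` A) x \<partial>lborel)"
    by (intro nn_integral_cong) (auto simp: indicator_def)
  also have "\<dots> = emeasure lborel ((\<lambda>x. t + c * x) -` A)"
    using m by simp
  finally show ?thesis using assms by simp
qed

lemma brunn_minkowski_bounded:
  fixes A B C :: "real set"
  assumes [measurable]: "A \<in> sets borel" "B \<in> sets borel" "C \<in> sets borel"
    and ne: "A \<noteq> {}" "B \<noteq> {}" and bd: "bdd_above A" "bdd_below B"
    and mid: "\<And>x y. x \<in> A \<Longrightarrow> y \<in> B \<Longrightarrow> (x + y) / 2 \<in> C"
  shows "emeasure lborel A + emeasure lborel B \<le> 2 * emeasure lborel C"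
proof (rule ennreal_le_epsilon)
  let ?m = "emeasure lborel :: real set \<Rightarrow> _"
  fix e :: real assume e: "e > 0"
  obtain \<alpha> where \<alpha>: "\<alpha> \<in> A" "\<alpha> > Sup A - e / 2"
    using less_cSupE[of "Sup A - e / 2" A] e ne by auto
  obtain \<beta> where \<beta>: "\<beta> \<in> B" "\<beta> < Inf B + e / 2"
    using cInf_lessD[of B "Inf B + e / 2"] e ne by auto
  define A' where "A' = (\<lambda>x. - \<beta> + 2 * x) -` A"
  define B' where "B' = (\<lambda>x. - \<alpha> + 2 * x) -` B"
  have [measurable]: "A' \<in> sets borel" "B' \<in> sets borel"
    unfolding A'_def B'_def
    using measurable_sets_borel[of "\<lambda>x. - \<beta> + 2 * x" borel A]
      measurable_sets_borel[of "\<lambda>x. - \<alpha> + 2 * x" borel B] by auto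
  have "A' \<union> B' \<subseteq> C"
  proof
    fix x assume "x \<in> A' \<union> B'"
    then have "(2 * x - \<beta>) \<in> A \<or> (2 * x - \<alpha>) \<in> B"
      by (auto simp: A'_def B'_def algebra_simps)
    then show "x \<in> C"
      using mid[of "2 * x - \<beta>" \<beta>] mid[of \<alpha> "2 * x - \<alpha>"] \<alpha> \<beta> by auto
  qed
  have "A' \<inter> B' \<subseteq> {(Sup A + Inf B - e / 2) / 2 .. (Sup A + Inf B + e / 2) / 2}"
  proof
    fix x assume "x \<in> A' \<inter> B'"
    then have "2 * x - \<beta> \<in> A" "2 * x - \<alpha> \<in> B"
      by (auto simp: A'_def B'_def algebra_simps)
    then have "2 * x - \<beta> \<le> Sup A" "2 * x - \<alpha> \<ge> Inf B"
      using bd by (auto simp only: intro!: cSup_upper cInf_lower)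
    then show "x \<in> {(Sup A + Inf B - e / 2) / 2 .. (Sup A + Inf B + e / 2) / 2}"
      using \<alpha> \<beta> by auto
  qed
  then have "?m (A' \<inter> B')
      \<le> ?m {(Sup A + Inf B - e / 2) / 2 .. (Sup A + Inf B + e / 2) / 2}"
    by (intro emeasure_mono) auto
  also have "\<dots> = ennreal (e / 2)"
    using e by (simp add: field_simps)
  finally have int: "?m (A' \<inter> B') \<le> ennreal (e / 2)" .
  have "?m A + ?m B = 2 * (?m A' + ?m B')"
    unfolding A'_def B'_def
    using emeasure_lborel_affine_vimage[of A 2 "- \<beta>"] emeasure_lborel_affine_vimage[of B 2 "- \<alpha>"]
    by (simp add: distrib_left)
  also have "?m A' + ?m B'
      = ?m (A' \<union> B') + ?m (A' \<inter> B')"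
    by (rule emeasure_Un_Int) auto
  also have "\<dots> \<le> ?m C + ennreal (e / 2)"
    using \<open>A' \<union> B' \<subseteq> C\<close> int by (intro add_mono emeasure_mono) auto
  finally have "?m A + ?m B \<le> 2 * (?m C + ennreal (e / 2))"
    by (simp add: mult_left_mono)
  also have "\<dots> = 2 * ?m C + 2 * ennreal (e/2)"
    by (simp add: distrib_left)
  also have "2 * ennreal (e/2) = ennreal e"
    using e by (metis ennreal_mult'' ennreal_numeral field_sum_of_halves less_eq_real_def mult_2 half_gt_zero)
  finally show "?m A + ?m B \<le> 2 * ?m C + ennreal e" .
qed

text \<open>One-sided truncation suffices, since the bounded case asks only for a bound on
  \<open>A\<close> from above and on \<open>B\<close> from below.\<close>

lemma brunn_minkowski_real:
  fixes A B C :: "real set"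
  assumes [measurable]: "A \<in> sets borel" "B \<in> sets borel" "C \<in> sets borel"
    and ne: "A \<noteq> {}" "B \<noteq> {}"
    and mid: "\<And>x y. x \<in> A \<Longrightarrow> y \<in> B \<Longrightarrow> (x + y) / 2 \<in> C"
  shows "emeasure lborel A + emeasure lborel B \<le> 2 * emeasure lborel C"
proof -
  define A' where "A' n = A \<inter> {..real n}" for n
  define B' where "B' n = B \<inter> {- real n..}" for n
  have [measurable]: "A' n \<in> sets borel" "B' n \<in> sets borel" for n
    by (auto simp: A'_def B'_def)
  have U: "(\<Union>n. A' n) = A" "(\<Union>n. B' n) = B"
    unfolding A'_def B'_def using real_arch_simple
    by (auto, metis minus_le_iff)
  have inc: "incseq A'" "incseq B'"
    by (auto simp: incseq_def A'_def B'_def)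
  have "(\<lambda>n. emeasure lborel (A' n)) \<longlonglongrightarrow> emeasure lborel (\<Union>n. A' n)"
       "(\<lambda>n. emeasure lborel (B' n)) \<longlonglongrightarrow> emeasure lborel (\<Union>n. B' n)"
    by (intro Lim_emeasure_incseq inc; auto)+
  then have lim: "(\<lambda>n. emeasure lborel (A' n) + emeasure lborel (B' n))
      \<longlonglongrightarrow> emeasure lborel A + emeasure lborel B"
    unfolding U by (intro tendsto_add)
  obtain x y where xy: "x \<in> A" "y \<in> B" using ne by auto
  obtain N where N: "real N \<ge> \<bar>x\<bar> + \<bar>y\<bar>" using real_arch_simple by blast
  have "emeasure lborel (A' n) + emeasure lborel (B' n) \<le> 2 * emeasure lborel C" if "n \<ge> N" for n
  proof (rule brunn_minkowski_bounded)
    have "real n \<ge> \<bar>x\<bar> + \<bar>y\<bar>" using N that by linarith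
    then have "x \<in> A' n" "y \<in> B' n"
      using xy by (auto simp: A'_def B'_def)
    then show "A' n \<noteq> {}" "B' n \<noteq> {}" by auto
  qed (auto simp: A'_def B'_def intro: mid bdd_aboveI[of _ "real n"] bdd_belowI[of _ "- real n"])
  then show ?thesis
    by (intro LIMSEQ_le_const2[OF lim]) blast
qed

section \<open>The Prekopa--Leindler inequality on the line\<close>

lemma emeasure_lborel_Ici_real: "emeasure lborel {a::real..} = \<infinity>"
proof (rule ccontr)
  assume "emeasure lborel {a..} \<noteq> \<infinity>"
  then obtain r where r: "emeasure lborel {a..} = ennreal r" "r \<ge> 0"
    by (cases "emeasure lborel {a..}" rule: ennreal_cases) auto
  have "ennreal (r + 1) = emeasure lborel {a..a + (r + 1)}"
    using r by simp
  also have "\<dots> \<le> emeasure lborel {a..}"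
    by (intro emeasure_mono) auto
  finally show False using r by (simp add: ennreal_le_iff)
qed

lemma nn_integral_layer_cake:
  fixes f :: "real \<Rightarrow> ennreal"
  assumes [measurable]: "f \<in> borel_measurable borel"
  shows "integral\<^sup>N lborel f = (\<integral>\<^sup>+s. indicator {0..} s * emeasure lborel {x. ennreal s < f x} \<partial>lborel)"
proof -
  have f: "f x = (\<integral>\<^sup>+s. indicator {0..} s * indicator {x. ennreal s < f x} x \<partial>lborel)" for x
  proof -
    have "(\<integral>\<^sup>+s. indicator {0..} s * indicator {x. ennreal s < f x} x \<partial>lborel)
        = (\<integral>\<^sup>+s. indicator {s. 0 \<le> s \<and> ennreal s < f x} s \<partial>lborel)"
      by (intro nn_integral_cong) (auto simp: indicator_def)
    also have "\<dots> = emeasure lborel {s. 0 \<le> s \<and> ennreal s < f x}"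
      by (intro nn_integral_indicator) auto
    also have "\<dots> = f x"
    proof (cases "f x" rule: ennreal_cases)
      case (real r)
      then have "{s. 0 \<le> s \<and> ennreal s < f x} = {0..<r}"
        by (auto simp: ennreal_less_iff)
      then show ?thesis using real by simp
    next
      case top
      then have "{s. 0 \<le> s \<and> ennreal s < f x} = {0..}"
        by auto
      then show ?thesis using top by (simp add: emeasure_lborel_Ici_real)
    qed
    finally show ?thesis by simp
  qed
  have "integral\<^sup>N lborel f
      = (\<integral>\<^sup>+x. (\<integral>\<^sup>+s. indicator {0..} s * indicator {x. ennreal s < f x} x \<partial>lborel) \<partial>lborel)"
    by (intro nn_integral_cong) (rule f)
  also have "\<dots> = (\<integral>\<^sup>+s. (\<integral>\<^sup>+x. indicator {0..} s * indicator {x. ennreal s < f x} x \<partial>lborel) \<partial>lborel)"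
    by (rule lborel_pair.Fubini') (simp add: indicator_def, measurable)
  also have "\<dots> = (\<integral>\<^sup>+s. indicator {0..} s * emeasure lborel {x. ennreal s < f x} \<partial>lborel)"
    by (intro nn_integral_cong) (auto simp: nn_integral_cmult)
  finally show ?thesis .
qed


text \<open>The arithmetic-geometric mean inequality; it turns the additive bound that level sets
  provide into a multiplicative one.\<close>

lemma ennreal_mult_le_square:
  fixes a b h :: ennreal
  assumes "a + b \<le> 2 * h"
  shows "a * b \<le> h\<^sup>2"
proof (cases "h = \<top>")
  case True
  then show ?thesis by (simp add: power2_eq_square ennreal_top_mult)
next
  case False
  then have "2 * h < \<top>" by (auto simp: ennreal_mult_less_top top.not_eq_extremum)
  then have "a + b < \<top>" using assms by (rule order_le_less_trans[rotated])
  then obtain x y z where xyz: "a = ennreal x" "b = ennreal y" "h = ennreal z" "x \<ge> 0" "y \<ge> 0" "z \<ge> 0"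
    using False by (cases a b h rule: ennreal3_cases) auto
  have "ennreal (x + y) \<le> ennreal (2 * z)"
    using assms xyz by (simp add: ennreal_mult ennreal_plus)
  then have "x + y \<le> 2 * z" using xyz by (simp add: ennreal_le_iff del: ennreal_plus)
  then have "(x + y)\<^sup>2 \<le> (2 * z)\<^sup>2"
    using xyz by (intro power_mono) auto
  moreover have "4 * (x * y) \<le> (x + y)\<^sup>2"
    using sum_squares_ge_zero[of "x - y" 0] by (simp add: power2_eq_square algebra_simps)
  ultimately have "x * y \<le> z\<^sup>2" by (simp add: power_mult_distrib)
  then show ?thesis using xyz by (simp add: ennreal_mult[symmetric] ennreal_power)
qed

lemma mult_strict_mono_ennreal:
  fixes a b c d :: ennreal
  assumes "a < b" "c < d"
  shows "a * c < b * d"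
proof -
  have "a * c \<le> b * c" using assms by (intro mult_right_mono) auto
  show ?thesis
  proof (cases "b = \<top>")
    case True
    moreover have "a < \<top>" "c < \<top>"
      using assms by (auto intro: less_le_trans)
    then have "a * c < \<top>"
      by (simp add: ennreal_mult_less_top)
    \<comment> \<open>Required because \<open>\<top> * 0 = 0\<close> in
      \<open>ennreal\<close>.\<close>
    moreover have "d \<noteq> 0" using assms by auto
    ultimately show ?thesis by (simp add: ennreal_top_mult)
  next
    case False
    then have "b * c < b * d"
      using assms by (intro ennreal_mult_strict_left_mono)
        (auto simp: top.not_eq_extremum intro: le_less_trans[of 0 a])
    then show ?thesis using \<open>a * c \<le> b * c\<close> by order
  qed
qed

text \<open>With equal suprema the level sets of \<open>f\<close> and \<open>g\<close> become empty
  at the same height, so at each level either both are nonempty and Brunn--Minkowski applies, or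
  both contribute nothing. Integration over the level gives an additive inequality, stronger than
  the product form.\<close>

lemma prekopa_leindler_normalized:
  fixes f g h :: "real \<Rightarrow> ennreal"
  assumes [measurable]: "f \<in> borel_measurable borel" "g \<in> borel_measurable borel"
    "h \<in> borel_measurable borel"
    and sup: "(SUP x. f x) = 1" "(SUP x. g x) = 1"
    and mid: "\<And>x y. f x * g y \<le> (h ((x + y) / 2))\<^sup>2"
  shows "integral\<^sup>N lborel f * integral\<^sup>N lborel g \<le> (integral\<^sup>N lborel h)\<^sup>2"
proof (rule ennreal_mult_le_square)
  define E where "E f s = indicator {0..} s * emeasure lborel {x::real. ennreal s < f x}"
    for f :: "real \<Rightarrow> ennreal" and s :: real
  have le1: "f x \<le> 1" "g x \<le> 1" for x
    using sup SUP_upper[of x UNIV f] SUP_upper[of x UNIV g] by auto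
  have E: "E f s + E g s \<le> 2 * E h s" for s
  proof (cases "0 \<le> s \<and> s < 1")
    case True
    then have s1: "ennreal s < 1" by (simp add: ennreal_less_one_iff)
    have "\<exists>x. ennreal s < f x" "\<exists>x. ennreal s < g x"
      using s1 sup less_SUP_iff[of "ennreal s" f UNIV] less_SUP_iff[of "ennreal s" g UNIV] by auto
    moreover have "ennreal s < h ((x + y) / 2)" if "ennreal s < f x" "ennreal s < g y" for x y
    proof (rule ccontr)
      assume "\<not> ennreal s < h ((x + y) / 2)"
      then have "(h ((x + y) / 2))\<^sup>2 \<le> (ennreal s)\<^sup>2"
        by (intro power_mono) auto
      also have "\<dots> < f x * g y"
        unfolding power2_eq_square using that by (intro mult_strict_mono_ennreal) auto
      finally show False using mid[of x y] by simp
    qed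
    ultimately show ?thesis
      using True unfolding E_def
      by (auto intro!: brunn_minkowski_real)
  next
    case False
    have "{x. ennreal s < f x} = {}" "{x. ennreal s < g x} = {}" if "s \<ge> 1"
    proof -
      have "1 \<le> ennreal s" using that by (simp add: ennreal_ge_1)
      then show "{x. ennreal s < f x} = {}" "{x. ennreal s < g x} = {}"
        using order_trans[OF le1(1)] order_trans[OF le1(2)] by (auto simp: not_less)
    qed
    then have "E f s = 0" "E g s = 0"
      using False by (auto simp: E_def indicator_def)
    then show ?thesis by simp
  qed
  have [measurable]: "E f \<in> borel_measurable borel" if [measurable]: "f \<in> borel_measurable borel" for f
    unfolding E_def by measurable
  have "integral\<^sup>N lborel f + integral\<^sup>N lborel g
      = (\<integral>\<^sup>+s. E f s \<partial>lborel) + (\<integral>\<^sup>+s. E g s \<partial>lborel)"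
    unfolding E_def nn_integral_layer_cake[OF assms(1)] nn_integral_layer_cake[OF assms(2)] ..
  also have "\<dots> = (\<integral>\<^sup>+s. E f s + E g s \<partial>lborel)"
    by (rule nn_integral_add[symmetric]) auto
  also have "\<dots> \<le> (\<integral>\<^sup>+s. 2 * E h s \<partial>lborel)"
    by (intro nn_integral_mono E)
  also have "\<dots> = 2 * (\<integral>\<^sup>+s. E h s \<partial>lborel)"
    by (rule nn_integral_cmult) auto
  also have "(\<integral>\<^sup>+s. E h s \<partial>lborel) = integral\<^sup>N lborel h"
    unfolding E_def nn_integral_layer_cake[OF assms(3)] ..
  finally show "integral\<^sup>N lborel f + integral\<^sup>N lborel g \<le> 2 * integral\<^sup>N lborel h" .
qed

lemma prekopa_leindler_bounded:
  fixes f g h :: "real \<Rightarrow> ennreal"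
  assumes [measurable]: "f \<in> borel_measurable borel" "g \<in> borel_measurable borel"
    "h \<in> borel_measurable borel"
    and bd: "\<And>x. f x \<le> ennreal n" "\<And>x. g x \<le> ennreal n"
    and mid: "\<And>x y. f x * g y \<le> (h ((x + y) / 2))\<^sup>2"
  shows "integral\<^sup>N lborel f * integral\<^sup>N lborel g \<le> (integral\<^sup>N lborel h)\<^sup>2"
proof -
  define \<alpha> where "\<alpha> = (SUP x. f x)"
  define \<beta> where "\<beta> = (SUP x. g x)"
  have "\<alpha> \<le> ennreal n" "\<beta> \<le> ennreal n"
    unfolding \<alpha>_def \<beta>_def using bd by (auto intro: SUP_least)
  then have "\<alpha> < \<top>" "\<beta> < \<top>" by (auto intro: order_le_less_trans)
  then obtain a b where ab: "\<alpha> = ennreal a" "a \<ge> 0" "\<beta> = ennreal b" "b \<ge> 0"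
    by (cases \<alpha> \<beta> rule: ennreal2_cases) auto
  show ?thesis
  proof (cases "a = 0 \<or> b = 0")
    case True
    then have "f = (\<lambda>_. 0) \<or> g = (\<lambda>_. 0)"
      using ab SUP_upper[of _ UNIV f] SUP_upper[of _ UNIV g] unfolding \<alpha>_def \<beta>_def by auto
    then show ?thesis by auto
  next
    case False
    then have pos: "a > 0" "b > 0" using ab by auto
    \<comment> \<open>The midpoint hypothesis has degree one in each of \<open>f\<close> and
      \<open>g\<close> and degree two in \<open>h\<close>: dividing \<open>f\<close> by
      \<open>a\<close> and \<open>g\<close> by \<open>b\<close> forces division of \<open>h\<close>
      by \<open>sqrt (a * b)\<close>.\<close>
    define c where "c = sqrt (a * b)"
    have c: "c > 0" "c\<^sup>2 = a * b" using pos by (auto simp: c_def)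
    define F where "F x = ennreal (1 / a) * f x" for x
    define G where "G x = ennreal (1 / b) * g x" for x
    define H where "H x = ennreal (1 / c) * h x" for x
    have FGH: "integral\<^sup>N lborel F * integral\<^sup>N lborel G \<le> (integral\<^sup>N lborel H)\<^sup>2"
    proof (rule prekopa_leindler_normalized)
      show "(SUP x. F x) = 1" "(SUP x. G x) = 1"
      proof -
        have "(SUP x. F x) = ennreal (1 / a) * ennreal a"
          unfolding F_def SUP_mult_left_ennreal[symmetric] using ab(1) \<alpha>_def by simp
        also have "\<dots> = ennreal (1 / a * a)"
          using pos by (intro ennreal_mult[symmetric]) auto
        finally show "(SUP x. F x) = 1" using pos by simp
        have "(SUP x. G x) = ennreal (1 / b) * ennreal b"
          unfolding G_def SUP_mult_left_ennreal[symmetric] using ab(3) \<beta>_def by simp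
        also have "\<dots> = ennreal (1 / b * b)"
          using pos by (intro ennreal_mult[symmetric]) auto
        finally show "(SUP x. G x) = 1" using pos by simp
      qed
      fix x y
      have "F x * G y = ennreal (1 / a * (1 / b)) * (f x * g y)"
        using pos unfolding F_def G_def by (subst ennreal_mult) (simp_all add: mult_ac)
      also have "\<dots> \<le> ennreal ((1 / c)\<^sup>2) * (h ((x + y) / 2))\<^sup>2"
        using mid c by (intro mult_mono) (auto simp: power_divide)
      also have "\<dots> = (H ((x + y) / 2))\<^sup>2"
        using c unfolding H_def by (simp add: power_mult_distrib ennreal_power)
      finally show "F x * G y \<le> (H ((x + y) / 2))\<^sup>2" .
    qed (auto simp: F_def[abs_def] G_def[abs_def] H_def[abs_def])
    have scaled: "ennreal (c\<^sup>2) * (ennreal (1 / a * (1 / b)) * (integral\<^sup>N lborel f * integral\<^sup>N lborel g))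
       \<le> ennreal (c\<^sup>2) * (ennreal ((1 / c)\<^sup>2) * (integral\<^sup>N lborel h)\<^sup>2)"
    proof (intro mult_left_mono)
      note FGH
      moreover have "integral\<^sup>N lborel F * integral\<^sup>N lborel G
          = ennreal (1 / a) * ennreal (1 / b) * (integral\<^sup>N lborel f * integral\<^sup>N lborel g)"
        unfolding F_def G_def
        by (subst (1 2) nn_integral_cmult) (simp_all add: mult_ac)
      moreover have "(integral\<^sup>N lborel H)\<^sup>2 = (ennreal (1 / c))\<^sup>2 * (integral\<^sup>N lborel h)\<^sup>2"
        unfolding H_def by (simp add: nn_integral_cmult power_mult_distrib)
      moreover have "ennreal (1 / a) * ennreal (1 / b) = ennreal (1 / a * (1 / b))"
        using pos by (intro ennreal_mult[symmetric]) auto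
      moreover have "(ennreal (1 / c))\<^sup>2 = ennreal ((1 / c)\<^sup>2)"
        using c by (intro ennreal_power) auto
      ultimately show "ennreal (1 / a * (1 / b)) * (integral\<^sup>N lborel f * integral\<^sup>N lborel g)
          \<le> ennreal ((1 / c)\<^sup>2) * (integral\<^sup>N lborel h)\<^sup>2" by simp
    qed simp
    from this have "ennreal (c\<^sup>2 * (1 / a * (1 / b))) * (integral\<^sup>N lborel f * integral\<^sup>N lborel g)
       \<le> ennreal (c\<^sup>2 * (1 / c)\<^sup>2) * (integral\<^sup>N lborel h)\<^sup>2"
    proof -
      have "ennreal (c\<^sup>2 * (1 / a * (1 / b))) = ennreal (c\<^sup>2) * ennreal (1 / a * (1 / b))"
        using pos by (intro ennreal_mult) auto
      moreover have "ennreal (c\<^sup>2 * (1 / c)\<^sup>2) = ennreal (c\<^sup>2) * ennreal ((1 / c)\<^sup>2)"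
        by (intro ennreal_mult) auto
      ultimately show ?thesis using scaled by (simp only: mult.assoc)
    qed
    moreover have "c\<^sup>2 * (1 / a * (1 / b)) = 1" "c\<^sup>2 * (1 / c)\<^sup>2 = 1"
      using pos c by (simp_all add: power_divide)
    ultimately show ?thesis by (simp only: ennreal_1 mult_1)
  qed
qed

text \<open>Cutting \<open>f\<close> and \<open>g\<close> off at independent heights preserves the
  hypothesis with the same \<open>h\<close>; the two suprema then leave the product one at a
  time.\<close>

lemma prekopa_leindler_real:
  fixes f g h :: "real \<Rightarrow> ennreal"
  assumes [measurable]: "f \<in> borel_measurable borel" "g \<in> borel_measurable borel"
    "h \<in> borel_measurable borel"
    and mid: "\<And>x y. f x * g y \<le> (h ((x + y) / 2))\<^sup>2"
  shows "integral\<^sup>N lborel f * integral\<^sup>N lborel g \<le> (integral\<^sup>N lborel h)\<^sup>2"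
proof -
  have trunc: "integral\<^sup>N lborel u = (SUP n. \<integral>\<^sup>+x. min (u x) (of_nat n) \<partial>lborel)"
    if [measurable]: "u \<in> borel_measurable borel" for u :: "real \<Rightarrow> ennreal"
  proof -
    have "u x = (SUP n. min (u x) (of_nat n))" for x
    proof (cases "u x" rule: ennreal_cases)
      case (real r)
      obtain n where "r \<le> real n" using real_arch_simple by blast
      then have "u x \<le> of_nat n"
        using real by (simp add: ennreal_of_nat_eq_real_of_nat ennreal_leI)
      then have "min (u x) (of_nat n) = u x" by simp
      then show ?thesis by (intro antisym SUP_least SUP_upper2[of n]) auto
    next
      case top
      then show ?thesis using ennreal_SUP_of_nat_eq_top[symmetric] by (simp add: min_absorb2)
    qed
    then have "integral\<^sup>N lborel u = (\<integral>\<^sup>+x. (SUP n. min (u x) (of_nat n)) \<partial>lborel)"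
      by simp
    also have "\<dots> = (SUP n. \<integral>\<^sup>+x. min (u x) (of_nat n) \<partial>lborel)"
      by (intro nn_integral_monotone_convergence_SUP)
         (auto simp: incseq_def le_fun_def min_def intro: order_trans)
    finally show ?thesis .
  qed
  have "(\<integral>\<^sup>+x. min (f x) (of_nat m) \<partial>lborel) * (\<integral>\<^sup>+x. min (g x) (of_nat n) \<partial>lborel)
      \<le> (integral\<^sup>N lborel h)\<^sup>2" for m n
  proof (rule prekopa_leindler_bounded[where n = "real (max m n)"])
    show "min (f x) (of_nat m) \<le> ennreal (real (max m n))"
      "min (g x) (of_nat n) \<le> ennreal (real (max m n))" for x
      by (auto simp: ennreal_of_nat_eq_real_of_nat min_le_iff_disj ennreal_leI)
    show "min (f x) (of_nat m) * min (g y) (of_nat n) \<le> (h ((x + y) / 2))\<^sup>2" for x y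
      by (rule order_trans[OF _ mid]) (intro mult_mono, auto)
  qed auto
  then show ?thesis
    unfolding trunc[OF assms(1)] trunc[OF assms(2)]
    by (simp only: SUP_mult_left_ennreal SUP_mult_right_ennreal SUP_le_iff simp_thms ball_UNIV)
qed

section \<open>Prekopa--Leindler in several dimensions\<close>

abbreviation LPi :: "'i set \<Rightarrow> ('i \<Rightarrow> real) measure" where "LPi I \<equiv> Pi\<^sub>M I (\<lambda>_. lborel)"

text \<open>For fixed remaining coordinates, the one-dimensional inequality in coordinate
  \<open>i\<close> shows that the partial integrals satisfy the midpoint hypothesis again, so the
  inequality tensorises. Points of the product space are extensional functions, hence the restricted
  hypothesis and the restricted midpoint.\<close>

lemma prekopa_leindler_PiM:
  fixes I :: "'i set" and f g h :: "('i \<Rightarrow> real) \<Rightarrow> ennreal"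
  assumes "finite I"
    and "f \<in> borel_measurable (LPi I)"
    and "g \<in> borel_measurable (LPi I)"
    and "h \<in> borel_measurable (LPi I)"
    and "\<And>x y. x \<in> extensional I \<Longrightarrow> y \<in> extensional I \<Longrightarrow>
          f x * g y \<le> (h (\<lambda>i\<in>I. (x i + y i) / 2))\<^sup>2"
  shows "integral\<^sup>N (LPi I) f * integral\<^sup>N (LPi I) g
    \<le> (integral\<^sup>N (LPi I) h)\<^sup>2"
  using assms
proof (induction I arbitrary: f g h)
  case empty
  \<comment> \<open>The empty product has a single point, the function that is constantly
    \<open>undefined\<close>.\<close>
  from empty(4)[of "\<lambda>_. undefined" "\<lambda>_. undefined"] show ?case
    by (simp add: product_sigma_finite.nn_integral_empty product_sigma_finite_def
        lborel.sigma_finite_measure_axioms restrict_def)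
next
  case (insert i I)
  interpret product_sigma_finite "\<lambda>_::'i. lborel :: real measure"
    by (simp add: product_sigma_finite_def lborel.sigma_finite_measure_axioms)
  note [measurable] = insert.prems(1-3)
  note mid = insert.prems(4)
  have split: "integral\<^sup>N (LPi (insert i I)) u
      = (\<integral>\<^sup>+x. (\<integral>\<^sup>+s. u (x(i := s)) \<partial>lborel) \<partial>LPi I)"
    if "u \<in> borel_measurable (LPi (insert i I))" for u :: "('i \<Rightarrow> real) \<Rightarrow> ennreal"
    using that insert.hyps by (intro product_nn_integral_insert) auto
  have meas: "(\<lambda>x. \<integral>\<^sup>+s. u (x(i := s)) \<partial>lborel) \<in> borel_measurable (LPi I)"
    if [measurable]: "u \<in> borel_measurable (LPi (insert i I))"
    for u :: "('i \<Rightarrow> real) \<Rightarrow> ennreal"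
    by measurable
  have meas': "(\<lambda>s. u (x(i := s))) \<in> borel_measurable borel"
    if [measurable]: "u \<in> borel_measurable (LPi (insert i I))" and "x \<in> extensional I"
    for x and u :: "('i \<Rightarrow> real) \<Rightarrow> ennreal"
  proof -
    have "x \<in> space (Pi\<^sub>M I (\<lambda>_. lborel :: real measure))"
      using that by (simp add: space_PiM PiE_def)
    then have "(\<lambda>s. x(i := s)) \<in> measurable lborel (LPi (insert i I))"
      by measurable
    then show ?thesis using that(1) by measurable
  qed
  show ?case
    unfolding split[OF insert.prems(1)] split[OF insert.prems(2)] split[OF insert.prems(3)]
  proof (rule insert.IH)
    fix x y :: "'i \<Rightarrow> real" assume x: "x \<in> extensional I" and y: "y \<in> extensional I"
    show "(\<integral>\<^sup>+s. f (x(i := s)) \<partial>lborel) * (\<integral>\<^sup>+s. g (y(i := s)) \<partial>lborel)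
      \<le> (\<integral>\<^sup>+s. h ((\<lambda>i\<in>I. (x i + y i) / 2)(i := s)) \<partial>lborel)\<^sup>2"
    proof (rule prekopa_leindler_real)
      fix s t :: real
      have "(\<lambda>j\<in>insert i I. ((x(i := s)) j + (y(i := t)) j) / 2)
          = (\<lambda>i\<in>I. (x i + y i) / 2)(i := (s + t) / 2)"
        using insert.hyps by (auto simp: fun_eq_iff restrict_def)
      moreover have "x(i := s) \<in> extensional (insert i I)" "y(i := t) \<in> extensional (insert i I)"
        using x y by (auto simp: extensional_def)
      ultimately show "f (x(i := s)) * g (y(i := t)) \<le> (h ((\<lambda>i\<in>I. (x i + y i) / 2)(i := (s + t) / 2)))\<^sup>2"
        using mid[of "x(i := s)" "y(i := t)"] by (simp only:)
    qed (use x y in \<open>auto intro!: meas'\<close>)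
  qed (use meas insert.prems(1-3) in blast)+
qed

lemma prekopa_leindler:
  fixes f g h :: "'a::euclidean_space \<Rightarrow> ennreal"
  assumes [measurable]: "f \<in> borel_measurable borel" "g \<in> borel_measurable borel"
    "h \<in> borel_measurable borel"
    and mid: "\<And>x y. f x * g y \<le> (h ((1 / 2) *\<^sub>R (x + y)))\<^sup>2"
  shows "integral\<^sup>N lborel f * integral\<^sup>N lborel g \<le> (integral\<^sup>N lborel h)\<^sup>2"
proof -
  define T where "T x = (\<Sum>b\<in>Basis. x b *\<^sub>R b)" for x :: "'a \<Rightarrow> real"
  have T[measurable]: "T \<in> borel_measurable (Pi\<^sub>M Basis (\<lambda>_. lborel))"
    unfolding T_def by measurable
  \<comment> \<open>\<open>lborel\<close> is by definition the image of the product measure under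
    \<open>T\<close>, and \<open>T\<close> commutes with midpoints.\<close>
  have lb: "integral\<^sup>N lborel u = (\<integral>\<^sup>+x. u (T x) \<partial>Pi\<^sub>M Basis (\<lambda>_. lborel))"
    if [measurable]: "u \<in> borel_measurable borel" for u :: "'a \<Rightarrow> ennreal"
    using T unfolding T_def
    by (subst lborel_def) (simp add: nn_integral_distr lborel_eq_real[symmetric])
  have "T (\<lambda>i\<in>Basis. (x i + y i) / 2) = (1 / 2) *\<^sub>R (T x + T y)" for x y
    unfolding T_def by (simp add: sum.distrib[symmetric] scaleR_sum_right scaleR_add_left[symmetric])
  then show ?thesis
    unfolding lb[OF assms(1)] lb[OF assms(2)] lb[OF assms(3)]
    by (intro prekopa_leindler_PiM) (auto simp: mid)
qed

section \<open>Exponential moments of log-concave densities\<close>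

abbreviation laplace :: "('a::euclidean_space \<Rightarrow> real) \<Rightarrow> 'a \<Rightarrow> ennreal" where
  "laplace V s \<equiv> \<integral>\<^sup>+y. ennreal (exp (s \<bullet> y - V y)) \<partial>lborel"


text \<open>Prekopa--Leindler for the densities tilted by \<open>s\<close> and \<open>- s\<close>,
  compared with a multiple of \<open>exp (- V y)\<close> at the midpoint. With \<open>d\<close> half
  the difference of the two points, the exponent gains \<open>2 * (s \<bullet> d)\<close> and loses
  \<open>c * (d \<bullet> d)\<close>; completing the square bounds the balance by
  \<open>(s \<bullet> s) / c\<close>.\<close>

lemma nn_integral_exp_mult_le:
  fixes V :: "'a::euclidean_space \<Rightarrow> real"
  assumes [measurable]: "V \<in> borel_measurable borel" and "c > 0"
    and conv: "\<And>x h. V (x + h) + V (x - h) - 2 * V x \<ge> c * (h \<bullet> h)"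
  shows "laplace V s * laplace V (- s)
    \<le> ennreal (exp ((s \<bullet> s) / c)) * (laplace V 0)\<^sup>2"
proof -
  \<comment> \<open>Only half of \<open>(s \<bullet> s) / c\<close>, because the midpoint function
    is squared.\<close>
  define h where "h y = ennreal (exp ((s \<bullet> s) / (2 * c))) * ennreal (exp (- V y))" for y
  have "laplace V s * laplace V (- s)
      \<le> (\<integral>\<^sup>+y. h y \<partial>lborel)\<^sup>2"
  proof (rule prekopa_leindler)
    fix x y :: 'a
    define m where "m = (1 / 2) *\<^sub>R (x + y)"
    define d where "d = (1 / 2) *\<^sub>R (x - y)"
    have "x = m + d" "y = m - d"
      by (simp_all add: m_def d_def algebra_simps scaleR_add_left[symmetric])
    then have c1: "V x + V y - 2 * V m \<ge> c * (d \<bullet> d)" and xy: "x - y = 2 *\<^sub>R d"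
      using conv[where x = m and h = d] by (simp_all add: scaleR_2)
    have "0 \<le> (s - c *\<^sub>R d) \<bullet> (s - c *\<^sub>R d) / c"
      using \<open>c > 0\<close> by simp
    also have "\<dots> = (s \<bullet> s) / c - 2 * (s \<bullet> d) + c * (d \<bullet> d)"
      using \<open>c > 0\<close> by (simp add: inner_diff_left inner_diff_right inner_commute field_simps)
    finally have "2 * (s \<bullet> d) - c * (d \<bullet> d) \<le> (s \<bullet> s) / c" by simp
    moreover have "s \<bullet> x - s \<bullet> y = 2 * (s \<bullet> d)"
      using xy by (simp add: inner_diff_right[symmetric])
    ultimately have "(s \<bullet> x - V x) + (- s \<bullet> y - V y) \<le> 2 * ((s \<bullet> s) / (2 * c) + (- V m))"
      using c1 by simp
    then have "exp (s \<bullet> x - V x) * exp (- s \<bullet> y - V y) \<le> (exp ((s \<bullet> s) / (2 * c)) * exp (- V m))\<^sup>2"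
      by (simp add: exp_add[symmetric] exp_double[symmetric])
    then show "ennreal (exp (s \<bullet> x - V x)) * ennreal (exp (- s \<bullet> y - V y)) \<le> (h ((1 / 2) *\<^sub>R (x + y)))\<^sup>2"
      unfolding h_def m_def[symmetric] 
      by (simp add: ennreal_mult[symmetric] ennreal_power ennreal_leI)
  qed (auto simp: h_def)
  also have "(\<integral>\<^sup>+y. h y \<partial>lborel)\<^sup>2
      = (ennreal (exp ((s \<bullet> s) / (2 * c))))\<^sup>2 * (laplace V 0)\<^sup>2"
    unfolding h_def by (simp add: nn_integral_cmult power_mult_distrib)
  also have "(ennreal (exp ((s \<bullet> s) / (2 * c))))\<^sup>2 = ennreal (exp ((s \<bullet> s) / c))"
    by (simp add: ennreal_power exp_double[symmetric])
  finally show ?thesis .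
qed

lemma nn_integral_lborel_shift:
  fixes f :: "'a::euclidean_space \<Rightarrow> ennreal"
  assumes [measurable]: "f \<in> borel_measurable borel"
  shows "(\<integral>\<^sup>+y. f (c + y) \<partial>lborel) = (\<integral>\<^sup>+y. f y \<partial>lborel)"
proof -
  have "(\<integral>\<^sup>+y. f y \<partial>lborel) = (\<integral>\<^sup>+y. f y \<partial>distr lborel borel ((+) c))"
    by (simp only: lborel_distr_plus)
  also have "\<dots> = (\<integral>\<^sup>+y. f (c + y) \<partial>lborel)"
    by (rule nn_integral_distr) auto
  finally show ?thesis ..
qed

text \<open>Shifting both factors by \<open>s / c\<close> in opposite directions makes the integrands comparable,
  and Cauchy--Schwarz then replaces a converse of the Prekopa--Leindler inequality.\<close>

lemma exp_half_square: "(exp (x / 2))\<^sup>2 = exp (x::real)"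
  by (simp add: power2_eq_square exp_add[symmetric])

lemma nn_integral_exp_mult_ge:
  fixes V :: "'a::euclidean_space \<Rightarrow> real"
  assumes [measurable]: "V \<in> borel_measurable borel" and "c > 0"
    and smooth: "\<And>x h. V (x + h) + V (x - h) - 2 * V x \<le> c * (h \<bullet> h)"
  shows "ennreal (exp ((s \<bullet> s) / c)) * (laplace V 0)\<^sup>2
    \<le> laplace V s * laplace V (- s)"
proof -
  define h where "h = (1 / c) *\<^sub>R s"
  define F where "F y =  ennreal (exp ((s \<bullet> (h + y) - V (h + y)) / 2))" for y :: 'a
  define G where "G y = ennreal (exp ((- (s \<bullet> (- h + y)) - V (- h + y)) / 2))" for y :: 'a
  have [measurable]: "F \<in> borel_measurable borel" "G \<in> borel_measurable borel"
    unfolding F_def G_def by measurable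
  \<comment> \<open>This \<open>h\<close> maximises
    \<open>s \<bullet> h - c / 2 * (h \<bullet> h)\<close>, with maximum
    \<open>(s \<bullet> s) / (2 * c)\<close>; hence the constant has the same form as in the upper
    bound.\<close>
  have hh: "s \<bullet> h = (s \<bullet> s) / c" "c * (h \<bullet> h) = (s \<bullet> s) / c"
    using \<open>c > 0\<close> by (auto simp: h_def power2_eq_square)
  have FG: "ennreal (exp ((s \<bullet> s) / (2 * c))) * ennreal (exp (- V y)) \<le> F y * G y" for y
  proof -
    have "V (h + y) + V (y - h) \<le> 2 * V y + (s \<bullet> s) / c"
      using smooth[of y h] hh by (simp add: add.commute)
    then have "(s \<bullet> s) / (2 * c) + (- V y)
        \<le> (s \<bullet> (h + y) - V (h + y)) / 2 + (- (s \<bullet> (- h + y)) - V (- h + y)) / 2"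
      using hh by (simp add: inner_add_right inner_diff_right add_divide_distrib diff_divide_distrib)
    then show ?thesis
      unfolding F_def G_def by (simp add: ennreal_mult[symmetric] exp_add[symmetric] ennreal_leI)
  qed
  have "ennreal (exp ((s \<bullet> s) / c)) = (ennreal (exp ((s \<bullet> s) / (2 * c))))\<^sup>2"
    by (simp add: ennreal_power exp_double[symmetric])
  then have "ennreal (exp ((s \<bullet> s) / c)) * (laplace V 0)\<^sup>2
      = (\<integral>\<^sup>+y. ennreal (exp ((s \<bullet> s) / (2 * c))) * ennreal (exp (- V y)) \<partial>lborel)\<^sup>2"
    by (simp add: nn_integral_cmult power_mult_distrib)
  also have "\<dots> \<le> (\<integral>\<^sup>+y. F y * G y \<partial>lborel)\<^sup>2"
    by (intro power_mono nn_integral_mono FG) auto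
  also have "\<dots> \<le> (\<integral>\<^sup>+y. (F y)\<^sup>2 \<partial>lborel) * (\<integral>\<^sup>+y. (G y)\<^sup>2 \<partial>lborel)"
    by (rule Cauchy_Schwarz_nn_integral) auto
  also have "(\<integral>\<^sup>+y. (F y)\<^sup>2 \<partial>lborel) = laplace V s"
    using nn_integral_lborel_shift[of "\<lambda>y. ennreal (exp (s \<bullet> y - V y))" h]
    by (simp add: F_def ennreal_power exp_half_square)
  also have "(\<integral>\<^sup>+y. (G y)\<^sup>2 \<partial>lborel) = laplace V (- s)"
    using nn_integral_lborel_shift[of "\<lambda>y. ennreal (exp (- s \<bullet> y - V y))" "- h"]
    by (simp add: G_def ennreal_power exp_half_square)
  finally show ?thesis .
qed

text \<open>The mean value theorem is applied to \<open>U (x + t *\<^sub>R h) + U (x - t *\<^sub>R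
  h) - k * t\<^sup>2\<close> on the unit interval, then to the gradient between \<open>- t\<close>
  and \<open>t\<close>. Only a sign is read off later, so an arbitrary \<open>k\<close> and an
  unspecified positive factor let one equation serve both curvature bounds.\<close>

lemma C2_second_difference:
  fixes U :: "'a::euclidean_space \<Rightarrow> real"
  assumes "C2_with_Hessian UNIV U H"
  obtains t z where "t > 0"
    "U (x + h) + U (x - h) - 2 * U x - k = t * (h \<bullet> blinfun_apply (H z) h - k)"
proof -
  obtain G where G: "\<And>x. (U has_derivative (\<lambda>h. G x \<bullet> h)) (at x)"
    "\<And>x. (G has_derivative blinfun_apply (H x)) (at x)"
    using assms unfolding C2_with_Hessian_def by auto
  have dG: "((\<lambda>t. G (x + t *\<^sub>R h) \<bullet> h) has_real_derivative (h \<bullet> blinfun_apply (H (x + t *\<^sub>R h)) h)) (at t)" for t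
  proof -
    have "((\<lambda>t. G (x + t *\<^sub>R h)) has_derivative (\<lambda>s. blinfun_apply (H (x + t *\<^sub>R h)) (s *\<^sub>R h))) (at t)"
      by (rule has_derivative_compose[OF _ G(2)]) (auto intro!: derivative_eq_intros)
    then have "((\<lambda>t. G (x + t *\<^sub>R h) \<bullet> h) has_derivative (\<lambda>s. blinfun_apply (H (x + t *\<^sub>R h)) (s *\<^sub>R h) \<bullet> h)) (at t)"
      by (rule has_derivative_inner_left)
    then show ?thesis
      by (simp add: has_field_derivative_def blinfun.scaleR_right inner_commute mult_commute_abs)
  qed
  have dU: "((\<lambda>t. U (x + t *\<^sub>R h) + U (x - t *\<^sub>R h)) has_real_derivative
      (G (x + t *\<^sub>R h) \<bullet> h - G (x - t *\<^sub>R h) \<bullet> h)) (at t)" for t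
  proof -
    have "((\<lambda>t. U (x + t *\<^sub>R h)) has_derivative (\<lambda>s. G (x + t *\<^sub>R h) \<bullet> (s *\<^sub>R h))) (at t)"
      by (rule has_derivative_compose[OF _ G(1)]) (auto intro!: derivative_eq_intros)
    moreover have "((\<lambda>t. U (x - t *\<^sub>R h)) has_derivative (\<lambda>s. G (x - t *\<^sub>R h) \<bullet> (- s *\<^sub>R h))) (at t)"
      by (rule has_derivative_compose[OF _ G(1)]) (auto intro!: derivative_eq_intros)
    ultimately have "((\<lambda>t. U (x + t *\<^sub>R h) + U (x - t *\<^sub>R h)) has_derivative
       (\<lambda>s. G (x + t *\<^sub>R h) \<bullet> (s *\<^sub>R h) + G (x - t *\<^sub>R h) \<bullet> (- s *\<^sub>R h))) (at t)"
      by (rule has_derivative_add)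
    then show ?thesis
      unfolding has_field_derivative_def
      by (rule has_derivative_eq_rhs) (simp add: fun_eq_iff algebra_simps)
  qed
  have d\<phi>: "((\<lambda>t. U (x + t *\<^sub>R h) + U (x - t *\<^sub>R h) - k * t\<^sup>2) has_real_derivative
      (G (x + t *\<^sub>R h) \<bullet> h - G (x - t *\<^sub>R h) \<bullet> h - 2 * k * t)) (at t)" for t
    by (rule derivative_eq_intros dU refl | simp)+
  obtain t where t: "0 < t" "t < 1" "U (x + h) + U (x - h) - 2 * U x - k
      = G (x + t *\<^sub>R h) \<bullet> h - G (x - t *\<^sub>R h) \<bullet> h - 2 * k * t"
    using MVT2[of 0 1 "\<lambda>t. U (x + t *\<^sub>R h) + U (x - t *\<^sub>R h) - k * t\<^sup>2", OF _ d\<phi>] by auto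
  obtain s where s: "G (x + t *\<^sub>R h) \<bullet> h - G (x - t *\<^sub>R h) \<bullet> h
      = 2 * t * (h \<bullet> blinfun_apply (H (x + s *\<^sub>R h)) h)"
    using MVT2[of "- t" t "\<lambda>t. G (x + t *\<^sub>R h) \<bullet> h", OF _ dG] t(1) by auto
  show ?thesis
    by (rule that[of "2 * t" "x + s *\<^sub>R h"]) (use s t in \<open>auto simp: algebra_simps\<close>)
qed

section \<open>Partition functions of the tilted measures\<close>

text \<open>Valued in \<open>ennreal\<close> because its finiteness for general \<open>\<xi>\<close>
  will be deduced from the product bound that it satisfies.\<close>

definition partition_fn :: "'a::euclidean_space measure \<Rightarrow> real \<Rightarrow> 'a \<Rightarrow> ennreal" where
  "partition_fn \<nu> \<tau> \<xi> = (\<integral>\<^sup>+y. ennreal (exp (\<xi> \<bullet> y - \<tau> / 2 * (y \<bullet> y))) \<partial>\<nu>)"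

lemma potential_representation:
  fixes \<nu> :: "'a::euclidean_space measure"
  assumes "has_potential \<nu> U" "C2_with_Hessian UNIV U H" "measure_support \<nu> = UNIV"
  shows "U \<in> borel_measurable borel"
    and "partition_fn \<nu> \<tau> \<xi> = laplace (\<lambda>y. U y + \<tau> / 2 * (y \<bullet> y)) \<xi>"
proof -
  have "continuous_on UNIV U"
    using assms(2) unfolding C2_with_Hessian_def
    by (metis UNIV_I continuous_at_imp_continuous_on has_derivative_continuous)
  then show [measurable]: "U \<in> borel_measurable borel"
    by (rule borel_measurable_continuous_onI)
  have \<nu>: "\<nu> = density lborel (\<lambda>x. ennreal (exp (- U x)))"
    using assms(1) unfolding has_potential_def assms(3) by simp
  show "partition_fn \<nu> \<tau> \<xi> = laplace (\<lambda>y. U y + \<tau> / 2 * (y \<bullet> y)) \<xi>"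
    unfolding partition_fn_def
    by (subst \<nu>, subst nn_integral_density)
       (auto intro!: nn_integral_cong simp: ennreal_mult[symmetric] exp_add[symmetric] algebra_simps)
qed

text \<open>A linear term has no second difference and \<open>\<tau> / 2 * (x \<bullet> x)\<close>
  has the constant one \<open>\<tau> * (h \<bullet> h)\<close>: tilting adds \<open>\<tau>\<close>
  to the curvature whatever \<open>\<xi>\<close> is.\<close>

lemma tilted_second_difference:
  fixes x h \<xi> :: "'a::euclidean_space"
  shows "(U (x + h) + \<tau> / 2 * ((x + h) \<bullet> (x + h)) - \<xi> \<bullet> (x + h))
    + (U (x - h) + \<tau> / 2 * ((x - h) \<bullet> (x - h)) - \<xi> \<bullet> (x - h))
    - 2 * (U x + \<tau> / 2 * (x \<bullet> x) - \<xi> \<bullet> x) = U (x + h) + U (x - h) - 2 * U x + \<tau> * (h \<bullet> h)"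
proof -
  have "(x + h) \<bullet> (x + h) = x \<bullet> x + 2 * (x \<bullet> h) + h \<bullet> h"
    and "(x - h) \<bullet> (x - h) = x \<bullet> x - 2 * (x \<bullet> h) + h \<bullet> h"
    by (simp_all add: inner_add_left inner_add_right inner_diff_left inner_diff_right inner_commute[of h x])
  then show ?thesis
    by (simp add: inner_add_right inner_diff_right algebra_simps)
qed

text \<open>The centre \<open>\<xi>\<close> is absorbed into the potential, so the estimate at the
  origin covers every centre. In logarithmic form this bounds symmetric second differences of the
  cumulant generating function, whose Hessian is the covariance.\<close>

lemma partition_fn_mult_le:
  fixes \<nu> :: "'a::euclidean_space measure"
  assumes "semi_log_concave \<kappa> \<nu>" and supp: "measure_support \<nu> = UNIV" and "\<kappa> > 0" "\<tau> \<ge> 0"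
  shows "partition_fn \<nu> \<tau> (\<xi> + s) * partition_fn \<nu> \<tau> (\<xi> - s)
    \<le> ennreal (exp ((s \<bullet> s) / (\<kappa> + \<tau>))) * (partition_fn \<nu> \<tau> \<xi>)\<^sup>2"
proof -
  obtain U H where U: "has_potential \<nu> U" "C2_with_Hessian UNIV U H"
    and H: "\<And>x h. h \<bullet> blinfun_apply (H x) h \<ge> \<kappa> * (h \<bullet> h)"
    using assms(1) unfolding semi_log_concave_def supp by auto
  note rep = potential_representation[OF U supp]
  note [measurable] = rep(1)
  define V where "V y = U y + \<tau> / 2 * (y \<bullet> y) - \<xi> \<bullet> y" for y
  have "V (x + h) + V (x - h) - 2 * V x \<ge> (\<kappa> + \<tau>) * (h \<bullet> h)" for x h
  proof -
    obtain t z where "t > 0" "U (x + h) + U (x - h) - 2 * U x - \<kappa> * (h \<bullet> h)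
        = t * (h \<bullet> blinfun_apply (H z) h - \<kappa> * (h \<bullet> h))"
      by (rule C2_second_difference[OF U(2)])
    moreover have "h \<bullet> blinfun_apply (H z) h - \<kappa> * (h \<bullet> h) \<ge> 0" using H[of h z] by simp
    ultimately have "U (x + h) + U (x - h) - 2 * U x - \<kappa> * (h \<bullet> h) \<ge> 0" by simp
    then show ?thesis
      unfolding V_def tilted_second_difference by (simp add: distrib_right)
  qed
  then have "laplace V s * laplace V (- s)
    \<le> ennreal (exp ((s \<bullet> s) / (\<kappa> + \<tau>))) * (laplace V 0)\<^sup>2"
    using assms(3,4) by (intro nn_integral_exp_mult_le) (auto simp: V_def)
  then show ?thesis
    by (simp add: rep(2) V_def algebra_simps inner_add_left inner_diff_left)
qed

lemma partition_fn_mult_ge: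
  fixes \<nu> :: "'a::euclidean_space measure"
  assumes "semi_log_convex \<beta> \<nu>" and supp: "measure_support \<nu> = UNIV" and "\<beta> > 0" "\<tau> \<ge> 0"
  shows "ennreal (exp ((s \<bullet> s) / (\<beta> + \<tau>))) * (partition_fn \<nu> \<tau> \<xi>)\<^sup>2
    \<le> partition_fn \<nu> \<tau> (\<xi> + s) * partition_fn \<nu> \<tau> (\<xi> - s)"
proof -
  obtain U H where U: "has_potential \<nu> U" "C2_with_Hessian UNIV U H"
    and H: "\<And>x h. h \<bullet> blinfun_apply (H x) h \<le> \<beta> * (h \<bullet> h)"
    using assms(1) unfolding semi_log_convex_def supp by auto
  note rep = potential_representation[OF U supp]
  note [measurable] = rep(1)
  define V where "V y = U y + \<tau> / 2 * (y \<bullet> y) - \<xi> \<bullet> y" for y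
  have "V (x + h) + V (x - h) - 2 * V x \<le> (\<beta> + \<tau>) * (h \<bullet> h)" for x h
  proof -
    obtain t z where "t > 0" "U (x + h) + U (x - h) - 2 * U x - \<beta> * (h \<bullet> h)
        = t * (h \<bullet> blinfun_apply (H z) h - \<beta> * (h \<bullet> h))"
      by (rule C2_second_difference[OF U(2)])
    moreover have "h \<bullet> blinfun_apply (H z) h - \<beta> * (h \<bullet> h) \<le> 0" using H[of h z] by simp
    ultimately have "U (x + h) + U (x - h) - 2 * U x - \<beta> * (h \<bullet> h) \<le> 0"
      by (simp add: mult_nonneg_nonpos)
    then show ?thesis
      unfolding V_def tilted_second_difference by (simp add: distrib_right)
  qed
  then have "ennreal (exp ((s \<bullet> s) / (\<beta> + \<tau>))) * (laplace V 0)\<^sup>2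
    \<le> laplace V s * laplace V (- s)"
    using assms(3,4) by (intro nn_integral_exp_mult_ge) (auto simp: V_def)
  then show ?thesis
    by (simp add: rep(2) V_def algebra_simps inner_add_left inner_diff_left)
qed

section \<open>Covariance of sub-Gaussian measures\<close>

lemma exp_taylor_bounds:
  fixes x :: real
  shows "\<bar>exp x - 1 - x\<bar> \<le> \<bar>x\<bar>\<^sup>2 * exp \<bar>x\<bar>"
    and "\<bar>exp x - 1 - x - x\<^sup>2 / 2\<bar> \<le> \<bar>x\<bar> ^ 3 * exp \<bar>x\<bar>"
proof -
  have "\<bar>exp x - (\<Sum>m<n. x ^ m / fact m)\<bar> \<le> \<bar>x\<bar> ^ n * exp \<bar>x\<bar>" for n
  proof -
    obtain t where t: "\<bar>t\<bar> \<le> \<bar>x\<bar>" "exp x = (\<Sum>m<n. x ^ m / fact m) + exp t / fact n * x ^ n"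
      using Maclaurin_exp_le[of x n] by auto
    have "exp t / fact n \<le> exp t / 1"
      by (intro divide_left_mono) auto
    also have "exp t \<le> exp \<bar>x\<bar>" using t(1) by auto
    finally have "exp t / fact n * \<bar>x\<bar> ^ n \<le> exp \<bar>x\<bar> * \<bar>x\<bar> ^ n"
      by (intro mult_right_mono) auto
    then show ?thesis
      using t(2) by (simp add: abs_mult power_abs mult.commute)
  qed
  from this[of 2] this[of 3]
  show "\<bar>exp x - 1 - x\<bar> \<le> \<bar>x\<bar>\<^sup>2 * exp \<bar>x\<bar>"
    and "\<bar>exp x - 1 - x - x\<^sup>2 / 2\<bar> \<le> \<bar>x\<bar> ^ 3 * exp \<bar>x\<bar>"
    by (simp_all add: numeral_2_eq_2 numeral_3_eq_3 algebra_simps)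
qed

text \<open>Origin of the constant 4 in the moment bounds: each of at most three factors
  \<open>t\<close> is absorbed by one \<open>exp t\<close>, and one exponential is already
  there.\<close>

lemma power_mult_exp_le:
  fixes t :: real
  assumes "t \<ge> 0" "k \<le> 3"
  shows "t ^ k * exp t \<le> exp (4 * t)"
proof -
  have "t \<le> exp t" using exp_ge_add_one_self[of t] by linarith
  then have "t ^ k \<le> exp t ^ k"
    using assms by (intro power_mono)
  also have "exp t ^ k \<le> exp t ^ 3"
    using assms by (intro power_increasing) auto
  finally have "t ^ k * exp t \<le> exp t ^ 3 * exp t"
    by (intro mult_right_mono) auto
  also have "\<dots> = exp (4 * t)"
    by (simp add: exp_of_nat_mult[symmetric] exp_add[symmetric])
  finally show ?thesis .
qed

abbreviation basis_exp :: "real \<Rightarrow> 'a::euclidean_space \<Rightarrow> real" where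
  "basis_exp r y \<equiv> \<Sum>i\<in>Basis. exp (((r * DIM('a)) *\<^sub>R i) \<bullet> y) + exp (- (((r * DIM('a)) *\<^sub>R i) \<bullet> y))"

text \<open>Some coordinate is at least \<open>norm y / DIM('a)\<close> in absolute value, so the
  exponential of a norm is dominated by finitely many exponentials of linear forms, the only ones
  that a bound on transforms controls.\<close>

lemma exp_norm_le_sum:
  fixes y :: "'a::euclidean_space"
  assumes "r \<ge> 0"
  shows "exp (r * norm y) \<le> basis_exp r y"
proof -
  have "\<exists>i\<in>Basis. norm y \<le> DIM('a) * \<bar>y \<bullet> i\<bar>"
  proof (rule ccontr)
    assume "\<not> ?thesis"
    then have "(\<Sum>i\<in>Basis. \<bar>y \<bullet> i\<bar>) < (\<Sum>i\<in>(Basis::'a set). norm y / DIM('a))"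
      by (intro sum_strict_mono) (auto simp: field_simps)
    then show False using norm_le_l1[of y] by simp
  qed
  then obtain i where i: "i \<in> Basis" "norm y \<le> DIM('a) * \<bar>y \<bullet> i\<bar>" by auto
  define z where "z = ((r * DIM('a)) *\<^sub>R i) \<bullet> y"
  have "r * norm y \<le> r * (DIM('a) * \<bar>y \<bullet> i\<bar>)"
    using i assms by (intro mult_left_mono)
  also have "\<dots> = \<bar>z\<bar>"
    using assms by (simp add: z_def abs_mult inner_commute)
  finally have "exp (r * norm y) \<le> exp \<bar>z\<bar>" by simp
  also have "\<dots> \<le> exp z + exp (- z)"
    by (cases "z \<ge> 0") auto
  also have "\<dots> \<le> basis_exp r y"
    unfolding z_def using i(1) by (intro member_le_sum) (auto simp: add_nonneg_nonneg)
  finally show ?thesis .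
qed

text \<open>A translation of \<open>P\<close> multiplies the two factors by reciprocal numbers, so
  the condition can be stated before the mean is known to exist.\<close>

locale sub_gaussian = prob_space P for P :: "'a::euclidean_space measure" +
  fixes c :: real
  assumes sets_P [measurable_cong, simp]: "sets P = sets borel"
    and nn_mgf_le: "\<And>s. (\<integral>\<^sup>+y. ennreal (exp (s \<bullet> y)) \<partial>P) * (\<integral>\<^sup>+y. ennreal (exp (- (s \<bullet> y))) \<partial>P)
        \<le> ennreal (exp ((s \<bullet> s) / c))"
begin

definition mean :: 'a where "mean = (\<integral>y. y \<partial>P)"

definition covar :: "'a \<Rightarrow> 'a" where
  "covar h = (\<integral>y. (h \<bullet> (y - mean)) *\<^sub>R (y - mean) \<partial>P)"

text \<open>Two exponentials for each basis vector, at the parameter \<open>4 * DIM('a)\<close> from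
  \<open>basis_exp\<close>. It depends on the dimension and \<open>c\<close> only, not on
  \<open>P\<close>; this makes remainders uniform over all tilts.\<close>

definition moment_bound :: real where
  "moment_bound = 2 * DIM('a) * exp ((4 * DIM('a))\<^sup>2 / c)"

lemma space_P [simp]: "space P = UNIV"
  using sets_eq_imp_space_eq[OF sets_P] by simp

text \<open>The opposite factor is the integral of a positive function, hence nonzero, so finiteness
  of the product passes to this factor.\<close>

lemma integrable_exp: "integrable P (\<lambda>y. exp (s \<bullet> y))"
proof -
  have "(\<integral>\<^sup>+y. ennreal (exp (- (s \<bullet> y))) \<partial>P) \<noteq> 0"
    using emeasure_space_1 by (subst nn_integral_0_iff_AE) (auto simp: AE_False)
  moreover have "(\<integral>\<^sup>+y. ennreal (exp (s \<bullet> y)) \<partial>P) * (\<integral>\<^sup>+y. ennreal (exp (- (s \<bullet> y))) \<partial>P) < \<top>"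
    using nn_mgf_le[of s] by (rule order_le_less_trans) simp
  ultimately have "(\<integral>\<^sup>+y. ennreal (exp (s \<bullet> y)) \<partial>P) < \<top>"
    by (auto simp: ennreal_mult_less_top)
  then show ?thesis
    by (intro integrableI_nonneg) auto
qed

lemma integrable_exp_uminus: "integrable P (\<lambda>y. exp (- (s \<bullet> y)))"
  using integrable_exp[of "- s"] by simp

abbreviation mgf2 :: "'a \<Rightarrow> real" where
  "mgf2 s \<equiv> expectation (\<lambda>y. exp (s \<bullet> y)) * expectation (\<lambda>y. exp (- (s \<bullet> y)))"

lemma mgf_eq:
  "(\<integral>\<^sup>+y. ennreal (exp (s \<bullet> y)) \<partial>P) * (\<integral>\<^sup>+y. ennreal (exp (- (s \<bullet> y))) \<partial>P)
    = ennreal (mgf2 s)"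
  using integrable_exp integrable_exp_uminus
  by (simp add: nn_integral_eq_integral ennreal_mult)

lemma integrable_exp_norm:
  assumes "r \<ge> 0"
  shows "integrable P (\<lambda>y. exp (r * norm y))"
proof (rule Bochner_Integration.integrable_bound)
  show "integrable P (\<lambda>y. basis_exp r y)"
    by (intro Bochner_Integration.integrable_sum Bochner_Integration.integrable_add integrable_exp integrable_exp_uminus)
  show "AE y in P. norm (exp (r * norm y))
      \<le> norm (basis_exp r y)"
    using exp_norm_le_sum[OF assms] by (intro AE_I2) (auto intro: order_trans[OF _ abs_ge_self])
qed simp

lemma integrable_id: "integrable P (\<lambda>y. y)"
proof (rule Bochner_Integration.integrable_bound[OF integrable_exp_norm[of 1]])
  show "AE y in P. norm y \<le> norm (exp (1 * norm y))"
    by (intro AE_I2) (auto intro: order_trans[OF _ exp_ge_add_one_self])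
qed auto

text \<open>Centring does not change the product of the two transforms, and by Jensen's inequality
  the centred transform at \<open>- s\<close> is at least 1; dropping it leaves a bound on the other
  factor alone.\<close>

lemma expectation_exp_centered_le: "expectation (\<lambda>y. exp (s \<bullet> (y - mean))) \<le> exp ((s \<bullet> s) / c)"
proof -
  define A where "A = expectation (\<lambda>y. exp (s \<bullet> (y - mean)))"
  define B where "B = expectation (\<lambda>y. exp (- (s \<bullet> (y - mean))))"
  have A: "A = exp (- (s \<bullet> mean)) * expectation (\<lambda>y. exp (s \<bullet> y))"
    unfolding A_def by (simp add: inner_diff_right exp_diff exp_minus divide_inverse mult.commute)
  have B: "B = exp (s \<bullet> mean) * expectation (\<lambda>y. exp (- (s \<bullet> y)))"
    unfolding B_def by (simp add: inner_diff_right exp_diff exp_minus divide_inverse)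
  have iB: "integrable P (\<lambda>y. exp (- (s \<bullet> (y - mean))))"
    using integrable_exp_uminus[of s] by (simp add: inner_diff_right exp_diff exp_minus divide_inverse)
  have "expectation (\<lambda>y. 1 - s \<bullet> (y - mean)) \<le> B"
    unfolding B_def
  proof (rule integral_mono[OF _ iB])
    show "integrable P (\<lambda>y. 1 - s \<bullet> (y - mean))"
      using integrable_id by auto
    show "1 - s \<bullet> (y - mean) \<le> exp (- (s \<bullet> (y - mean)))" for y
      using exp_ge_add_one_self[of "- (s \<bullet> (y - mean))"] by simp
  qed
  moreover have "expectation (\<lambda>y. 1 - s \<bullet> (y - mean)) = 1"
    using integrable_id prob_space by (simp add: inner_diff_right mean_def)
  ultimately have "B \<ge> 1" by simp
  moreover have "A \<ge> 0" unfolding A_def by simp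
  ultimately have "A \<le> A * B" by (simp add: mult_le_cancel_left1)
  also have "\<dots> = expectation (\<lambda>y. exp (s \<bullet> y)) * expectation (\<lambda>y. exp (- (s \<bullet> y)))"
    unfolding A B by (simp add: exp_minus)
  also have "\<dots> \<le> exp ((s \<bullet> s) / c)"
    using nn_mgf_le[of s] unfolding mgf_eq by (simp add: ennreal_le_iff)
  finally show ?thesis unfolding A_def .
qed

lemma integrable_exp_centered: "integrable P (\<lambda>y. exp (s \<bullet> (y - mean)))"
  using integrable_exp[of s] by (simp add: inner_diff_right exp_diff divide_inverse)

lemma exp_norm_centered:
  shows "integrable P (\<lambda>y. exp (4 * norm (y - mean)))"
    and "expectation (\<lambda>y. exp (4 * norm (y - mean))) \<le> moment_bound"
proof -
  define s where "s i = (4 * DIM('a)) *\<^sub>R i" for i :: 'a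
  define S where "S y = (\<Sum>i\<in>Basis. exp (s i \<bullet> (y - mean)) + exp (- (s i) \<bullet> (y - mean)))" for y
  have le: "exp (4 * norm (y - mean)) \<le> S y" for y
    using exp_norm_le_sum[of 4 "y - mean"] by (simp add: S_def s_def)
  have iS: "integrable P S"
    unfolding S_def
    by (intro Bochner_Integration.integrable_sum Bochner_Integration.integrable_add integrable_exp_centered)
  show i: "integrable P (\<lambda>y. exp (4 * norm (y - mean)))"
    by (rule Bochner_Integration.integrable_bound[OF iS])
       (use le in \<open>auto intro!: AE_I2 intro: order_trans[OF _ abs_ge_self]\<close>)
  have "expectation (\<lambda>y. exp (4 * norm (y - mean))) \<le> expectation S"
    by (intro integral_mono i iS le)
  also have "expectation S = (\<Sum>i\<in>Basis. expectation (\<lambda>y. exp (s i \<bullet> (y - mean)))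
      + expectation (\<lambda>y. exp (- (s i) \<bullet> (y - mean))))"
    unfolding S_def using integrable_exp_centered
    by (subst Bochner_Integration.integral_sum, (intro Bochner_Integration.integrable_add; blast))
       (intro sum.cong refl Bochner_Integration.integral_add; blast)
  also have "\<dots> \<le> (\<Sum>i\<in>(Basis::'a set). exp ((4 * DIM('a))\<^sup>2 / c) + exp ((4 * DIM('a))\<^sup>2 / c))"
  proof (intro sum_mono add_mono)
    fix i :: 'a assume "i \<in> Basis"
    then have "s i \<bullet> s i = (4 * DIM('a))\<^sup>2" "(- s i) \<bullet> (- s i) = (4 * DIM('a))\<^sup>2"
      by (auto simp: s_def power2_eq_square)
    then show "expectation (\<lambda>y. exp (s i \<bullet> (y - mean))) \<le> exp ((4 * DIM('a))\<^sup>2 / c)"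
      "expectation (\<lambda>y. exp (- (s i) \<bullet> (y - mean))) \<le> exp ((4 * DIM('a))\<^sup>2 / c)"
      using expectation_exp_centered_le[of "s i"] expectation_exp_centered_le[of "- s i"] by simp_all
  qed
  also have "\<dots> = moment_bound" by (simp add: moment_bound_def)
  finally show "expectation (\<lambda>y. exp (4 * norm (y - mean))) \<le> moment_bound" .
qed

lemma moment_bound_ge_0: "moment_bound \<ge> 0"
  by (simp add: moment_bound_def)

lemma integral_bound:
  fixes f :: "'a \<Rightarrow> 'b::{banach, second_countable_topology}"
  assumes [measurable]: "f \<in> borel_measurable borel"
    and le: "\<And>y. norm (f y) \<le> B * exp (4 * norm (y - mean))" and "B \<ge> 0"
  shows "integrable P f" and "norm (integral\<^sup>L P f) \<le> B * moment_bound"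
proof -
  have iB: "integrable P (\<lambda>y. B * exp (4 * norm (y - mean)))"
    using exp_norm_centered(1) by simp
  show i: "integrable P f"
    by (rule Bochner_Integration.integrable_bound[OF iB])
       (use le in \<open>auto intro!: AE_I2 intro: order_trans[OF _ abs_ge_self]\<close>)
  have "norm (integral\<^sup>L P f) \<le> expectation (\<lambda>y. norm (f y))"
    by (rule integral_norm_bound)
  also have "\<dots> \<le> expectation (\<lambda>y. B * exp (4 * norm (y - mean)))"
    by (intro integral_mono iB le integrable_norm i)
  also have "\<dots> = B * expectation (\<lambda>y. exp (4 * norm (y - mean)))"
    by simp
  also have "\<dots> \<le> B * moment_bound"
    using exp_norm_centered(2) \<open>B \<ge> 0\<close> by (intro mult_left_mono)
  finally show "norm (integral\<^sup>L P f) \<le> B * moment_bound" .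
qed

lemma remainder_bounds:
  fixes h u :: 'a
  assumes "norm h \<le> 1"
  shows "\<bar>exp (h \<bullet> u) - 1 - h \<bullet> u\<bar> \<le> (norm h)\<^sup>2 * (norm u)\<^sup>2 * exp (norm u)"
    and "\<bar>exp (h \<bullet> u) - 1 - h \<bullet> u - (h \<bullet> u)\<^sup>2 / 2\<bar> \<le> norm h ^ 3 * norm u ^ 3 * exp (norm u)"
proof -
  define x where "x = \<bar>h \<bullet> u\<bar>"
  have x: "0 \<le> x" "x \<le> norm h * norm u" 
    by (auto simp: x_def Cauchy_Schwarz_ineq2)
  have "norm h * norm u \<le> 1 * norm u" using assms by (intro mult_right_mono) auto
  then have e: "exp x \<le> exp (norm u)" using x by auto
  have p: "x ^ k * exp x \<le> (norm h * norm u) ^ k * exp (norm u)" for k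
    using x e by (intro mult_mono power_mono) auto
  from order_trans[OF exp_taylor_bounds(1)[of "h \<bullet> u", folded x_def] p[of 2]]
    order_trans[OF exp_taylor_bounds(2)[of "h \<bullet> u", folded x_def] p[of 3]]
  show "\<bar>exp (h \<bullet> u) - 1 - h \<bullet> u\<bar> \<le> (norm h)\<^sup>2 * (norm u)\<^sup>2 * exp (norm u)"
    "\<bar>exp (h \<bullet> u) - 1 - h \<bullet> u - (h \<bullet> u)\<^sup>2 / 2\<bar> \<le> norm h ^ 3 * norm u ^ 3 * exp (norm u)"
    by (simp_all add: power_mult_distrib)
qed

lemma norm_power_le:
  assumes "k \<le> 3"
  shows "norm u ^ k * exp (norm u) \<le> exp (4 * norm u)" and "norm u ^ k \<le> exp (4 * norm u)"
proof -
  show *: "norm u ^ k * exp (norm u) \<le> exp (4 * norm u)"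
    using power_mult_exp_le[OF _ assms, of "norm u"] by simp
  have "norm u ^ k * 1 \<le> norm u ^ k * exp (norm u)"
    by (intro mult_left_mono) auto
  with * show "norm u ^ k \<le> exp (4 * norm u)" by simp
qed

lemma covar_integrand: 
  shows "integrable P (\<lambda>y. (h \<bullet> (y - mean)) *\<^sub>R (y - mean))"
    and "norm (covar h) \<le> norm h * moment_bound"
proof -
  have le: "norm ((h \<bullet> (y - mean)) *\<^sub>R (y - mean)) \<le> norm h * exp (4 * norm (y - mean))" for y
  proof -
    have "norm ((h \<bullet> (y - mean)) *\<^sub>R (y - mean)) \<le> (norm h * norm (y - mean)) * norm (y - mean)"
      by (simp add: mult_right_mono Cauchy_Schwarz_ineq2)
    also have "\<dots> = norm h * norm (y - mean) ^ 2"
      by (simp add: power2_eq_square)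
    also have "\<dots> \<le> norm h * exp (4 * norm (y - mean))"
      by (intro mult_left_mono norm_power_le) auto
    finally show ?thesis .
  qed
  show "integrable P (\<lambda>y. (h \<bullet> (y - mean)) *\<^sub>R (y - mean))"
    and "norm (covar h) \<le> norm h * moment_bound"
    unfolding covar_def by (rule integral_bound[OF _ le]; simp)+
qed

lemma inner_covar: "k \<bullet> covar h = expectation (\<lambda>y. (h \<bullet> (y - mean)) * (k \<bullet> (y - mean)))"
  unfolding covar_def using covar_integrand(1)[of h] by (simp flip: integral_inner_right)

lemma covar_sym: "k \<bullet> covar h = h \<bullet> covar k"
  unfolding inner_covar by (simp add: mult.commute)

lemma linear_covar: "linear covar"
proof (rule linearI)
  show "covar (x + y) = covar x + covar y" for x y
    unfolding covar_def
    by (subst Bochner_Integration.integral_add[symmetric])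
       (auto intro: covar_integrand simp: inner_add_left scaleR_add_left)
  show "covar (r *\<^sub>R x) = r *\<^sub>R covar x" for r x
    unfolding covar_def by (simp flip: integral_scaleR_right)
qed

lemma expectation_centered: "(\<integral>y. y - mean \<partial>P) = 0"
  using integrable_id prob_space by (simp add: mean_def)

text \<open>The quotient is the mean of \<open>P\<close> reweighted by
  \<open>exp (h \<bullet> y)\<close>, so the covariance is the derivative of the mean under tilting.
  After centring it equals \<open>mean + (1 / D) *\<^sub>R N\<close>, where \<open>D - 1\<close> and
  \<open>N - covar h\<close> are both of second order in \<open>h\<close>; the product of
  \<open>D - 1\<close> with \<open>covar h\<close> causes the square of
  \<open>moment_bound\<close>.\<close>

lemma mean_shift_expansion:
  assumes h: "norm h \<le> 1"
  shows "norm ((1 / expectation (\<lambda>y. exp (h \<bullet> y))) *\<^sub>R (\<integral>y. exp (h \<bullet> y) *\<^sub>R y \<partial>P) - mean - covar h)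
    \<le> (moment_bound + moment_bound\<^sup>2) * (norm h)\<^sup>2"
proof -
  define e where "e y = exp (h \<bullet> (y - mean))" for y
  define D where "D = expectation e"
  define N where "N = (\<integral>y. e y *\<^sub>R (y - mean) \<partial>P)"
  have ie: "integrable P e"
    unfolding e_def by (rule integrable_exp_centered)
  have iu: "integrable P (\<lambda>y. y - mean)" using integrable_id by simp
  have iN': "integrable P (\<lambda>y. (e y - 1 - h \<bullet> (y - mean)) *\<^sub>R (y - mean))"
    and N': "norm (\<integral>y. (e y - 1 - h \<bullet> (y - mean)) *\<^sub>R (y - mean) \<partial>P) \<le> (norm h)\<^sup>2 * moment_bound"
  proof -
    have le: "norm ((e y - 1 - h \<bullet> (y - mean)) *\<^sub>R (y - mean)) \<le> (norm h)\<^sup>2 * exp (4 * norm (y - mean))" for y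
    proof -
      define u where "u = y - mean"
      have "norm ((e y - 1 - h \<bullet> u) *\<^sub>R u) \<le> ((norm h)\<^sup>2 * (norm u)\<^sup>2 * exp (norm u)) * norm u"
        using remainder_bounds(1)[OF h, of u] by (simp add: e_def u_def mult_right_mono)
      also have "\<dots> = (norm h)\<^sup>2 * (norm u ^ 3 * exp (norm u))"
        by (simp add: power2_eq_square power3_eq_cube)
      also have "\<dots> \<le> (norm h)\<^sup>2 * exp (4 * norm u)"
        by (intro mult_left_mono norm_power_le) auto
      finally show ?thesis unfolding u_def .
    qed
    show "integrable P (\<lambda>y. (e y - 1 - h \<bullet> (y - mean)) *\<^sub>R (y - mean))"
      and "norm (\<integral>y. (e y - 1 - h \<bullet> (y - mean)) *\<^sub>R (y - mean) \<partial>P) \<le> (norm h)\<^sup>2 * moment_bound"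
      by (rule integral_bound[OF _ le]; simp add: e_def)+
  qed
  have "integrable P (\<lambda>y. (e y - 1 - h \<bullet> (y - mean)) *\<^sub>R (y - mean) + (y - mean) + (h \<bullet> (y - mean)) *\<^sub>R (y - mean))"
    by (intro Bochner_Integration.integrable_add iN' iu covar_integrand)
  then have iN: "integrable P (\<lambda>y. e y *\<^sub>R (y - mean))"
    by (simp add: algebra_simps)
  have "N - covar h = (\<integral>y. e y *\<^sub>R (y - mean) - (h \<bullet> (y - mean)) *\<^sub>R (y - mean) \<partial>P)"
    unfolding N_def covar_def
    by (rule Bochner_Integration.integral_diff[symmetric, OF iN covar_integrand(1)])
  \<comment> \<open>Subtracting the centred variable, whose integral is zero, completes the
    first-order Taylor remainder of \<open>e\<close>.\<close>
  also have "\<dots> = (\<integral>y. (e y *\<^sub>R (y - mean) - (h \<bullet> (y - mean)) *\<^sub>R (y - mean)) - (y - mean) \<partial>P)"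
    using iN covar_integrand(1) iu expectation_centered by (subst (2) Bochner_Integration.integral_diff) auto
  also have "\<dots> = (\<integral>y. (e y - 1 - h \<bullet> (y - mean)) *\<^sub>R (y - mean) \<partial>P)"
    by (intro Bochner_Integration.integral_cong refl) (simp add: scaleR_diff_left)
  finally have Nc: "norm (N - covar h) \<le> (norm h)\<^sup>2 * moment_bound"
    using N' by simp
  \<comment> \<open>The lower bound, from \<open>1 + u \<le> exp u\<close> and centring, later
    allows the factor \<open>1 / D\<close> to be dropped.\<close>
  have D: "D \<ge> 1" "D - 1 \<le> (norm h)\<^sup>2 * moment_bound"
  proof -
    have "\<bar>e y - 1 - h \<bullet> (y - mean)\<bar> \<le> (norm h)\<^sup>2 * exp (4 * norm (y - mean))" for y
    proof -
      define u where "u = y - mean"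
      have "\<bar>e y - 1 - h \<bullet> u\<bar> \<le> (norm h)\<^sup>2 * ((norm u)\<^sup>2 * exp (norm u))"
        using remainder_bounds(1)[OF h, of u] by (simp add: e_def u_def mult.assoc)
      also have "\<dots> \<le> (norm h)\<^sup>2 * exp (4 * norm u)"
        by (intro mult_left_mono norm_power_le) auto
      finally show ?thesis unfolding u_def .
    qed
    then have le: "norm (e y - 1 - h \<bullet> (y - mean)) \<le> (norm h)\<^sup>2 * exp (4 * norm (y - mean))" for y
      by simp
    have "norm (expectation (\<lambda>y. e y - 1 - h \<bullet> (y - mean))) \<le> (norm h)\<^sup>2 * moment_bound"
      by (rule integral_bound(2)[OF _ le]) (simp_all add: e_def)
    moreover have "expectation (\<lambda>y. e y - 1 - h \<bullet> (y - mean)) \<ge> 0"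
    proof (rule Bochner_Integration.integral_nonneg)
      show "0 \<le> e y - 1 - h \<bullet> (y - mean)" for y
        using exp_ge_add_one_self[of "h \<bullet> (y - mean)"] unfolding e_def by linarith
    qed
    moreover have "expectation (\<lambda>y. e y - 1 - h \<bullet> (y - mean)) = D - 1 - h \<bullet> (\<integral>y. y - mean \<partial>P)"
    proof -
      have "expectation (\<lambda>y. h \<bullet> (y - mean)) = h \<bullet> (\<integral>y. y - mean \<partial>P)"
        using iu by (intro integral_inner_right) auto
      moreover have "integrable P (\<lambda>y. h \<bullet> (y - mean))" using iu by auto
      ultimately show ?thesis
        using ie prob_space
        by (subst Bochner_Integration.integral_diff; (subst Bochner_Integration.integral_diff)?) (auto simp: D_def)
    qed
    ultimately show "D \<ge> 1" "D - 1 \<le> (norm h)\<^sup>2 * moment_bound"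
      using expectation_centered by auto
  qed
  have e: "exp (h \<bullet> y) = exp (h \<bullet> mean) * e y" for y
    by (simp add: e_def exp_add[symmetric] inner_diff_right)
  have "(\<integral>y. exp (h \<bullet> y) *\<^sub>R y \<partial>P)
      = (\<integral>y. exp (h \<bullet> mean) *\<^sub>R (e y *\<^sub>R (y - mean) + e y *\<^sub>R mean) \<partial>P)"
    by (intro Bochner_Integration.integral_cong refl, subst e)
       (simp add: scaleR_add_right[symmetric])
  also have "\<dots> = exp (h \<bullet> mean) *\<^sub>R (\<integral>y. (e y *\<^sub>R (y - mean) + e y *\<^sub>R mean) \<partial>P)"
    by simp
  also have "(\<integral>y. (e y *\<^sub>R (y - mean) + e y *\<^sub>R mean) \<partial>P) = N + D *\<^sub>R mean"
    using iN ie unfolding N_def D_def by (subst Bochner_Integration.integral_add) auto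
  finally have eN: "(\<integral>y. exp (h \<bullet> y) *\<^sub>R y \<partial>P) = exp (h \<bullet> mean) *\<^sub>R (N + D *\<^sub>R mean)" .
  have eD: "expectation (\<lambda>y. exp (h \<bullet> y)) = exp (h \<bullet> mean) * D"
    unfolding D_def by (subst e) simp
  have "(1 / expectation (\<lambda>y. exp (h \<bullet> y))) *\<^sub>R (\<integral>y. exp (h \<bullet> y) *\<^sub>R y \<partial>P)
      = (1 / D) *\<^sub>R (N + D *\<^sub>R mean)"
    unfolding eN eD by simp
  also have "\<dots> = mean + (1 / D) *\<^sub>R N"
    using D(1) by (simp add: scaleR_add_right)
  finally have "(1 / expectation (\<lambda>y. exp (h \<bullet> y))) *\<^sub>R (\<integral>y. exp (h \<bullet> y) *\<^sub>R y \<partial>P) - mean - covar h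
      = (1 / D) *\<^sub>R ((N - covar h) - (D - 1) *\<^sub>R covar h)"
    using D(1) by (simp add: algebra_simps)
  then have "norm ((1 / expectation (\<lambda>y. exp (h \<bullet> y))) *\<^sub>R (\<integral>y. exp (h \<bullet> y) *\<^sub>R y \<partial>P) - mean - covar h)
      = (1 / D) * norm ((N - covar h) - (D - 1) *\<^sub>R covar h)"
    using D(1) by simp
  also have "\<dots> \<le> 1 * norm ((N - covar h) - (D - 1) *\<^sub>R covar h)"
    using D(1) by (intro mult_right_mono) auto
  also have "\<dots> \<le> norm (N - covar h) + (D - 1) * norm (covar h)"
    using D(1) norm_triangle_ineq4[of "N - covar h" "(D - 1) *\<^sub>R covar h"] by simp
  also have "\<dots> \<le> (norm h)\<^sup>2 * moment_bound + ((norm h)\<^sup>2 * moment_bound) * (1 * moment_bound)"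
    using D Nc covar_integrand(2)[of h] h moment_bound_ge_0
    by (intro add_mono mult_mono order_trans[OF covar_integrand(2)] mult_right_mono) auto
  finally show ?thesis by (simp add: power2_eq_square algebra_simps)
qed

text \<open>Third order is needed because the remainder must still vanish after division by the
  square of the scale. The linear term integrates to zero by centring.\<close>

lemma mgf_expansion:
  assumes h: "norm h \<le> 1"
  shows "\<bar>expectation (\<lambda>y. exp (h \<bullet> (y - mean))) - 1 - (h \<bullet> covar h) / 2\<bar> \<le> norm h ^ 3 * moment_bound"
proof -
  define R where "R y = exp (h \<bullet> (y - mean)) - 1 - h \<bullet> (y - mean) - (h \<bullet> (y - mean))\<^sup>2 / 2" for y
  have "\<bar>R y\<bar> \<le> norm h ^ 3 * exp (4 * norm (y - mean))" for y
  proof -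
    define u where "u = y - mean"
    have "\<bar>R y\<bar> \<le> norm h ^ 3 * (norm u ^ 3 * exp (norm u))"
      using remainder_bounds(2)[OF h, of u] by (simp add: R_def u_def mult.assoc)
    also have "\<dots> \<le> norm h ^ 3 * exp (4 * norm u)"
      by (intro mult_left_mono norm_power_le) auto
    finally show ?thesis unfolding u_def .
  qed
  then have le: "norm (R y) \<le> norm h ^ 3 * exp (4 * norm (y - mean))" for y
    by simp
  have "norm (expectation R) \<le> norm h ^ 3 * moment_bound"
    by (rule integral_bound(2)[OF _ le]) (simp_all add: R_def[abs_def])
  moreover have "expectation R = expectation (\<lambda>y. exp (h \<bullet> (y - mean))) - 1 - (h \<bullet> covar h) / 2"
  proof -
    have iu: "integrable P (\<lambda>y. h \<bullet> (y - mean))" using integrable_id by auto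
    have i2: "integrable P (\<lambda>y. (h \<bullet> (y - mean))\<^sup>2 / 2)"
      using integrable_inner_right[OF covar_integrand(1)[of h], of h]
      by (simp add: power2_eq_square)
    have "expectation R = expectation (\<lambda>y. exp (h \<bullet> (y - mean))) - 1 - expectation (\<lambda>y. h \<bullet> (y - mean))
        - expectation (\<lambda>y. (h \<bullet> (y - mean))\<^sup>2 / 2)"
      unfolding R_def using integrable_exp_centered[of h] iu i2 prob_space
      by (simp add: Bochner_Integration.integral_diff)
    also have "expectation (\<lambda>y. h \<bullet> (y - mean)) = h \<bullet> (\<integral>y. y - mean \<partial>P)"
      using integrable_id by (intro integral_inner_right) auto
    also have "expectation (\<lambda>y. (h \<bullet> (y - mean))\<^sup>2 / 2) = (h \<bullet> covar h) / 2"
      unfolding inner_covar by (simp add: power2_eq_square)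
    finally show ?thesis using expectation_centered by simp
  qed
  ultimately show ?thesis by simp
qed

text \<open>The centring factors cancel in the product, and each centred transform contributes half
  of \<open>s \<bullet> covar s\<close> at second order.\<close>

lemma mgf_product_limit:
  "((\<lambda>r. (mgf2 (r *\<^sub>R s) - 1) / r\<^sup>2)
    \<longlongrightarrow> s \<bullet> covar s) (at_right 0)"
proof -
  define A where "A r = expectation (\<lambda>y. exp ((r *\<^sub>R s) \<bullet> (y - mean)))" for r
  define q where "q = s \<bullet> covar s"
  define K where "K = norm s ^ 3 * moment_bound"
  have K: "K \<ge> 0" using moment_bound_ge_0 by (simp add: K_def)
  have scale: "(r *\<^sub>R s) \<bullet> covar (r *\<^sub>R s) = r\<^sup>2 * q" for r
    using linear_scale[OF linear_covar] by (simp add: q_def power2_eq_square)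
  have ex: "\<bar>A r - 1 - r\<^sup>2 * q / 2\<bar> \<le> \<bar>r\<bar> ^ 3 * K" if "norm (r *\<^sub>R s) \<le> 1" for r
    using mgf_expansion[OF that] scale unfolding A_def K_def by (simp add: power_mult_distrib mult_ac)
  have small: "eventually (\<lambda>r::real. 0 < r \<and> norm (r *\<^sub>R s) \<le> 1) (at_right 0)"
  proof -
    have "0 < 1 / (norm s + 1)" by (simp add: add_nonneg_pos)
    then have "eventually (\<lambda>r::real. r \<in> {0<..<1 / (norm s + 1)}) (at_right 0)"
      by (rule eventually_at_right_real)
    then show ?thesis
    proof eventually_elim
      case (elim r)
      then have "r * norm s \<le> r * (norm s + 1)" by simp
      moreover have "r * (norm s + 1) < 1 / (norm s + 1) * (norm s + 1)"
        using elim by (intro mult_strict_right_mono) (auto simp: add_nonneg_pos)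
      moreover have "1 / (norm s + 1) * (norm s + 1) = 1"
        using norm_ge_zero[of s] by (simp add: add_nonneg_eq_0_iff)
      ultimately have "r * norm s \<le> 1" by linarith
      then show ?case using elim by simp
    qed
  qed
  have lim: "((\<lambda>r. (A (\<sigma> * r) - 1) / r\<^sup>2) \<longlongrightarrow> q / 2) (at_right 0)" if "\<bar>\<sigma>\<bar> = 1" for \<sigma> :: real
  proof (rule Lim_null[THEN iffD2], rule Lim_null_comparison)
    have \<sigma>2: "\<sigma>\<^sup>2 = 1" using that by (metis one_power2 power2_abs)
    show "eventually (\<lambda>r. norm ((A (\<sigma> * r) - 1) / r\<^sup>2 - q / 2) \<le> r * K) (at_right 0)"
      using small
    proof eventually_elim
      case (elim r)
      have "norm ((\<sigma> * r) *\<^sub>R s) \<le> 1"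
        using that elim by (simp only: norm_scaleR abs_mult mult_1)
      then have "\<bar>A (\<sigma> * r) - 1 - r\<^sup>2 * q / 2\<bar> \<le> r ^ 3 * K"
        using ex[of "\<sigma> * r"] that elim \<sigma>2 by (simp add: abs_mult power_mult_distrib)
      then have "\<bar>A (\<sigma> * r) - 1 - r\<^sup>2 * q / 2\<bar> / r\<^sup>2 \<le> r ^ 3 * K / r\<^sup>2"
        by (intro divide_right_mono) auto
      also have "r ^ 3 * K / r\<^sup>2 = r * K"
        using elim by (simp add: power2_eq_square power3_eq_cube)
      also have "\<bar>A (\<sigma> * r) - 1 - r\<^sup>2 * q / 2\<bar> / r\<^sup>2 = \<bar>(A (\<sigma> * r) - 1 - r\<^sup>2 * q / 2) / r\<^sup>2\<bar>"
        by (simp add: abs_divide)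
      also have "(A (\<sigma> * r) - 1 - r\<^sup>2 * q / 2) / r\<^sup>2 = (A (\<sigma> * r) - 1) / r\<^sup>2 - q / 2"
        using elim by (simp add: diff_divide_distrib)
      finally show ?case by simp
    qed
    show "((\<lambda>r. r * K) \<longlongrightarrow> 0) (at_right 0)"
      by (auto intro!: tendsto_eq_intros)
  qed
  have l1: "((\<lambda>r. (A r - 1) / r\<^sup>2) \<longlongrightarrow> q / 2) (at_right 0)"
    and l2: "((\<lambda>r. (A (- r) - 1) / r\<^sup>2) \<longlongrightarrow> q / 2) (at_right 0)"
    using lim[of 1] lim[of "- 1"] by simp_all
  \<comment> \<open>If \<open>A r = 1 + r\<^sup>2 * u\<close> and
    \<open>A (- r) = 1 + r\<^sup>2 * w\<close>, then \<open>(A r * A (- r) - 1) / r\<^sup>2\<close>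
    equals \<open>u + w + u * w * r\<^sup>2\<close>.\<close>
  have "((\<lambda>r. (A r - 1) / r\<^sup>2 + (A (- r) - 1) / r\<^sup>2
      + (A r - 1) / r\<^sup>2 * ((A (- r) - 1) / r\<^sup>2) * r\<^sup>2) \<longlongrightarrow> q / 2 + q / 2 + q / 2 * (q / 2) * 0\<^sup>2) (at_right 0)"
    by (intro tendsto_intros l1 l2)
  then have "((\<lambda>r. (A r - 1) / r\<^sup>2 + (A (- r) - 1) / r\<^sup>2
      + (A r - 1) / r\<^sup>2 * ((A (- r) - 1) / r\<^sup>2) * r\<^sup>2) \<longlongrightarrow> q) (at_right 0)"
    by simp
  moreover have "eventually (\<lambda>r. (A r - 1) / r\<^sup>2 + (A (- r) - 1) / r\<^sup>2
      + (A r - 1) / r\<^sup>2 * ((A (- r) - 1) / r\<^sup>2) * r\<^sup>2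
      = (mgf2 (r *\<^sub>R s) - 1) / r\<^sup>2) (at_right 0)"
    using eventually_at_right_less[of 0]
  proof eventually_elim
    case (elim r)
    have "A r = exp (- ((r *\<^sub>R s) \<bullet> mean)) * expectation (\<lambda>y. exp (r *\<^sub>R s \<bullet> y))"
      "A (- r) = exp ((r *\<^sub>R s) \<bullet> mean) * expectation (\<lambda>y. exp (- (r *\<^sub>R s \<bullet> y)))"
      unfolding A_def
      by (simp_all add: inner_diff_right right_diff_distrib exp_diff exp_minus divide_inverse mult.commute)
    then have "mgf2 (r *\<^sub>R s) = A r * A (- r)"
      by (simp add: exp_minus)
    moreover have "(A r - 1) / r\<^sup>2 + (A (- r) - 1) / r\<^sup>2
      + (A r - 1) / r\<^sup>2 * ((A (- r) - 1) / r\<^sup>2) * r\<^sup>2 = (A r * A (- r) - 1) / r\<^sup>2"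
      using elim by (simp add: field_simps)
    ultimately show ?case by simp
  qed
  ultimately show ?thesis
    unfolding q_def by (rule Lim_transform_eventually)
qed

lemma exp_quadratic_limit:
  fixes r :: real
  shows "((\<lambda>t. (exp (t\<^sup>2 * r) - 1) / t\<^sup>2) \<longlongrightarrow> r) (at_right 0)"
proof -
  have "((\<lambda>x. exp (x * r)) has_real_derivative r) (at 0)"
    by (auto intro!: derivative_eq_intros)
  then have "((\<lambda>x. (exp (x * r) - 1) / x) \<longlongrightarrow> r) (at 0)"
    by (simp add: has_field_derivative_iff)
  moreover have "filterlim (\<lambda>t::real. t\<^sup>2) (at 0) (at_right 0)"
    by (auto simp: filterlim_at eventually_at_filter intro!: tendsto_eq_intros)
  ultimately show ?thesis
    by (rule filterlim_compose[unfolded comp_def])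
qed

lemma covar_le: "s \<bullet> covar s \<le> (s \<bullet> s) / c"
proof (rule tendsto_le[OF _ exp_quadratic_limit mgf_product_limit])
  show "eventually (\<lambda>r. (mgf2 (r *\<^sub>R s) - 1) / r\<^sup>2
      \<le> (exp (r\<^sup>2 * (s \<bullet> s / c)) - 1) / r\<^sup>2) (at_right 0)"
  proof (intro always_eventually allI divide_right_mono diff_right_mono)
    fix r :: real
    show "mgf2 (r *\<^sub>R s)
      \<le> exp (r\<^sup>2 * (s \<bullet> s / c))"
      using nn_mgf_le[of "r *\<^sub>R s"] unfolding mgf_eq
      by (simp add: ennreal_le_iff power2_eq_square mult.assoc)
  qed simp
qed simp

lemma covar_ge:
  assumes "\<And>s. ennreal (exp ((s \<bullet> s) / b))
    \<le> (\<integral>\<^sup>+y. ennreal (exp (s \<bullet> y)) \<partial>P) * (\<integral>\<^sup>+y. ennreal (exp (- (s \<bullet> y))) \<partial>P)"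
  shows "(s \<bullet> s) / b \<le> s \<bullet> covar s"
proof (rule tendsto_le[OF _ mgf_product_limit exp_quadratic_limit])
  show "eventually (\<lambda>r. (exp (r\<^sup>2 * (s \<bullet> s / b)) - 1) / r\<^sup>2
      \<le> (mgf2 (r *\<^sub>R s) - 1) / r\<^sup>2) (at_right 0)"
  proof (intro always_eventually allI divide_right_mono diff_right_mono)
    fix r :: real
    show "exp (r\<^sup>2 * (s \<bullet> s / b))
      \<le> mgf2 (r *\<^sub>R s)"
      using assms[of "r *\<^sub>R s"] unfolding mgf_eq
      by (simp add: ennreal_le_iff power2_eq_square mult.assoc)
  qed simp
qed simp

end

section \<open>Tilted measures\<close>

abbreviation tilt :: "real \<Rightarrow> 'a::euclidean_space \<Rightarrow> 'a \<Rightarrow> real" where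
  "tilt \<tau> x y \<equiv> exp (x \<bullet> y - \<tau> / 2 * (y \<bullet> y))"

definition tilted :: "'a::euclidean_space measure \<Rightarrow> real \<Rightarrow> 'a \<Rightarrow> 'a measure" where
  "tilted \<nu> \<tau> x = density \<nu>
     (\<lambda>y. ennreal (tilt \<tau> x y / enn2real (partition_fn \<nu> \<tau> x)))"

definition tilted_mean :: "'a::euclidean_space measure \<Rightarrow> real \<Rightarrow> 'a \<Rightarrow> 'a" where
  "tilted_mean \<nu> \<tau> x = (\<integral>y. y \<partial>tilted \<nu> \<tau> x)"

definition tilted_cov :: "'a::euclidean_space measure \<Rightarrow> real \<Rightarrow> 'a \<Rightarrow> 'a \<Rightarrow> 'a" where
  "tilted_cov \<nu> \<tau> x h
    = (\<integral>y. (h \<bullet> (y - tilted_mean \<nu> \<tau> x)) *\<^sub>R (y - tilted_mean \<nu> \<tau> x) \<partial>tilted \<nu> \<tau> x)"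

locale strongly_log_concave =
  fixes \<nu> :: "'a::euclidean_space measure" and \<kappa> :: real
  assumes concave: "semi_log_concave \<kappa> \<nu>" and supp: "measure_support \<nu> = UNIV" and \<kappa>: "\<kappa> > 0"
begin

lemma prob_nu: "prob_space \<nu>"
  using concave by (simp add: semi_log_concave_def)

lemma sets_nu [measurable_cong, simp]: "sets \<nu> = sets borel"
proof -
  obtain U where "has_potential \<nu> U"
    using concave unfolding semi_log_concave_def by blast
  then show ?thesis unfolding has_potential_def by (metis sets_density sets_lborel)
qed

lemma space_nu [simp]: "space \<nu> = UNIV"
  using sets_eq_imp_space_eq[OF sets_nu] by simp

definition Z :: "real \<Rightarrow> 'a \<Rightarrow> real" where "Z \<tau> x = enn2real (partition_fn \<nu> \<tau> x)"

text \<open>At \<open>0\<close> the integrand is at most 1 and \<nu> is a probability measure. The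
  product bound centred at \<open>0\<close> then makes the product of the values at \<open>x\<close>
  and \<open>- x\<close> finite, and neither of them is zero.\<close>

lemma partition_fn_eq_Z:
  assumes "\<tau> \<ge> 0"
  shows "partition_fn \<nu> \<tau> x = ennreal (Z \<tau> x)" and "Z \<tau> x > 0"
proof -
  interpret prob_space \<nu> by (rule prob_nu)
  have nz: "partition_fn \<nu> \<tau> x \<noteq> 0" for x
    using emeasure_space_1 unfolding partition_fn_def
    by (subst nn_integral_0_iff_AE) (auto simp: AE_False)
  have "partition_fn \<nu> \<tau> 0 \<le> (\<integral>\<^sup>+y. 1 \<partial>\<nu>)"
    unfolding partition_fn_def using assms by (intro nn_integral_mono) (simp add: ennreal_le_1)
  also have "\<dots> = 1" using emeasure_space_1 by simp
  finally have "partition_fn \<nu> \<tau> 0 < \<top>" by (rule order_le_less_trans) simp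
  then have "ennreal (exp ((x \<bullet> x) / (\<kappa> + \<tau>))) * (partition_fn \<nu> \<tau> 0)\<^sup>2 < \<top>"
    by (simp add: ennreal_mult_less_top power2_eq_square)
  with partition_fn_mult_le[OF concave supp \<kappa> assms, of 0 x]
  have "partition_fn \<nu> \<tau> x * partition_fn \<nu> \<tau> (- x) < \<top>"
    by (auto intro: order_le_less_trans)
  then have fin: "partition_fn \<nu> \<tau> x < \<top>"
    using nz[of "- x"] by (auto simp: ennreal_mult_less_top)
  then show *: "partition_fn \<nu> \<tau> x = ennreal (Z \<tau> x)"
    by (simp add: Z_def)
  show "Z \<tau> x > 0"
    using nz[of x] unfolding * by (simp add: zero_less_iff_neq_zero[symmetric])
qed

lemma tilted_eq: "tilted \<nu> \<tau> x = density \<nu> (\<lambda>y. ennreal (tilt \<tau> x y / Z \<tau> x))"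
  by (simp add: tilted_def Z_def)

lemma sets_tilted [measurable_cong, simp]: "sets (tilted \<nu> \<tau> x) = sets borel"
  by (simp add: tilted_eq)

text \<open>The tilts form an exponential family: weighting by \<open>exp (s \<bullet> y)\<close>
  only moves the parameter from \<open>x\<close> to \<open>x + s\<close>. Every transform of a tilt
  is therefore a ratio of partition functions.\<close>

lemma nn_integral_exp_tilted:
  assumes "\<tau> \<ge> 0"
  shows "(\<integral>\<^sup>+y. ennreal (exp (s \<bullet> y)) \<partial>tilted \<nu> \<tau> x) = ennreal (Z \<tau> (x + s) / Z \<tau> x)"
proof -
  note Z = partition_fn_eq_Z[OF assms]
  have "(\<integral>\<^sup>+y. ennreal (exp (s \<bullet> y)) \<partial>tilted \<nu> \<tau> x)
      = (\<integral>\<^sup>+y. ennreal (1 / Z \<tau> x) * ennreal (tilt \<tau> (x + s) y) \<partial>\<nu>)"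
    unfolding tilted_eq
  proof (subst nn_integral_density; (intro nn_integral_cong)?)
    fix y
    have "tilt \<tau> x y / Z \<tau> x * exp (s \<bullet> y)
        = 1 / Z \<tau> x * tilt \<tau> (x + s) y"
      by (simp add: inner_add_left exp_add exp_diff)
    then show "ennreal (tilt \<tau> x y / Z \<tau> x) * ennreal (exp (s \<bullet> y))
        = ennreal (1 / Z \<tau> x) * ennreal (tilt \<tau> (x + s) y)"
      using Z(2)[of x] by (simp add: ennreal_mult[symmetric] less_imp_le)
  qed auto
  also have "\<dots> = ennreal (1 / Z \<tau> x) * partition_fn \<nu> \<tau> (x + s)"
    unfolding partition_fn_def by (rule nn_integral_cmult) auto
  also have "\<dots> = ennreal (Z \<tau> (x + s) / Z \<tau> x)"
    unfolding Z(1) using Z(2) by (simp add: ennreal_mult[symmetric] less_imp_le)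
  finally show ?thesis .
qed

lemma prob_tilted:
  assumes "\<tau> \<ge> 0"
  shows "prob_space (tilted \<nu> \<tau> x)"
  using nn_integral_exp_tilted[OF assms, of x 0] partition_fn_eq_Z(2)[OF assms, of x]
  by (intro prob_spaceI) simp

lemma Z_mult_le:
  assumes "\<tau> \<ge> 0"
  shows "Z \<tau> (x + s) * Z \<tau> (x - s) \<le> exp ((s \<bullet> s) / (\<kappa> + \<tau>)) * (Z \<tau> x)\<^sup>2"
  using partition_fn_mult_le[OF concave supp \<kappa> assms, of x s] partition_fn_eq_Z[OF assms]
  by (simp add: ennreal_mult[symmetric] ennreal_power less_imp_le ennreal_le_iff)

lemma nn_mgf_tilted:
  assumes "\<tau> \<ge> 0"
  shows "(\<integral>\<^sup>+y. ennreal (exp (s \<bullet> y)) \<partial>tilted \<nu> \<tau> x) * (\<integral>\<^sup>+y. ennreal (exp (- (s \<bullet> y))) \<partial>tilted \<nu> \<tau> x)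
    = ennreal (Z \<tau> (x + s) * Z \<tau> (x - s) / (Z \<tau> x)\<^sup>2)"
  using nn_integral_exp_tilted[OF assms, of x s] nn_integral_exp_tilted[OF assms, of x "- s"]
    partition_fn_eq_Z(2)[OF assms]
  by (simp add: ennreal_mult[symmetric] less_imp_le power2_eq_square)

text \<open>The constant may be lowered: \<open>\<kappa> + \<tau>\<close> gives the sharp covariance
  bound, while \<open>\<kappa>\<close> gives remainder constants independent of
  \<open>\<tau>\<close>.\<close>

lemma sub_gaussian_tilted:
  assumes "\<tau> \<ge> 0" "0 < c" "c \<le> \<kappa> + \<tau>"
  shows "sub_gaussian (tilted \<nu> \<tau> x) c"
proof (intro sub_gaussian.intro sub_gaussian_axioms.intro prob_tilted assms sets_tilted)
  fix s :: 'a
  have "(s \<bullet> s) / (\<kappa> + \<tau>) \<le> (s \<bullet> s) / c"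
    using assms \<kappa> by (intro divide_left_mono) auto
  then have "exp ((s \<bullet> s) / (\<kappa> + \<tau>)) * (Z \<tau> x)\<^sup>2 \<le> exp ((s \<bullet> s) / c) * (Z \<tau> x)\<^sup>2"
    by (intro mult_right_mono) auto
  with Z_mult_le[OF assms(1), of x s]
  have "Z \<tau> (x + s) * Z \<tau> (x - s) / (Z \<tau> x)\<^sup>2 \<le> exp ((s \<bullet> s) / c)"
    using partition_fn_eq_Z(2)[OF assms(1), of x]
    by (simp only: pos_divide_le_eq zero_less_power order_trans)
  then show "(\<integral>\<^sup>+y. ennreal (exp (s \<bullet> y)) \<partial>tilted \<nu> \<tau> x) * (\<integral>\<^sup>+y. ennreal (exp (- (s \<bullet> y))) \<partial>tilted \<nu> \<tau> x)
      \<le> ennreal (exp ((s \<bullet> s) / c))"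
    unfolding nn_mgf_tilted[OF assms(1)] by (rule ennreal_leI)
qed

lemma tilted_cov_eq: "tilted_cov \<nu> \<tau> x = sub_gaussian.covar (tilted \<nu> \<tau> x)"
  and tilted_mean_eq: "tilted_mean \<nu> \<tau> x = sub_gaussian.mean (tilted \<nu> \<tau> x)" if "\<tau> \<ge> 0"
proof -
  interpret sub_gaussian "tilted \<nu> \<tau> x" "\<kappa> + \<tau>"
    using \<kappa> that by (intro sub_gaussian_tilted) auto
  show *: "tilted_mean \<nu> \<tau> x = mean" by (simp add: tilted_mean_def mean_def)
  show "tilted_cov \<nu> \<tau> x = covar" by (simp add: fun_eq_iff tilted_cov_def covar_def *)
qed

lemma tilted_cov:
  assumes "\<tau> \<ge> 0"
  shows linear_tilted_cov: "linear (tilted_cov \<nu> \<tau> x)"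
    and tilted_cov_sym: "k \<bullet> tilted_cov \<nu> \<tau> x h = h \<bullet> tilted_cov \<nu> \<tau> x k"
    and tilted_cov_le: "h \<bullet> tilted_cov \<nu> \<tau> x h \<le> (h \<bullet> h) / (\<kappa> + \<tau>)"
proof -
  interpret sub_gaussian "tilted \<nu> \<tau> x" "\<kappa> + \<tau>"
    using \<kappa> assms by (intro sub_gaussian_tilted) auto
  show "linear (tilted_cov \<nu> \<tau> x)"
    and "k \<bullet> tilted_cov \<nu> \<tau> x h = h \<bullet> tilted_cov \<nu> \<tau> x k"
    and "h \<bullet> tilted_cov \<nu> \<tau> x h \<le> (h \<bullet> h) / (\<kappa> + \<tau>)"
    unfolding tilted_cov_eq[OF assms] by (rule linear_covar covar_sym covar_le)+
qed

lemma tilted_cov_ge: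
  assumes "\<tau> \<ge> 0" and "semi_log_convex \<beta> \<nu>" "\<beta> > 0"
  shows "(h \<bullet> h) / (\<beta> + \<tau>) \<le> h \<bullet> tilted_cov \<nu> \<tau> x h"
proof -
  interpret sub_gaussian "tilted \<nu> \<tau> x" "\<kappa> + \<tau>"
    using \<kappa> assms by (intro sub_gaussian_tilted) auto
  show ?thesis unfolding tilted_cov_eq[OF assms(1)]
  proof (rule covar_ge)
    fix s :: 'a
    have "exp ((s \<bullet> s) / (\<beta> + \<tau>)) * (Z \<tau> x)\<^sup>2 \<le> Z \<tau> (x + s) * Z \<tau> (x - s)"
      using partition_fn_mult_ge[OF assms(2) supp assms(3,1), of s x] partition_fn_eq_Z[OF assms(1)]
      by (simp add: ennreal_mult[symmetric] ennreal_power less_imp_le ennreal_le_iff)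
    then have "exp ((s \<bullet> s) / (\<beta> + \<tau>)) \<le> Z \<tau> (x + s) * Z \<tau> (x - s) / (Z \<tau> x)\<^sup>2"
      using partition_fn_eq_Z(2)[OF assms(1), of x] by (simp add: le_divide_eq)
    then show "ennreal (exp ((s \<bullet> s) / (\<beta> + \<tau>))) \<le> (\<integral>\<^sup>+y. ennreal (exp (s \<bullet> y)) \<partial>tilted \<nu> \<tau> x)
        * (\<integral>\<^sup>+y. ennreal (exp (- (s \<bullet> y))) \<partial>tilted \<nu> \<tau> x)"
      unfolding nn_mgf_tilted[OF assms(1)] by (rule ennreal_leI)
  qed
qed

lemma integral_tilted:
  fixes f :: "'a \<Rightarrow> 'b::{banach, second_countable_topology}"
  assumes "\<tau> \<ge> 0" and [measurable]: "f \<in> borel_measurable borel"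
  shows "integral\<^sup>L (tilted \<nu> \<tau> x) f
    = (1 / Z \<tau> x) *\<^sub>R (\<integral>y. tilt \<tau> x y *\<^sub>R f y \<partial>\<nu>)"
proof -
  have "integral\<^sup>L (tilted \<nu> \<tau> x) f
      = (\<integral>y. (tilt \<tau> x y / Z \<tau> x) *\<^sub>R f y \<partial>\<nu>)"
    unfolding tilted_eq using partition_fn_eq_Z(2)[OF assms(1), of x]
    by (intro integral_density) (auto intro!: AE_I2 simp: less_imp_le)
  also have "\<dots> = (\<integral>y. (1 / Z \<tau> x) *\<^sub>R (tilt \<tau> x y *\<^sub>R f y) \<partial>\<nu>)"
    by simp
  finally show ?thesis by (simp only: integral_scaleR_right)
qed

lemma integral_exp_tilted:
  fixes f :: "'a \<Rightarrow> 'b::{banach, second_countable_topology}"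
  assumes "\<tau> \<ge> 0" and [measurable]: "f \<in> borel_measurable borel"
  shows "(\<integral>y. exp (h \<bullet> y) *\<^sub>R f y \<partial>tilted \<nu> \<tau> x)
    = (Z \<tau> (x + h) / Z \<tau> x) *\<^sub>R (\<integral>y. f y \<partial>tilted \<nu> \<tau> (x + h))"
proof -
  have "tilt \<tau> x y *\<^sub>R exp (h \<bullet> y) *\<^sub>R f y
      = tilt \<tau> (x + h) y *\<^sub>R f y" for y
    by (simp add: inner_add_left exp_add exp_diff)
  then have "(\<integral>y. exp (h \<bullet> y) *\<^sub>R f y \<partial>tilted \<nu> \<tau> x)
      = (1 / Z \<tau> x) *\<^sub>R (\<integral>y. tilt \<tau> (x + h) y *\<^sub>R f y \<partial>\<nu>)"
    by (subst integral_tilted) (simp_all only: assms(1), measurable)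
  then show ?thesis
    using partition_fn_eq_Z(2)[OF assms(1), of "x + h"] by (simp add: integral_tilted[OF assms])
qed

lemma tilted_mean_shift:
  assumes "\<tau> \<ge> 0"
  shows "tilted_mean \<nu> \<tau> (x + h) = (1 / (\<integral>y. exp (h \<bullet> y) \<partial>tilted \<nu> \<tau> x))
    *\<^sub>R (\<integral>y. exp (h \<bullet> y) *\<^sub>R y \<partial>tilted \<nu> \<tau> x)"
proof -
  interpret prob_space "tilted \<nu> \<tau> (x + h)" by (rule prob_tilted[OF assms])
  note Z = partition_fn_eq_Z(2)[OF assms]
  have "(\<integral>y. exp (h \<bullet> y) \<partial>tilted \<nu> \<tau> x) = Z \<tau> (x + h) / Z \<tau> x"
    using integral_exp_tilted[OF assms, of "\<lambda>_. 1 :: real" x h] prob_space by simp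
  then show ?thesis
    using integral_exp_tilted[OF assms, of "\<lambda>y. y" x h] Z[of x] Z[of "x + h"]
    by (simp add: tilted_mean_def)
qed

text \<open>One \<open>K\<close> for all \<open>\<tau>\<close> and \<open>x\<close>: it will make
  the remainder of the velocity uniform in space and over compact time intervals, which mere
  differentiability of the mean would not.\<close>

lemma tilted_mean_expansion:
  obtains K where "K \<ge> 0"
    "\<And>\<tau> x h. \<tau> \<ge> 0 \<Longrightarrow> norm h \<le> 1 \<Longrightarrow>
      norm (tilted_mean \<nu> \<tau> (x + h) - tilted_mean \<nu> \<tau> x - tilted_cov \<nu> \<tau> x h) \<le> K * (norm h)\<^sup>2"
proof
  define K where "K = (2 * DIM('a) * exp ((4 * DIM('a))\<^sup>2 / \<kappa>))"
  show "K + K\<^sup>2 \<ge> 0" by (simp add: K_def)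
  fix \<tau> :: real and x h :: 'a assume "\<tau> \<ge> 0" "norm h \<le> 1"
  interpret sub_gaussian "tilted \<nu> \<tau> x" \<kappa>
    using \<kappa> \<open>\<tau> \<ge> 0\<close> by (intro sub_gaussian_tilted) auto
  show "norm (tilted_mean \<nu> \<tau> (x + h) - tilted_mean \<nu> \<tau> x - tilted_cov \<nu> \<tau> x h) \<le> (K + K\<^sup>2) * (norm h)\<^sup>2"
    using mean_shift_expansion[OF \<open>norm h \<le> 1\<close>]
    unfolding tilted_mean_shift[OF \<open>\<tau> \<ge> 0\<close>] tilted_mean_eq[OF \<open>\<tau> \<ge> 0\<close>, where x = x] tilted_cov_eq[OF \<open>\<tau> \<ge> 0\<close>]
      K_def moment_bound_def .
qed

lemma has_derivative_tilted_mean: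
  assumes "\<tau> \<ge> 0"
  shows "(tilted_mean \<nu> \<tau> has_derivative tilted_cov \<nu> \<tau> x) (at x)"
proof -
  obtain K where K: "\<And>h. norm h \<le> 1 \<Longrightarrow>
      norm (tilted_mean \<nu> \<tau> (x + h) - tilted_mean \<nu> \<tau> x - tilted_cov \<nu> \<tau> x h) \<le> K * (norm h)\<^sup>2"
    using tilted_mean_expansion assms by metis
  show ?thesis
  proof (rule has_derivativeI_sandwich[of 1 _ _ _ _ "\<lambda>y. K * norm (y - x)"])
    show "bounded_linear (tilted_cov \<nu> \<tau> x)"
      using linear_tilted_cov[OF assms] by (simp add: linear_conv_bounded_linear)
    show "norm (tilted_mean \<nu> \<tau> y - tilted_mean \<nu> \<tau> x - tilted_cov \<nu> \<tau> x (y - x)) / norm (y - x)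
        \<le> K * norm (y - x)" if "y \<noteq> x" "dist y x < 1" for y
      using K[of "y - x"] that by (simp add: dist_norm divide_le_eq power2_eq_square mult.assoc)
    show "((\<lambda>y. K * norm (y - x)) \<longlongrightarrow> 0) (at x)"
      by (auto intro!: tendsto_eq_intros)
  qed simp
qed

text \<open>Bayes' formula with the normalisation multiplied out, so that a common factor of the
  weight cancels from both sides.\<close>

lemma integral_exp_scaleR_nu:
  assumes "\<tau> \<ge> 0"
  shows "(\<integral>y. tilt \<tau> x y *\<^sub>R y \<partial>\<nu>)
    = (\<integral>y. tilt \<tau> x y \<partial>\<nu>) *\<^sub>R tilted_mean \<nu> \<tau> x"
proof -
  interpret prob_space "tilted \<nu> \<tau> x" by (rule prob_tilted[OF assms])
  note Z = partition_fn_eq_Z(2)[OF assms]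
  have "(\<integral>y. tilt \<tau> x y \<partial>\<nu>) = Z \<tau> x"
    using integral_tilted[OF assms, of "\<lambda>_. 1 :: real" x] prob_space Z[of x] by simp
  then show ?thesis
    using integral_tilted[OF assms, of "\<lambda>y. y" x] Z[of x] by (simp add: tilted_mean_def)
qed

end

section \<open>Conditional expectation for a Gaussian channel\<close>

text \<open>The conditional density at \<open>x\<close> of the output of a Gaussian channel with
  gain \<open>b\<close> and noise level \<open>a\<close>, given the input \<open>y\<close>.\<close>

definition gaussian_kernel :: "real \<Rightarrow> real \<Rightarrow> 'a::euclidean_space \<Rightarrow> 'a \<Rightarrow> real" where
  "gaussian_kernel a b x y = exp (- (norm (x - b *\<^sub>R y))\<^sup>2 / (2 * a\<^sup>2)) / (sqrt (2 * pi) * a) ^ DIM('a)"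

lemma gaussian_kernel_pos: "a > 0 \<Longrightarrow> gaussian_kernel a b x y > 0"
  by (simp add: gaussian_kernel_def)

lemma gaussian_kernel_nonneg: "a > 0 \<Longrightarrow> gaussian_kernel a b x y \<ge> 0"
  by (simp add: gaussian_kernel_def)

lemma borel_measurable_gaussian_kernel [measurable]:
  assumes [measurable]: "f \<in> borel_measurable M" "g \<in> borel_measurable M"
  shows "(\<lambda>\<omega>. gaussian_kernel a b (f \<omega>) (g \<omega>)) \<in> borel_measurable M"
  unfolding gaussian_kernel_def by measurable

text \<open>The prefactor depends on \<open>x\<close> alone and disappears on normalisation; the
  dependence on \<open>y\<close> is exactly a \<open>tilt\<close>.\<close>

lemma gaussian_kernel_eq_exp:
  fixes x y :: "'a::euclidean_space"
  assumes "a > 0"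
  shows "gaussian_kernel a b x y = exp (- (norm x)\<^sup>2 / (2 * a\<^sup>2)) / (sqrt (2 * pi) * a) ^ DIM('a)
    * exp (((b / a\<^sup>2) *\<^sub>R x) \<bullet> y - (b\<^sup>2 / a\<^sup>2) / 2 * (y \<bullet> y))"
proof -
  have "(norm (x - b *\<^sub>R y))\<^sup>2 = (norm x)\<^sup>2 - 2 * b * (x \<bullet> y) + b\<^sup>2 * (y \<bullet> y)"
    unfolding power2_norm_eq_inner
    by (simp add: inner_diff_left inner_diff_right inner_commute[of y x] power2_eq_square algebra_simps)
  moreover have "- (N - 2 * b * s + b\<^sup>2 * r) / (2 * q) = - N / (2 * q) + (b / q * s - b\<^sup>2 / q / 2 * r)"
    if "q \<noteq> 0" for N q r s :: real
    using that by (simp add: diff_divide_distrib add_divide_distrib)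
  ultimately have "- (norm (x - b *\<^sub>R y))\<^sup>2 / (2 * a\<^sup>2)
      = - (norm x)\<^sup>2 / (2 * a\<^sup>2) + (((b / a\<^sup>2) *\<^sub>R x) \<bullet> y - (b\<^sup>2 / a\<^sup>2) / 2 * (y \<bullet> y))"
    using assms by simp
  then show ?thesis unfolding gaussian_kernel_def by (simp only: exp_add times_divide_eq_left)
qed

lemma prod_std_normal_density:
  fixes z :: "'a::euclidean_space"
  shows "(\<Prod>i\<in>Basis. std_normal_density (z \<bullet> i)) = gaussian_kernel 1 0 z 0"
proof -
  have "(\<Prod>i\<in>Basis. std_normal_density (z \<bullet> i))
      = (1 / sqrt (2 * pi)) ^ DIM('a) * exp (\<Sum>i\<in>Basis. - (z \<bullet> i)\<^sup>2 / 2)"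
    by (simp add: std_normal_density_def prod_dividef exp_sum power_one_over del: divide_minus_left)
  also have "(\<Sum>i\<in>Basis. - (z \<bullet> i)\<^sup>2 / 2) = - (norm z)\<^sup>2 / 2"
    unfolding power2_norm_eq_inner euclidean_inner[of z z]
    by (simp add: sum_divide_distrib[symmetric] sum_negf power2_eq_square)
  finally show ?thesis by (simp add: gaussian_kernel_def power_one_over field_simps)
qed

lemma std_gaussian_eq: "std_gaussian = density lborel (\<lambda>z::'a::euclidean_space. ennreal (gaussian_kernel 1 0 z 0))"
  by (simp add: std_gaussian_def prod_std_normal_density)

lemma sets_std_gaussian [measurable_cong, simp]: "sets std_gaussian = sets borel"
  by (simp add: std_gaussian_eq)

lemma nn_integral_std_gaussian_affine:
  fixes G :: "'a::euclidean_space \<Rightarrow> ennreal"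
  assumes [measurable]: "G \<in> borel_measurable borel" and a: "a > 0"
  shows "(\<integral>\<^sup>+z. G (a *\<^sub>R z + b *\<^sub>R y) \<partial>std_gaussian) = (\<integral>\<^sup>+x. G x * ennreal (gaussian_kernel a b x y) \<partial>lborel)"
proof -
  have "(\<integral>\<^sup>+x. G x * ennreal (gaussian_kernel a b x y) \<partial>lborel)
    = (\<integral>\<^sup>+z. ennreal (a ^ DIM('a)) * (G (b *\<^sub>R y + a *\<^sub>R z) * ennreal (gaussian_kernel a b (b *\<^sub>R y + a *\<^sub>R z) y)) \<partial>lborel)"
    using a by (subst lborel_affine[of a "b *\<^sub>R y"]) (simp_all add: nn_integral_density nn_integral_distr)
  also have "\<dots> = (\<integral>\<^sup>+z. ennreal (gaussian_kernel 1 0 z 0) * G (a *\<^sub>R z + b *\<^sub>R y) \<partial>lborel)"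
  proof (intro nn_integral_cong)
    fix z :: 'a
    have "a ^ DIM('a) * gaussian_kernel a b (b *\<^sub>R y + a *\<^sub>R z) y = gaussian_kernel 1 0 z 0"
      using a by (simp add: gaussian_kernel_def power_mult_distrib)
    then have "ennreal (a ^ DIM('a)) * ennreal (gaussian_kernel a b (b *\<^sub>R y + a *\<^sub>R z) y) = ennreal (gaussian_kernel 1 0 z 0)"
      using a by (simp add: ennreal_mult[symmetric] gaussian_kernel_nonneg)
    then show "ennreal (a ^ DIM('a)) * (G (b *\<^sub>R y + a *\<^sub>R z) * ennreal (gaussian_kernel a b (b *\<^sub>R y + a *\<^sub>R z) y))
        = ennreal (gaussian_kernel 1 0 z 0) * G (a *\<^sub>R z + b *\<^sub>R y)"
      by (metis add.commute mult.assoc mult.commute)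
  qed
  also have "\<dots> = (\<integral>\<^sup>+z. G (a *\<^sub>R z + b *\<^sub>R y) \<partial>std_gaussian)"
    unfolding std_gaussian_eq by (rule nn_integral_density[symmetric]) auto
  finally show ?thesis ..
qed

lemma integrable_std_gaussian_inner:
  assumes i: "i \<in> Basis"
  shows "integrable std_gaussian (\<lambda>z::'a::euclidean_space. z \<bullet> i)"
proof (rule integrableI_bounded)
  \<comment> \<open>The weight \<open>\<bar>x\<bar>\<close> is attached to coordinate
    \<open>i\<close> only, so that the integral factorises into one-dimensional moments.\<close>
  define f where "f b x = (if b = i then \<bar>x\<bar> else 1) * std_normal_density x" for b :: 'a and x
  have fin: "(\<integral>\<^sup>+x. ennreal (f b x) \<partial>lborel) < \<infinity>" for b
  proof -
    have "integrable lborel (f b)"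
      using integrable_std_normal_moment_abs[of 1] integrable_std_normal_moment_abs[of 0]
      by (cases "b = i") (simp_all add: f_def[abs_def] mult.commute)
    then show ?thesis
      by (subst nn_integral_eq_integral) (auto simp: f_def)
  qed
  have "(\<integral>\<^sup>+z. ennreal (norm (z \<bullet> i)) \<partial>std_gaussian)
      = (\<integral>\<^sup>+z. ennreal (\<Prod>b\<in>Basis. std_normal_density (z \<bullet> b)) * ennreal (norm (z \<bullet> i)) \<partial>lborel)"
    unfolding std_gaussian_def by (rule nn_integral_density) auto
  also have "\<dots> = (\<integral>\<^sup>+z. (\<Prod>b\<in>Basis. ennreal (f b (z \<bullet> b))) \<partial>lborel)"
  proof (intro nn_integral_cong)
    fix z :: 'a
    have "(\<Prod>b\<in>Basis. f b (z \<bullet> b)) = (\<Prod>b\<in>Basis. std_normal_density (z \<bullet> b)) * norm (z \<bullet> i)"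
    proof -
      have "(\<Prod>b\<in>Basis. if b = i then \<bar>z \<bullet> b\<bar> else 1) = \<bar>z \<bullet> i\<bar>"
        using i by (simp add: prod.delta)
      then show ?thesis
        unfolding f_def prod.distrib by (simp only: mult.commute real_norm_def)
    qed
    then show "ennreal (\<Prod>b\<in>Basis. std_normal_density (z \<bullet> b)) * ennreal (norm (z \<bullet> i))
        = (\<Prod>b\<in>Basis. ennreal (f b (z \<bullet> b)))"
      by (subst prod_ennreal) (auto simp: f_def ennreal_mult[symmetric] prod_nonneg)
  qed
  also have "\<dots> = (\<Prod>b\<in>Basis. \<integral>\<^sup>+x. ennreal (f b x) \<partial>lborel)"
    by (rule nn_integral_lborel_prod) (auto simp: f_def[abs_def])
  also have "\<dots> < \<infinity>"
    using fin by (induction rule: finite_induct[OF finite_Basis]) (auto simp: ennreal_mult_less_top)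
  finally show "(\<integral>\<^sup>+z. ennreal (norm (z \<bullet> i)) \<partial>std_gaussian) < \<infinity>" .
qed auto

locale gaussian_channel = prob_space M for M :: "'w measure" +
  fixes \<zeta> Y :: "'w \<Rightarrow> 'a::euclidean_space" and \<nu> :: "'a measure" and a b :: real
  assumes indep: "indep_var borel \<zeta> borel Y"
    and \<zeta>_law: "distr M borel \<zeta> = std_gaussian" and Y_law: "distr M borel Y = \<nu>"
    and Y_int: "integrable \<nu> (\<lambda>y. y)"
    and a: "a > 0"
begin

abbreviation k :: "'a \<Rightarrow> 'a \<Rightarrow> real" where "k \<equiv> gaussian_kernel a b"

definition W :: "'w \<Rightarrow> 'a" where "W w = a *\<^sub>R \<zeta> w + b *\<^sub>R Y w"

definition p :: "'a \<Rightarrow> ennreal" where "p x = (\<integral>\<^sup>+y. ennreal (k x y) \<partial>\<nu>)"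

lemma meas_channel [measurable]:
  shows "\<zeta> \<in> borel_measurable M" "Y \<in> borel_measurable M" "W \<in> borel_measurable M"
proof -
  show [measurable]: "\<zeta> \<in> borel_measurable M" "Y \<in> borel_measurable M"
    using indep indep_var_rv1 indep_var_rv2 by blast+
  show "W \<in> borel_measurable M" unfolding W_def[abs_def] by measurable
qed

lemma sets_law [measurable_cong, simp]: "sets \<nu> = sets borel"
  using Y_law by (metis sets_distr)

lemma prob_law: "prob_space \<nu>"
  using prob_space_distr[OF meas_channel(2)] Y_law by simp

lemma space_law [simp]: "space \<nu> = UNIV"
  using sets_eq_imp_space_eq[OF sets_law] by simp

lemma prob_std: "prob_space (std_gaussian :: 'a measure)"
  using prob_space_distr[OF meas_channel(1)] \<zeta>_law by simp

text \<open>By independence the input can be frozen, and an affine change of variables turns the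
  Gaussian integral into one against the kernel: \<open>(W, Y)\<close> has density \<open>k\<close>
  with respect to the product of Lebesgue measure and \<nu>.\<close>

lemma nn_integral_channel:
  assumes [measurable]: "f \<in> borel_measurable (borel \<Otimes>\<^sub>M borel)"
  shows "(\<integral>\<^sup>+w. f (W w, Y w) \<partial>M)
    = (\<integral>\<^sup>+x. \<integral>\<^sup>+y. f (x, y) * ennreal (k x y) \<partial>\<nu> \<partial>lborel)"
proof -
  interpret S: prob_space "std_gaussian :: 'a measure" by (rule prob_std)
  interpret N: prob_space \<nu> by (rule prob_law)
  interpret SN: pair_sigma_finite "std_gaussian :: 'a measure" \<nu> ..
  interpret LN: pair_sigma_finite "lborel :: 'a measure" \<nu> ..
  have law: "distr M (borel \<Otimes>\<^sub>M borel) (\<lambda>w. (\<zeta> w, Y w)) = std_gaussian \<Otimes>\<^sub>M \<nu>"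
    using indep unfolding indep_var_distribution_eq \<zeta>_law Y_law by simp
  have "(\<integral>\<^sup>+w. f (W w, Y w) \<partial>M)
      = (\<integral>\<^sup>+u. f (a *\<^sub>R fst u + b *\<^sub>R snd u, snd u) \<partial>distr M (borel \<Otimes>\<^sub>M borel) (\<lambda>w. (\<zeta> w, Y w)))"
    by (subst nn_integral_distr) (auto simp: W_def)
  also have "\<dots> = (\<integral>\<^sup>+y. \<integral>\<^sup>+z. f (a *\<^sub>R z + b *\<^sub>R y, y) \<partial>std_gaussian \<partial>\<nu>)"
    unfolding law by (subst SN.nn_integral_snd[symmetric]) simp_all
  also have "\<dots> = (\<integral>\<^sup>+y. \<integral>\<^sup>+x. f (x, y) * ennreal (k x y) \<partial>lborel \<partial>\<nu>)"
  proof (intro nn_integral_cong)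
    fix y
    have "(\<lambda>x. f (x, y)) \<in> borel_measurable borel" by measurable
    then show "(\<integral>\<^sup>+z. f (a *\<^sub>R z + b *\<^sub>R y, y) \<partial>std_gaussian)
        = (\<integral>\<^sup>+x. f (x, y) * ennreal (k x y) \<partial>lborel)"
      using nn_integral_std_gaussian_affine[of "\<lambda>x. f (x, y)" a b y] a by simp
  qed
  also have "\<dots> = (\<integral>\<^sup>+x. \<integral>\<^sup>+y. f (x, y) * ennreal (k x y) \<partial>\<nu> \<partial>lborel)"
    by (rule LN.Fubini') measurable
  finally show ?thesis .
qed

abbreviation joint :: "('a \<times> 'a) measure" where "joint \<equiv> distr M (borel \<Otimes>\<^sub>M borel) (\<lambda>w. (W w, Y w))"

lemma law_channel:
  "joint
    = density (lborel \<Otimes>\<^sub>M \<nu>) (\<lambda>u. ennreal (k (fst u) (snd u)))"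
proof (rule measure_eqI)
  interpret N: prob_space \<nu> by (rule prob_law)
  show sets: "sets joint
    = sets (density (lborel \<Otimes>\<^sub>M \<nu>) (\<lambda>u. ennreal (k (fst u) (snd u))))"
    by (simp cong: sets_pair_measure_cong)
  fix A assume "A \<in> sets joint"
  then have A[measurable]: "A \<in> sets (borel \<Otimes>\<^sub>M borel)" by simp
  then have A': "A \<in> sets (lborel \<Otimes>\<^sub>M \<nu>)" by (simp cong: sets_pair_measure_cong)
  have "emeasure joint A
      = (\<integral>\<^sup>+u. indicator A u \<partial>joint)"
    by simp
  also have "\<dots> = (\<integral>\<^sup>+w. indicator A (W w, Y w) \<partial>M)"
    by (rule nn_integral_distr) auto
  also have "\<dots> = (\<integral>\<^sup>+x. \<integral>\<^sup>+y. indicator A (x, y) * ennreal (k x y) \<partial>\<nu> \<partial>lborel)"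
    by (rule nn_integral_channel) auto
  also have "\<dots> = (\<integral>\<^sup>+u. ennreal (k (fst u) (snd u)) * indicator A u \<partial>(lborel \<Otimes>\<^sub>M \<nu>))"
    using A' by (subst N.nn_integral_fst[symmetric]) (auto simp: mult.commute)
  also have "\<dots> = emeasure (density (lborel \<Otimes>\<^sub>M \<nu>) (\<lambda>u. ennreal (k (fst u) (snd u)))) A"
    using A' by (subst emeasure_density) auto
  finally show "emeasure joint A
      = emeasure (density (lborel \<Otimes>\<^sub>M \<nu>) (\<lambda>u. ennreal (k (fst u) (snd u)))) A" .
qed

lemma integrable_Y: "integrable M (\<lambda>w. Y w \<bullet> i)"
proof -
  have "integrable \<nu> (\<lambda>y. y \<bullet> i)" using Y_int by auto
  then show ?thesis unfolding Y_law[symmetric] by (subst (asm) integrable_distr_eq) auto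
qed

lemma integrable_\<zeta>: "i \<in> Basis \<Longrightarrow> integrable M (\<lambda>w. \<zeta> w \<bullet> i)"
  using integrable_std_gaussian_inner[of i] unfolding \<zeta>_law[symmetric]
  by (subst (asm) integrable_distr_eq) auto

lemma integral_channel:
  fixes f :: "'a \<Rightarrow> 'a \<Rightarrow> real"
  assumes [measurable]: "case_prod f \<in> borel_measurable (borel \<Otimes>\<^sub>M borel)"
    and int: "integrable M (\<lambda>w. f (W w) (Y w))"
  shows "expectation (\<lambda>w. f (W w) (Y w)) = (\<integral>x. (\<integral>y. k x y * f x y \<partial>\<nu>) \<partial>lborel)"
proof -
  interpret N: prob_space \<nu> by (rule prob_law)
  interpret LN: pair_sigma_finite "lborel :: 'a measure" \<nu> ..
  let ?k = "\<lambda>u. k (fst u) (snd u)"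
  have [measurable]: "case_prod f \<in> borel_measurable (lborel \<Otimes>\<^sub>M \<nu>)"
    using assms(1) by (simp cong: measurable_cong_sets sets_pair_measure_cong)
  have nn: "AE u in lborel \<Otimes>\<^sub>M \<nu>. 0 \<le> ?k u"
    using a by (intro AE_I2) (simp add: gaussian_kernel_nonneg)
  have "integrable joint (case_prod f)"
    using int by (subst integrable_distr_eq) auto
  then have i: "integrable (lborel \<Otimes>\<^sub>M \<nu>) (\<lambda>u. ?k u *\<^sub>R case_prod f u)"
    unfolding law_channel using nn by (subst (asm) integrable_density) auto
  have "expectation (\<lambda>w. f (W w) (Y w)) = integral\<^sup>L joint (case_prod f)"
    by (subst integral_distr) auto
  also have "\<dots> = (\<integral>u. ?k u *\<^sub>R case_prod f u \<partial>(lborel \<Otimes>\<^sub>M \<nu>))"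
    unfolding law_channel using nn by (intro integral_density) auto
  also have "\<dots> = (\<integral>x. (\<integral>y. k x y * f x y \<partial>\<nu>) \<partial>lborel)"
    using LN.integral_fst'[OF i] by simp
  finally show ?thesis .
qed

lemma p_pos: "p x > 0"
proof -
  interpret N: prob_space \<nu> by (rule prob_law)
  have "ennreal (k x y) \<noteq> 0" for y
    using gaussian_kernel_pos[OF a, of b x y] by simp
  then have "p x \<noteq> 0"
    using N.emeasure_space_1 unfolding p_def
    by (subst nn_integral_0_iff_AE) (auto simp: AE_False)
  then show ?thesis by (simp add: zero_less_iff_neq_zero)
qed

text \<open>The law of \<open>W\<close> has the everywhere positive density \<open>p\<close>, so an
  almost sure property holds Lebesgue almost everywhere; a closed set of full Lebesgue measure is
  the whole space.\<close>

lemma AE_channel_closed: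
  assumes "closed C" and ae: "AE w in M. W w \<in> C"
  shows "x \<in> C"
proof (rule mem_closed_if_AE_lebesgue[OF assms(1)], rule AE_completion)
  interpret N: prob_space \<nu> by (rule prob_law)
  have [measurable]: "C \<in> sets borel" using assms(1) by simp
  have [measurable]: "p \<in> borel_measurable borel" unfolding p_def[abs_def] by measurable
  have "0 = (\<integral>\<^sup>+w. indicator (- C) (W w) \<partial>M)"
    using ae by (subst nn_integral_0_iff_AE[THEN iffD2]) (auto simp: indicator_def elim!: eventually_mono)
  also have "\<dots> = (\<integral>\<^sup>+x. \<integral>\<^sup>+y. indicator (- C) x * ennreal (k x y) \<partial>\<nu> \<partial>lborel)"
    using nn_integral_channel[of "\<lambda>u. indicator (- C) (fst u)"] by simp
  also have "\<dots> = (\<integral>\<^sup>+x. indicator (- C) x * p x \<partial>lborel)"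
    unfolding p_def by (intro nn_integral_cong nn_integral_cmult) auto
  finally have "(\<integral>\<^sup>+x. indicator (- C) x * p x \<partial>lborel) = 0" ..
  then have "AE x in lborel. indicator (- C) x * p x = 0"
    by (subst (asm) nn_integral_0_iff_AE) auto
  then show "AE x in lborel. x \<in> C"
  proof eventually_elim
    case (elim x)
    then show ?case using p_pos[of x] by (auto simp: indicator_def split: if_splits)
  qed
qed

text \<open>The assumption on \<open>m\<close> says that it is the posterior mean of the input, with
  the normalisation multiplied out. Integrating it against the joint density over \<open>B\<close>
  gives the defining property of the conditional expectation.\<close>

lemma bayes:
  fixes m :: "'a \<Rightarrow> 'a"
  assumes m[measurable]: "m \<in> borel_measurable borel"
    and mean: "\<And>x. (\<integral>y. k x y *\<^sub>R y \<partial>\<nu>) = (\<integral>y. k x y \<partial>\<nu>) *\<^sub>R m x"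
    and B[measurable]: "B \<in> sets borel" and i: "i \<in> Basis"
  shows "integrable M (\<lambda>w. m (W w) \<bullet> i)"
    and "expectation (\<lambda>w. indicator B (W w) * (Y w \<bullet> i)) = expectation (\<lambda>w. indicator B (W w) * (m (W w) \<bullet> i))"
proof -
  interpret N: prob_space \<nu> by (rule prob_law)
  have kn: "k x y \<ge> 0" for x y :: 'a
    using a by (rule gaussian_kernel_nonneg)
  have k_le: "k x y \<le> 1 / (sqrt (2 * pi) * a) ^ DIM('a)" for x y :: 'a
    unfolding gaussian_kernel_def using a by (intro divide_right_mono) auto
  have ik: "integrable \<nu> (\<lambda>y. k x y)" for x
    by (rule N.integrable_const_bound[where B = "1 / (sqrt (2 * pi) * a) ^ DIM('a)"])
       (use k_le kn in \<open>auto intro!: AE_I2\<close>)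
  have iky: "integrable \<nu> (\<lambda>y. k x y *\<^sub>R y)" for x
  proof (rule Bochner_Integration.integrable_bound)
    show "integrable \<nu> (\<lambda>y. (1 / (sqrt (2 * pi) * a) ^ DIM('a)) *\<^sub>R y)" using Y_int by simp
    show "AE y in \<nu>. norm (k x y *\<^sub>R y) \<le> norm ((1 / (sqrt (2 * pi) * a) ^ DIM('a)) *\<^sub>R y)"
    proof (intro AE_I2)
      fix y
      have "\<bar>k x y\<bar> \<le> \<bar>1 / (sqrt (2 * pi) * a) ^ DIM('a)\<bar>"
        using k_le[of x y] kn[of x y] by linarith
      then show "norm (k x y *\<^sub>R y) \<le> norm ((1 / (sqrt (2 * pi) * a) ^ DIM('a)) *\<^sub>R y)"
        unfolding norm_scaleR by (intro mult_right_mono) auto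
    qed
  qed measurable
  have mi: "(\<integral>y. k x y * (y \<bullet> i) \<partial>\<nu>) = (\<integral>y. k x y * (m x \<bullet> i) \<partial>\<nu>)" for x
  proof -
    have "(\<integral>y. k x y * (y \<bullet> i) \<partial>\<nu>) = (\<integral>y. (k x y *\<^sub>R y) \<bullet> i \<partial>\<nu>)"
      by simp
    also have "\<dots> = (\<integral>y. k x y *\<^sub>R y \<partial>\<nu>) \<bullet> i"
      using iky by (rule integral_inner_left)
    also have "\<dots> = (\<integral>y. k x y \<partial>\<nu>) * (m x \<bullet> i)"
      by (simp add: mean)
    finally show ?thesis by simp
  qed
  \<comment> \<open>Jensen's inequality for the posterior at each fixed \<open>x\<close>: the
    absolute value of a mean is at most the mean of absolute values.\<close>
  have "(\<integral>\<^sup>+w. ennreal \<bar>m (W w) \<bullet> i\<bar> \<partial>M)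
      = (\<integral>\<^sup>+x. \<integral>\<^sup>+y. ennreal \<bar>m x \<bullet> i\<bar> * ennreal (k x y) \<partial>\<nu> \<partial>lborel)"
    using nn_integral_channel[of "\<lambda>u. ennreal \<bar>m (fst u) \<bullet> i\<bar>"] by simp
  also have "\<dots> \<le> (\<integral>\<^sup>+x. \<integral>\<^sup>+y. ennreal \<bar>y \<bullet> i\<bar> * ennreal (k x y) \<partial>\<nu> \<partial>lborel)"
  proof (rule nn_integral_mono)
    fix x :: 'a
    have "(\<integral>\<^sup>+y. ennreal \<bar>m x \<bullet> i\<bar> * ennreal (k x y) \<partial>\<nu>)
        = ennreal (\<integral>y. \<bar>m x \<bullet> i\<bar> * k x y \<partial>\<nu>)"
      using ik kn by (subst nn_integral_eq_integral[symmetric]) (auto simp: ennreal_mult)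
    also have "(\<integral>y. \<bar>m x \<bullet> i\<bar> * k x y \<partial>\<nu>) = \<bar>\<integral>y. k x y * (m x \<bullet> i) \<partial>\<nu>\<bar>"
      using kn by (simp add: abs_mult mult.commute)
    also have "\<dots> = \<bar>\<integral>y. k x y * (y \<bullet> i) \<partial>\<nu>\<bar>"
      by (simp only: mi)
    also have "\<dots> \<le> (\<integral>y. \<bar>k x y * (y \<bullet> i)\<bar> \<partial>\<nu>)"
      by (rule integral_abs_bound)
    also have "\<dots> = (\<integral>y. \<bar>y \<bullet> i\<bar> * k x y \<partial>\<nu>)"
      using kn by (simp add: abs_mult mult.commute)
    also have "ennreal \<dots> = (\<integral>\<^sup>+y. ennreal \<bar>y \<bullet> i\<bar> * ennreal (k x y) \<partial>\<nu>)"
    proof -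
      have "integrable \<nu> (\<lambda>y. \<bar>(k x y *\<^sub>R y) \<bullet> i\<bar>)"
        using iky by (intro integrable_abs integrable_inner_left)
      then have "integrable \<nu> (\<lambda>y. \<bar>y \<bullet> i\<bar> * k x y)"
        using kn by (simp add: abs_mult mult.commute)
      then show ?thesis
        using kn by (subst nn_integral_eq_integral[symmetric]) (auto simp: ennreal_mult)
    qed
    finally show "(\<integral>\<^sup>+y. ennreal \<bar>m x \<bullet> i\<bar> * ennreal (k x y) \<partial>\<nu>)
        \<le> (\<integral>\<^sup>+y. ennreal \<bar>y \<bullet> i\<bar> * ennreal (k x y) \<partial>\<nu>)"
      by (simp add: ennreal_leI)
  qed
  also have "\<dots> = (\<integral>\<^sup>+w. ennreal \<bar>Y w \<bullet> i\<bar> \<partial>M)"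
    using nn_integral_channel[of "\<lambda>u. ennreal \<bar>snd u \<bullet> i\<bar>"] by simp
  also have "\<dots> < \<infinity>"
    using integrable_Y[of i] by (simp add: integrable_iff_bounded)
  finally show im: "integrable M (\<lambda>w. m (W w) \<bullet> i)"
    by (intro integrableI_bounded) auto
  have iB: "integrable M (\<lambda>w. indicator B (W w) * f w)" if "integrable M f" for f :: "'w \<Rightarrow> real"
    by (rule Bochner_Integration.integrable_bound[OF that])
       (use that in \<open>auto simp: indicator_def intro!: AE_I2 borel_measurable_integrable\<close>)
  have "expectation (\<lambda>w. indicator B (W w) * (Y w \<bullet> i))
      = (\<integral>x. (\<integral>y. k x y * (indicator B x * (y \<bullet> i)) \<partial>\<nu>) \<partial>lborel)"
    by (rule integral_channel[where f = "\<lambda>x y. indicator B x * (y \<bullet> i)"]) (use iB[OF integrable_Y] in auto)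
  also have "\<dots> = (\<integral>x. (\<integral>y. k x y * (indicator B x * (m x \<bullet> i)) \<partial>\<nu>) \<partial>lborel)"
  proof (rule Bochner_Integration.integral_cong[OF refl])
    fix x
    have "(\<integral>y. k x y * (indicator B x * (y \<bullet> i)) \<partial>\<nu>)
        = indicator B x * (\<integral>y. k x y * (y \<bullet> i) \<partial>\<nu>)"
      by (simp add: mult.left_commute)
    also have "\<dots> = (\<integral>y. k x y * (indicator B x * (m x \<bullet> i)) \<partial>\<nu>)"
      unfolding mi by (simp add: mult.left_commute)
    finally show "(\<integral>y. k x y * (indicator B x * (y \<bullet> i)) \<partial>\<nu>)
        = (\<integral>y. k x y * (indicator B x * (m x \<bullet> i)) \<partial>\<nu>)" .
  qed
  also have "\<dots> = expectation (\<lambda>w. indicator B (W w) * (m (W w) \<bullet> i))"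
    by (rule integral_channel[where f = "\<lambda>x y. indicator B x * (m x \<bullet> i)", symmetric]) (use iB[OF im] in auto)
  finally show "expectation (\<lambda>w. indicator B (W w) * (Y w \<bullet> i))
      = expectation (\<lambda>w. indicator B (W w) * (m (W w) \<bullet> i))" .
qed

text \<open>Eliminating the noise through \<open>\<zeta> = (W - b Y) / a\<close> writes the
  conditioned variable as a multiple of \<open>W\<close> plus
  \<open>\<gamma> - \<alpha> * b / a\<close> times \<open>Y\<close>, so only the posterior mean is
  required. This identifies \<open>f\<close> almost surely along \<open>W\<close>; the set where two
  continuous functions agree is closed, which removes the exceptional set.\<close>

lemma continuous_cond_exp_eq:
  fixes m f :: "'a \<Rightarrow> 'a"
  assumes m: "continuous_on UNIV m"
    and mean: "\<And>x. (\<integral>y. k x y *\<^sub>R y \<partial>\<nu>) = (\<integral>y. k x y \<partial>\<nu>) *\<^sub>R m x"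
    and f: "continuous_cond_exp_given M (\<lambda>w. \<alpha> *\<^sub>R \<zeta> w + \<gamma> *\<^sub>R Y w) (\<lambda>w. a *\<^sub>R \<zeta> w + b *\<^sub>R Y w) f"
  shows "f x = (\<alpha> / a) *\<^sub>R x + (\<gamma> - \<alpha> * b / a) *\<^sub>R m x"
proof -
  define F where "F = vimage_algebra (space M) W borel"
  define g where "g x = (\<alpha> / a) *\<^sub>R x + (\<gamma> - \<alpha> * b / a) *\<^sub>R m x" for x
  have mm[measurable]: "m \<in> borel_measurable borel" using m by (rule borel_measurable_continuous_onI)
  have gc: "continuous_on UNIV g" unfolding g_def by (intro continuous_intros m)
  then have [measurable]: "g \<in> borel_measurable borel" by (rule borel_measurable_continuous_onI)
  have fc: "continuous_on UNIV f"
    and ce: "\<And>i. i \<in> Basis \<Longrightarrow> AE w in M. real_cond_exp M F (\<lambda>w. (\<alpha> *\<^sub>R \<zeta> w + \<gamma> *\<^sub>R Y w) \<bullet> i) w = f (W w) \<bullet> i"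
    using f unfolding continuous_cond_exp_given_def F_def W_def[abs_def] by auto
  have sub: "subalgebra M F"
    unfolding subalgebra_def F_def
    by (auto simp: sets_vimage_algebra2 measurable_space intro!: measurable_sets[OF meas_channel(3)])
  have WF: "W \<in> borel_measurable F"
    unfolding F_def by (rule measurable_vimage_algebra1) simp
  interpret sigma_finite_subalgebra M F
    by (rule finite_measure_subalgebra_is_sigma_finite)
       (use sub finite_measure_axioms in \<open>simp add: finite_measure_subalgebra_def finite_measure_subalgebra_axioms_def\<close>)
  have "AE w in M. f (W w) \<bullet> i = g (W w) \<bullet> i" if i: "i \<in> Basis" for i
  proof -
    let ?V = "\<lambda>w. (\<alpha> *\<^sub>R \<zeta> w + \<gamma> *\<^sub>R Y w) \<bullet> i"
    have iV: "integrable M ?V"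
      using integrable_\<zeta>[OF i] integrable_Y[of i] by (simp add: inner_add_left)
    have iW: "integrable M (\<lambda>w. W w \<bullet> i)"
      using integrable_\<zeta>[OF i] integrable_Y[of i] by (simp add: W_def inner_add_left)
    have im: "integrable M (\<lambda>w. m (W w) \<bullet> i)"
      by (rule bayes(1)[OF mm mean _ i, of UNIV]) simp
    have g_eq: "g (W w) \<bullet> i = \<alpha> / a * (W w \<bullet> i) + (\<gamma> - \<alpha> * b / a) * (m (W w) \<bullet> i)" for w
      by (simp add: g_def inner_add_left)
    have V_eq: "?V w = \<alpha> / a * (W w \<bullet> i) + (\<gamma> - \<alpha> * b / a) * (Y w \<bullet> i)" for w
      using a by (simp add: W_def inner_add_left field_simps)
    have ig: "integrable M (\<lambda>w. g (W w) \<bullet> i)"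
      unfolding g_eq using iW im by simp
    have iB: "integrable M (\<lambda>w. indicator B (W w) * h w)"
      if "integrable M h" and [measurable]: "B \<in> sets borel" for h :: "'w \<Rightarrow> real" and B
      by (rule Bochner_Integration.integrable_bound[OF that(1)])
         (use that in \<open>auto simp: indicator_def intro!: AE_I2 borel_measurable_integrable\<close>)
    have "AE w in M. real_cond_exp M F ?V w = g (W w) \<bullet> i"
    proof (rule real_cond_exp_charact[OF _ iV ig])
      show "(\<lambda>w. g (W w) \<bullet> i) \<in> borel_measurable F"
        using WF by measurable
      fix A assume "A \<in> sets F"
      then obtain B where B[measurable]: "B \<in> sets borel" and A: "A = W -` B \<inter> space M"
        unfolding F_def by (subst (asm) sets_vimage_algebra2) auto
      have set_eq: "(\<integral>w\<in>A. h w \<partial>M) = expectation (\<lambda>w. indicator B (W w) * h w)" for h :: "'w \<Rightarrow> real"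
        unfolding set_lebesgue_integral_def A
        by (intro Bochner_Integration.integral_cong refl) (simp add: indicator_def)
      have split: "expectation (\<lambda>w. indicator B (W w) * (\<alpha> / a * (W w \<bullet> i) + (\<gamma> - \<alpha> * b / a) * h w))
          = \<alpha> / a * expectation (\<lambda>w. indicator B (W w) * (W w \<bullet> i))
            + (\<gamma> - \<alpha> * b / a) * expectation (\<lambda>w. indicator B (W w) * h w)"
        if "integrable M h" for h :: "'w \<Rightarrow> real"
      proof -
        have "expectation (\<lambda>w. indicator B (W w) * (\<alpha> / a * (W w \<bullet> i) + (\<gamma> - \<alpha> * b / a) * h w))
          = expectation (\<lambda>w. \<alpha> / a * (indicator B (W w) * (W w \<bullet> i))
            + (\<gamma> - \<alpha> * b / a) * (indicator B (W w) * h w))"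
          by (intro Bochner_Integration.integral_cong refl) (simp only: distrib_left mult.left_commute)
        also have "\<dots> = expectation (\<lambda>w. \<alpha> / a * (indicator B (W w) * (W w \<bullet> i)))
            + expectation (\<lambda>w. (\<gamma> - \<alpha> * b / a) * (indicator B (W w) * h w))"
          by (intro Bochner_Integration.integral_add integrable_mult_right iB iW that B)
        finally show ?thesis by simp
      qed
      show "(\<integral>w\<in>A. ?V w \<partial>M) = (\<integral>w\<in>A. g (W w) \<bullet> i \<partial>M)"
        unfolding set_eq V_eq g_eq split[OF integrable_Y] split[OF im] bayes(2)[OF mm mean B i] ..
    qed
    with ce[OF i] show ?thesis by eventually_elim simp
  qed
  then have "AE w in M. \<forall>i\<in>Basis. f (W w) \<bullet> i = g (W w) \<bullet> i"
    by (intro AE_finite_allI) auto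
  then have "AE w in M. W w \<in> {x. f x = g x}"
    by eventually_elim (auto intro: euclidean_eqI)
  moreover have "closed {x. f x = g x}"
    by (intro closed_Collect_eq fc gc)
  ultimately have "x \<in> {x. f x = g x}"
    by (intro AE_channel_closed)
  then show ?thesis by (simp add: g_def)
qed

end

section \<open>Flows of Lipschitz vector fields\<close>

text \<open>The norm is not differentiable at the origin, hence the regularisation
  \<open>sqrt (e t \<bullet> e t + \<delta>\<^sup>2)\<close>.\<close>

lemma norm_gronwall:
  fixes e :: "real \<Rightarrow> 'a::euclidean_space"
  assumes "p \<le> q" and cont: "continuous_on {p..q} e"
    and deriv: "\<And>t. p < t \<Longrightarrow> t < q \<Longrightarrow> (e has_vector_derivative e' t) (at t)"
    and bound: "\<And>t. p < t \<Longrightarrow> t < q \<Longrightarrow> norm (e' t) \<le> L * norm (e t) + \<rho>"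
    and "L \<ge> 0" "\<rho> \<ge> 0"
  shows "norm (e q) \<le> exp (L * (q - p)) * (norm (e p) + \<rho> * (q - p))"
proof (rule field_le_epsilon)
  fix \<epsilon> :: real assume "\<epsilon> > 0"
  \<comment> \<open>The regularisation costs at most \<open>\<delta>\<close> at time
    \<open>p\<close>, and the exponential factor magnifies this to exactly
    \<open>\<epsilon>\<close>.\<close>
  define \<delta> where "\<delta> = \<epsilon> / exp (L * (q - p))"
  have \<delta>: "\<delta> > 0" using \<open>\<epsilon> > 0\<close> by (simp add: \<delta>_def)
  define n where "n t = sqrt (e t \<bullet> e t + \<delta>\<^sup>2)" for t
  \<comment> \<open>The integrating factor cancels the growth \<open>L * n t\<close>; as this factor
    is at most 1, the linear term compensates for \<open>\<rho>\<close>, and \<open>\<phi>\<close>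
    decreases.\<close>
  define \<phi> where "\<phi> t = exp (- L * (t - p)) * n t - \<rho> * (t - p)" for t
  have pos: "e t \<bullet> e t + \<delta>\<^sup>2 > 0" for t
    using \<delta> by (simp add: add_nonneg_pos)
  have n0: "n t > 0" for t unfolding n_def using pos by simp
  have n: "norm (e t) \<le> n t" for t
    unfolding n_def norm_eq_sqrt_inner by simp
  have "\<phi> q \<le> \<phi> p"
  proof (rule DERIV_nonpos_imp_decreasing_open[OF \<open>p \<le> q\<close>])
    fix t assume t: "p < t" "t < q"
    define n' where "n' = (e t \<bullet> e' t) / n t"
    have "((\<lambda>s. e s \<bullet> e s) has_vector_derivative (e t \<bullet> e' t + e' t \<bullet> e t)) (at t)"
      by (rule bounded_bilinear.has_vector_derivative[OF bounded_bilinear_inner deriv[OF t] deriv[OF t]])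
    then have "((\<lambda>s. e s \<bullet> e s) has_real_derivative (2 * (e t \<bullet> e' t))) (at t)"
      by (simp add: has_real_derivative_iff_has_vector_derivative inner_commute)
    from DERIV_chain2[OF DERIV_real_sqrt[OF pos] DERIV_add[OF this DERIV_const]]
    have "(n has_real_derivative (inverse (n t) / 2 * (2 * (e t \<bullet> e' t) + 0))) (at t)"
      unfolding n_def[abs_def] by simp
    moreover have "inverse (n t) / 2 * (2 * (e t \<bullet> e' t) + 0) = n'"
      using n0[of t] by (simp add: n'_def field_simps)
    ultimately have "(n has_real_derivative n') (at t)" by simp
    moreover have "((\<lambda>s. exp (- L * (s - p))) has_real_derivative (exp (- L * (t - p)) * (- L))) (at t)"
      and "((\<lambda>s. \<rho> * (s - p)) has_real_derivative \<rho>) (at t)"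
      using DERIV_fun_exp[OF DERIV_cmult[OF DERIV_diff[OF DERIV_ident DERIV_const[of p]], of "- L"], of t]
        DERIV_cmult[OF DERIV_diff[OF DERIV_ident DERIV_const[of p]], of \<rho> t] by simp_all
    ultimately have "(\<phi> has_real_derivative
        (exp (- L * (t - p)) * (- L) * n t + n' * exp (- L * (t - p)) - \<rho>)) (at t)"
      unfolding \<phi>_def[abs_def] by (intro DERIV_diff DERIV_mult)
    moreover have "exp (- L * (t - p)) * (- L) * n t + n' * exp (- L * (t - p)) - \<rho>
        = exp (- L * (t - p)) * (n' - L * n t) - \<rho>"
      by algebra
    ultimately have d: "(\<phi> has_real_derivative (exp (- L * (t - p)) * (n' - L * n t) - \<rho>)) (at t)"
      by simp
    have "e t \<bullet> e' t \<le> norm (e t) * norm (e' t)"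
      by (rule norm_cauchy_schwarz)
    also have "\<dots> \<le> n t * (L * n t + \<rho>)"
      using bound[OF t] n[of t] n0[of t] \<open>L \<ge> 0\<close> \<open>\<rho> \<ge> 0\<close>
      by (intro mult_mono order_trans[OF bound[OF t]] add_mono mult_left_mono) auto
    finally have "n' \<le> L * n t + \<rho>"
      unfolding n'_def using n0[of t] by (simp add: divide_le_eq mult.commute)
    then have "exp (- L * (t - p)) * (n' - L * n t) \<le> exp (- L * (t - p)) * \<rho>"
      by (intro mult_left_mono) auto
    also have "\<dots> \<le> 1 * \<rho>"
      using \<open>L \<ge> 0\<close> \<open>\<rho> \<ge> 0\<close> t by (intro mult_right_mono) auto
    finally show "\<exists>y. (\<phi> has_real_derivative y) (at t) \<and> y \<le> 0"
      using d by (intro exI[of _ "exp (- L * (t - p)) * (n' - L * n t) - \<rho>"]) simp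
  next
    show "continuous_on {p..q} \<phi>"
      unfolding \<phi>_def n_def by (intro continuous_intros cont)
  qed
  then have "exp (- L * (q - p)) * n q \<le> n p + \<rho> * (q - p)"
    by (simp add: \<phi>_def)
  then have "exp (L * (q - p)) * (exp (- L * (q - p)) * n q) \<le> exp (L * (q - p)) * (n p + \<rho> * (q - p))"
    by (intro mult_left_mono) auto
  moreover have "exp (L * (q - p)) * (exp (- L * (q - p)) * n q) = n q"
    by (simp add: exp_minus mult.assoc[symmetric])
  ultimately have nq: "n q \<le> exp (L * (q - p)) * (n p + \<rho> * (q - p))"
    by (simp only:)
  have "n p \<le> norm (e p) + \<delta>"
    unfolding n_def norm_eq_sqrt_inner using \<delta> sqrt_add_le_add_sqrt[of "e p \<bullet> e p" "\<delta>\<^sup>2"] by simp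
  then have "exp (L * (q - p)) * (n p + \<rho> * (q - p)) \<le> exp (L * (q - p)) * (norm (e p) + \<delta> + \<rho> * (q - p))"
    by (intro mult_left_mono) auto
  also have "\<dots> = exp (L * (q - p)) * (norm (e p) + \<rho> * (q - p)) + exp (L * (q - p)) * \<delta>"
    by (simp only: distrib_left add.assoc add.commute add.left_commute)
  also have "exp (L * (q - p)) * \<delta> = \<epsilon>" by (simp add: \<delta>_def)
  finally show "norm (e q) \<le> exp (L * (q - p)) * (norm (e p) + \<rho> * (q - p)) + \<epsilon>"
    using n[of q] nq by linarith
qed

lemma norm_gronwall_unit:
  fixes e :: "real \<Rightarrow> 'a::euclidean_space"
  assumes "p \<le> q" "q - p \<le> 1" and cont: "continuous_on {p..q} e"
    and deriv: "\<And>t. p < t \<Longrightarrow> t < q \<Longrightarrow> (e has_vector_derivative e' t) (at t)"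
    and bound: "\<And>t. p < t \<Longrightarrow> t < q \<Longrightarrow> norm (e' t) \<le> L * norm (e t) + \<rho>"
    and "L \<ge> 0" "\<rho> \<ge> 0"
  shows "norm (e q) \<le> exp L * (norm (e p) + \<rho> * (q - p))"
proof -
  have "L * (q - p) \<le> L" using assms by (simp add: mult_left_le)
  then have "exp (L * (q - p)) * (norm (e p) + \<rho> * (q - p)) \<le> exp L * (norm (e p) + \<rho> * (q - p))"
    using assms by (intro mult_right_mono) auto
  then show ?thesis using norm_gronwall[OF assms(1,3-7)] by simp
qed

section \<open>Differentiability in the initial point\<close>

text \<open>Differentiability at the origin phrased without a candidate derivative: linear relations
  between small vectors survive up to a relative error. Elements of the space serve as indices;
  \<open>Basis\<close> and the extra index \<open>0\<close> are enough for the relations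
  used.\<close>

definition asymptotically_linear :: "('a::euclidean_space \<Rightarrow> 'b::euclidean_space) \<Rightarrow> real \<Rightarrow> real \<Rightarrow> bool" where
  "asymptotically_linear W \<epsilon> \<delta> \<longleftrightarrow> (\<forall>J (c :: 'a \<Rightarrow> real) h. finite J \<longrightarrow> (\<forall>j\<in>J. norm (h j) \<le> \<delta>) \<longrightarrow>
      (\<Sum>j\<in>J. c j *\<^sub>R h j) = 0 \<longrightarrow> norm (\<Sum>j\<in>J. c j *\<^sub>R W (h j)) \<le> \<epsilon> * (\<Sum>j\<in>J. \<bar>c j\<bar> * norm (h j)))"

text \<open>The relation between two multiples of one basis vector makes the difference quotients
  Cauchy, so partial derivatives exist. The relation between \<open>h\<close> and its coordinate
  expansion in small multiples of the basis then compares \<open>W h\<close> with the linear map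
  that they define.\<close>

lemma has_derivative_of_asymptotically_linear:
  fixes W :: "'a::euclidean_space \<Rightarrow> 'b::euclidean_space"
  assumes comb: "\<And>\<epsilon>. \<epsilon> > 0 \<Longrightarrow> \<exists>\<delta>>0. asymptotically_linear W \<epsilon> \<delta>"
  shows "\<exists>D. (W has_derivative D) (at 0)"
proof -
  define s where "s n = 1 / real (Suc n)" for n
  define q where "q i n = (1 / s n) *\<^sub>R W (s n *\<^sub>R i)" for i n
  have s0: "s n > 0" for n by (simp add: s_def)
  have slim: "s \<longlonglongrightarrow> 0" unfolding s_def by (rule LIMSEQ_Suc[OF lim_1_over_n])
  have ssmall: "\<exists>N. \<forall>n\<ge>N. s n \<le> \<delta>" if "\<delta> > 0" for \<delta>
    using order_tendstoD(2)[OF slim that] by (auto simp: eventually_sequentially intro: less_imp_le)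
  have "Cauchy (q i)" if i: "i \<in> Basis" for i
  proof (rule metric_CauchyI)
    fix e :: real assume e: "e > 0"
    have "e / 4 > 0" using e by simp
    from comb[OF this] obtain \<delta> where \<delta>: "\<delta> > 0" and C: "asymptotically_linear W (e / 4) \<delta>"
      by (elim exE conjE)
    note C = C[unfolded asymptotically_linear_def, rule_format]
    obtain N where N: "\<forall>n\<ge>N. s n \<le> \<delta>" using ssmall[OF \<delta>] by auto
    have i0: "i \<noteq> 0" using i by auto
    have "dist (q i m) (q i n) < e" if "m \<ge> N" "n \<ge> N" for m n
    proof -
      \<comment> \<open>The relation \<open>(1 / s m) *\<^sub>R (s m *\<^sub>R i) - (1 / s n)
        *\<^sub>R (s n *\<^sub>R i) = 0\<close>, with the index \<open>0\<close> labelling the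
        second vector.\<close>
      define c where "c j = (if j = 0 then - (1 / s n) else 1 / s m)" for j :: 'a
      define h where "h j = (if j = 0 then s n *\<^sub>R i else s m *\<^sub>R i)" for j :: 'a
      have "norm (\<Sum>j\<in>{0, i}. c j *\<^sub>R W (h j)) \<le> e / 4 * (\<Sum>j\<in>{0, i}. \<bar>c j\<bar> * norm (h j))"
        using N that i i0 s0[of m] s0[of n] by (intro C) (auto simp: h_def c_def)
      then have "norm (q i m - q i n) \<le> e / 4 * 2"
        using i i0 s0[of m] s0[of n] by (simp add: h_def c_def q_def)
      then show ?thesis using e by (simp add: dist_norm)
    qed
    then show "\<exists>M. \<forall>m\<ge>M. \<forall>n\<ge>M. dist (q i m) (q i n) < e" by blast
  qed
  then have "\<exists>l. q i \<longlonglongrightarrow> l" if "i \<in> Basis" for i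
    using that by (simp add: Cauchy_convergent_iff convergent_def)
  then obtain l where l: "\<And>i. i \<in> Basis \<Longrightarrow> q i \<longlonglongrightarrow> l i" by metis
  define D where "D h = (\<Sum>i\<in>Basis. (h \<bullet> i) *\<^sub>R l i)" for h
  have "(W has_derivative D) (at 0)"
    unfolding has_derivative_at_alt
  proof (intro conjI allI impI)
    show "bounded_linear D"
      unfolding D_def
      by (intro bounded_linear_sum bounded_linear_scaleR_const bounded_linear_inner_left)
    have W0: "W 0 = 0"
    proof -
      have "(1::real) > 0" by simp
    from comb[OF this] obtain \<delta> where \<delta>: "\<delta> > 0" and C: "asymptotically_linear W (1) \<delta>"
      by (elim exE conjE)
    note C = C[unfolded asymptotically_linear_def, rule_format]
      show ?thesis using C[of "{0}" "\<lambda>_. 0" "\<lambda>_. 1"] \<delta> by simp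
    qed
    fix e :: real assume e: "e > 0"
    define d where "d = real (DIM('a))"
    \<comment> \<open>The weights of the relation below sum to \<open>norm h\<close> plus the
      absolute values of \<open>d\<close> coordinates, at most \<open>(1 + d) * norm h\<close> in
      total.\<close>
    have "e / (1 + d) > 0" using e by (simp add: d_def add_pos_nonneg)
    from comb[OF this] obtain \<delta> where \<delta>: "\<delta> > 0" and C: "asymptotically_linear W (e / (1 + d)) \<delta>"
      by (elim exE conjE)
    note C = C[unfolded asymptotically_linear_def, rule_format]
    obtain N where N: "\<forall>n\<ge>N. s n \<le> \<delta>" using ssmall[OF \<delta>] by auto
    have "norm (W h - D h) \<le> e * norm h" if h: "norm h < \<delta>" for h
    proof (rule LIMSEQ_le_const2)
      show "(\<lambda>n. norm (W h - (\<Sum>i\<in>Basis. (h \<bullet> i) *\<^sub>R q i n))) \<longlonglongrightarrow> norm (W h - D h)"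
        unfolding D_def by (intro tendsto_intros l)
      have "norm (W h - (\<Sum>i\<in>Basis. (h \<bullet> i) *\<^sub>R q i n)) \<le> e * norm h" if "n \<ge> N" for n
      proof -
        define c where "c j = (if j = 0 then 1 else - (h \<bullet> j) / s n)" for j :: 'a
        define k where "k j = (if j = 0 then h else s n *\<^sub>R j)" for j :: 'a
        have nz: "j \<noteq> 0" if "j \<in> Basis" for j :: 'a using that by auto
        have sums: "(\<Sum>j\<in>insert 0 Basis. c j *\<^sub>R k j) = 0"
          "(\<Sum>j\<in>insert 0 Basis. c j *\<^sub>R W (k j)) = W h - (\<Sum>i\<in>Basis. (h \<bullet> i) *\<^sub>R q i n)"
          "(\<Sum>j\<in>insert 0 Basis. \<bar>c j\<bar> * norm (k j)) = norm h + (\<Sum>i\<in>Basis. \<bar>h \<bullet> i\<bar>)"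
        proof -
          have "(\<Sum>j\<in>Basis. c j *\<^sub>R k j) = (\<Sum>j\<in>Basis. - ((h \<bullet> j) *\<^sub>R j))"
            using s0[of n] nz by (intro sum.cong refl) (auto simp: c_def k_def)
          then show "(\<Sum>j\<in>insert 0 Basis. c j *\<^sub>R k j) = 0"
            by (simp add: sum_negf euclidean_representation) (simp add: c_def k_def)
          have "(\<Sum>j\<in>Basis. c j *\<^sub>R W (k j)) = (\<Sum>j\<in>Basis. - ((h \<bullet> j) *\<^sub>R q j n))"
            using nz by (intro sum.cong refl) (auto simp: c_def k_def q_def)
          then show "(\<Sum>j\<in>insert 0 Basis. c j *\<^sub>R W (k j)) = W h - (\<Sum>i\<in>Basis. (h \<bullet> i) *\<^sub>R q i n)"
            by (simp add: sum_negf) (simp add: c_def k_def)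
          have "(\<Sum>j\<in>Basis. \<bar>c j\<bar> * norm (k j)) = (\<Sum>j\<in>Basis. \<bar>h \<bullet> j\<bar>)"
            using s0[of n] nz by (intro sum.cong refl) (auto simp: c_def k_def)
          then show "(\<Sum>j\<in>insert 0 Basis. \<bar>c j\<bar> * norm (k j)) = norm h + (\<Sum>i\<in>Basis. \<bar>h \<bullet> i\<bar>)"
            by simp (simp add: c_def k_def)
        qed
        have "norm (W h - (\<Sum>i\<in>Basis. (h \<bullet> i) *\<^sub>R q i n)) \<le> e / (1 + d) * (norm h + (\<Sum>i\<in>Basis. \<bar>h \<bullet> i\<bar>))"
          unfolding sums(2,3)[symmetric]
          using h N \<open>n \<ge> N\<close> s0[of n] sums(1) by (intro C) (auto simp: k_def)
        also have "\<dots> \<le> e / (1 + d) * (norm h + (\<Sum>i\<in>(Basis::'a set). norm h))"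
          using e by (intro mult_left_mono add_left_mono sum_mono Basis_le_norm) (auto simp: d_def)
        also have "\<dots> = e / (1 + d) * (norm h + d * norm h)" by (simp add: d_def)
        also have "\<dots> = e / (1 + d) * (1 + d) * norm h"
          by (simp only: distrib_right distrib_left mult.assoc mult_1_left mult_1_right)
        also have "\<dots> = e * norm h"
        proof -
          have "1 + d \<noteq> 0" using of_nat_0_le_iff[of "DIM('a)"] unfolding d_def by linarith
          then show ?thesis by simp
        qed
        finally show ?thesis .
      qed
      then show "\<exists>N. \<forall>n\<ge>N. norm (W h - (\<Sum>i\<in>Basis. (h \<bullet> i) *\<^sub>R q i n)) \<le> e * norm h" by blast
    qed
    then show "\<exists>\<delta>>0. \<forall>y. norm (y - 0) < \<delta> \<longrightarrow> norm (W y - W 0 - D (y - 0)) \<le> e * norm (y - 0)"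
      using \<delta> W0 by auto
  qed
  then show ?thesis by blast
qed

text \<open>The quadratic remainder is uniform only on \<open>{u..1 - u}\<close>. On the two layers
  of length \<open>u\<close> the linearisation error is merely of first order in the increments but
  acts for a short time; in between it is of second order. Choosing \<open>u\<close> first and the
  size of the increments afterwards makes both contributions small.\<close>

lemma flow_differentiable:
  fixes w :: "real \<Rightarrow> 'a::euclidean_space \<Rightarrow> 'a" and X :: "real \<Rightarrow> 'a \<Rightarrow> 'a"
  assumes X0: "\<And>x. X 0 x = x"
    and cont: "\<And>x. continuous_on {0..1} (\<lambda>t. X t x)"
    and ode: "\<And>x t. 0 < t \<Longrightarrow> t < 1 \<Longrightarrow> ((\<lambda>s. X s x) has_vector_derivative w t (X t x)) (at t)"
    and lip: "\<And>t x y. 0 < t \<Longrightarrow> t < 1 \<Longrightarrow> norm (w t x - w t y) \<le> L * norm (x - y)"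
    and lin: "\<And>t x. 0 < t \<Longrightarrow> t < 1 \<Longrightarrow> linear (A t x)"
    and bnd: "\<And>t x h. 0 < t \<Longrightarrow> t < 1 \<Longrightarrow> norm (A t x h) \<le> L * norm h"
    and rem: "\<And>u. 0 < u \<Longrightarrow> u < 1 / 2 \<Longrightarrow> \<exists>K \<delta>. K \<ge> 0 \<and> \<delta> > 0 \<and>
      (\<forall>t\<in>{u..1 - u}. \<forall>x h. norm h \<le> \<delta> \<longrightarrow> norm (w t (x + h) - w t x - A t x h) \<le> K * (norm h)\<^sup>2)"
    and L: "L \<ge> 0"
  shows "X 1 differentiable (at x)"
proof -
  define E where "E = exp L"
  have E: "E \<ge> 1" using L by (simp add: E_def)
  define W where "W t h = X t (x + h) - X t x" for t h
  define W' where "W' t h = w t (X t (x + h)) - w t (X t x)" for t h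
  have Wd: "((\<lambda>s. W s h) has_vector_derivative W' t h) (at t)" if "0 < t" "t < 1" for t h
    unfolding W_def W'_def by (intro has_vector_derivative_diff ode that)
  have Wc: "continuous_on {0..1} (\<lambda>t. W t h)" for h
    unfolding W_def by (intro continuous_intros cont)
  have W'L: "norm (W' t h) \<le> L * norm (W t h)" if "0 < t" "t < 1" for t h
    unfolding W'_def W_def using lip[OF that] by simp
  have WE: "norm (W t h) \<le> E * norm h" if t: "0 \<le> t" "t \<le> 1" for t h
  proof -
    have "norm (W t h) \<le> exp L * (norm (W 0 h) + 0 * (t - 0))"
    proof (rule norm_gronwall_unit)
      show "continuous_on {0..t} (\<lambda>t. W t h)" 
        by (rule continuous_on_subset[OF Wc]) (use t in auto)
      show "norm (W' r h) \<le> L * norm (W r h) + 0" if "0 < r" "r < t" for r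
        using W'L that t by simp
    qed (use t L Wd in auto)
    then show ?thesis by (simp add: E_def W_def X0)
  qed
  have "\<exists>D. (W 1 has_derivative D) (at 0)"
  proof (rule has_derivative_of_asymptotically_linear)
    fix \<epsilon> :: real assume \<epsilon>: "\<epsilon> > 0"
    \<comment> \<open>The two layers together contribute at most \<open>4 * L * E ^ 4 * u\<close>,
      allotted half of \<open>\<epsilon>\<close>. The power of \<open>E\<close> collects one
      Gronwall factor for each of the three time intervals and one for the growth of the
      increments.\<close>
    define u where "u = min (1 / 4) (\<epsilon> / (8 * (L + 1) * E ^ 4))"
    have E4: "E ^ 4 > 0" using E by simp
    have u: "0 < u" "u \<le> 1 / 4" "u \<le> \<epsilon> / (8 * (L + 1) * E ^ 4)"
    proof -
      have "0 < \<epsilon> / (8 * (L + 1) * E ^ 4)" using \<epsilon> L E4 by (intro divide_pos_pos mult_pos_pos) auto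
      then show "0 < u" unfolding u_def by simp
    qed (unfold u_def, rule min.cobounded1, rule min.cobounded2)
    have u': "4 * L * E ^ 4 * u \<le> \<epsilon> / 2"
    proof -
      have "4 * L * E ^ 4 * u \<le> 4 * (L + 1) * E ^ 4 * u"
        using u(1) E4 by (intro mult_right_mono) auto
      also have "\<dots> \<le> 4 * (L + 1) * E ^ 4 * (\<epsilon> / (8 * (L + 1) * E ^ 4))"
        using u(3) L E4 by (intro mult_left_mono) auto
      also have "\<dots> = 4 * ((L + 1) * E ^ 4) * (\<epsilon> / (8 * ((L + 1) * E ^ 4)))"
        by (simp only: mult.assoc)
      also have "\<dots> = \<epsilon> / 2"
      proof -
        have "(L + 1) * E ^ 4 \<noteq> 0" using L E4 by simp
        then show ?thesis by simp
      qed
      finally show ?thesis .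
    qed
    obtain K \<delta> where K: "K \<ge> 0" and \<delta>: "\<delta> > 0"
      and r: "\<And>t x h. t \<in> {u..1 - u} \<Longrightarrow> norm h \<le> \<delta> \<Longrightarrow> norm (w t (x + h) - w t x - A t x h) \<le> K * (norm h)\<^sup>2"
      using rem[of u] u by auto
    \<comment> \<open>Increments grow at most by the factor \<open>E\<close>, so they remain in the
      range of the remainder bound; the second entry gives the middle interval the other half of
      \<open>\<epsilon>\<close>.\<close>
    define \<delta>' where "\<delta>' = min (\<delta> / E) (\<epsilon> / (2 * (K + 1) * E ^ 4))"
    have \<delta>': "0 < \<delta>'" "E * \<delta>' \<le> \<delta>" "\<delta>' \<le> \<epsilon> / (2 * (K + 1) * E ^ 4)"
    proof -
      have "0 < \<epsilon> / (2 * (K + 1) * E ^ 4)" using \<epsilon> K E4 by (intro divide_pos_pos mult_pos_pos) auto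
      moreover have "0 < \<delta> / E" using \<delta> E by simp
      ultimately show "0 < \<delta>'" unfolding \<delta>'_def by simp
      have "E * \<delta>' \<le> E * (\<delta> / E)"
        unfolding \<delta>'_def using E by (intro mult_left_mono min.cobounded1) auto
      then show "E * \<delta>' \<le> \<delta>" using E by simp
    qed (unfold \<delta>'_def, rule min.cobounded2)
    have \<delta>'': "K * E ^ 4 * \<delta>' \<le> \<epsilon> / 2"
    proof -
      have "K * E ^ 4 * \<delta>' \<le> (K + 1) * E ^ 4 * \<delta>'"
        using \<delta>'(1) E4 by (intro mult_right_mono) auto
      also have "\<dots> \<le> (K + 1) * E ^ 4 * (\<epsilon> / (2 * (K + 1) * E ^ 4))"
        using \<delta>'(3) K E4 by (intro mult_left_mono) auto
      also have "\<dots> = ((K + 1) * E ^ 4) * (\<epsilon> / (2 * ((K + 1) * E ^ 4)))"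
        by (simp only: mult.assoc)
      also have "\<dots> = \<epsilon> / 2"
      proof -
        have "(K + 1) * E ^ 4 \<noteq> 0" using K E4 by simp
        then show ?thesis by simp
      qed
      finally show ?thesis .
    qed
    show "\<exists>\<delta>>0. asymptotically_linear (W 1) \<epsilon> \<delta>"
      unfolding asymptotically_linear_def
    proof (intro exI[of _ \<delta>'] conjI \<delta>'(1) allI impI)
      fix J and c :: "'a \<Rightarrow> real" and h :: "'a \<Rightarrow> 'a"
      assume J: "finite J" and h: "\<forall>j\<in>J. norm (h j) \<le> \<delta>'" and ch: "(\<Sum>j\<in>J. c j *\<^sub>R h j) = 0"
      define S where "S = (\<Sum>j\<in>J. \<bar>c j\<bar> * norm (h j))"
      have S: "S \<ge> 0" by (auto simp: S_def intro!: sum_nonneg)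
      \<comment> \<open>Since \<open>A\<close> is linear, this combination satisfies the linearised
        equation up to an error proportional to \<open>S\<close>, and it vanishes at time
        \<open>0\<close> because the relation between the \<open>h j\<close> is exact.\<close>
      define e where "e t = (\<Sum>j\<in>J. c j *\<^sub>R W t (h j))" for t
      define e' where "e' t = (\<Sum>j\<in>J. c j *\<^sub>R W' t (h j))" for t
      have ed: "(e has_vector_derivative e' t) (at t)" if "0 < t" "t < 1" for t
        unfolding e_def[abs_def] e'_def
        by (intro has_vector_derivative_sum bounded_linear.has_vector_derivative[OF bounded_linear_scaleR_right] Wd that)
      have ec: "continuous_on {p..q} e" if "0 \<le> p" "q \<le> 1" for p q
        unfolding e_def by (intro continuous_intros continuous_on_subset[OF Wc]) (use that in auto)
      have e'_le: "norm (e' t) \<le> L * norm (e t) + \<rho> * S"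
        if t: "0 < t" "t < 1" and \<rho>: "\<And>j. j \<in> J \<Longrightarrow> norm (W' t (h j) - A t (X t x) (W t (h j))) \<le> \<rho> * norm (h j)"
        for t \<rho>
      proof -
        have "A t (X t x) (e t) = (\<Sum>j\<in>J. c j *\<^sub>R A t (X t x) (W t (h j)))"
          unfolding e_def using lin[OF t] by (simp add: linear_sum linear_scale)
        then have "e' t = A t (X t x) (e t) + (\<Sum>j\<in>J. c j *\<^sub>R (W' t (h j) - A t (X t x) (W t (h j))))"
          by (simp add: e'_def scaleR_diff_right sum_subtractf)
        then have "norm (e' t) \<le> norm (A t (X t x) (e t))
            + norm (\<Sum>j\<in>J. c j *\<^sub>R (W' t (h j) - A t (X t x) (W t (h j))))"
          using norm_triangle_ineq by metis
        also have "\<dots> \<le> L * norm (e t) + (\<Sum>j\<in>J. \<bar>c j\<bar> * (\<rho> * norm (h j)))"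
        proof (intro add_mono bnd t sum_norm_le)
          fix j assume "j \<in> J"
          then show "norm (c j *\<^sub>R (W' t (h j) - A t (X t x) (W t (h j)))) \<le> \<bar>c j\<bar> * (\<rho> * norm (h j))"
            using \<rho> by (simp add: mult_left_mono)
        qed
        also have "(\<Sum>j\<in>J. \<bar>c j\<bar> * (\<rho> * norm (h j))) = \<rho> * S"
          unfolding S_def sum_distrib_left by (simp add: mult_ac)
        finally show ?thesis .
      qed
      \<comment> \<open>No cancellation is used here: the increment of the field and its
        linearisation are each bounded by \<open>L * E * norm (h j)\<close>.\<close>
      have rough: "norm (e' t) \<le> L * norm (e t) + 2 * L * E * S" if t: "0 < t" "t < 1" for t
      proof (rule e'_le[OF t])
        fix j
        have "norm (W' t (h j) - A t (X t x) (W t (h j))) \<le> L * norm (W t (h j)) + L * norm (W t (h j))"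
          by (intro norm_triangle_le_diff add_mono W'L bnd t)
        also have "\<dots> = 2 * L * norm (W t (h j))" by simp
        also have "\<dots> \<le> 2 * L * (E * norm (h j))"
          using t L by (intro mult_left_mono WE) auto
        finally show "norm (W' t (h j) - A t (X t x) (W t (h j))) \<le> 2 * L * E * norm (h j)"
          by (simp add: mult.assoc)
      qed
      \<comment> \<open>One of the two factors \<open>norm (h j)\<close> of the quadratic remainder
        is traded for \<open>\<delta>'\<close>, the other enters \<open>S\<close>.\<close>
      have fine: "norm (e' t) \<le> L * norm (e t) + K * E\<^sup>2 * \<delta>' * S" if t: "t \<in> {u..1 - u}" for t
      proof -
        have t': "0 < t" "t < 1" using t u by auto
        show ?thesis
        proof (rule e'_le[OF t'])
          fix j assume j: "j \<in> J"
          have Wj: "norm (W t (h j)) \<le> E * norm (h j)" using t' by (intro WE) auto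
          also have "\<dots> \<le> E * \<delta>'" using h j E by (intro mult_left_mono) auto
          also have "\<dots> \<le> \<delta>" by (rule \<delta>'(2))
          finally have "norm (w t (X t x + W t (h j)) - w t (X t x) - A t (X t x) (W t (h j))) \<le> K * (norm (W t (h j)))\<^sup>2"
            by (intro r t)
          also have "X t x + W t (h j) = X t (x + h j)" by (simp add: W_def)
          also have "K * (norm (W t (h j)))\<^sup>2 \<le> K * (E * norm (h j))\<^sup>2"
            using Wj K by (intro mult_left_mono power_mono) auto
          also have "\<dots> = K * E\<^sup>2 * norm (h j) * norm (h j)"
            by (simp add: power2_eq_square)
          also have "\<dots> \<le> K * E\<^sup>2 * \<delta>' * norm (h j)"
            using h j K by (intro mult_right_mono mult_left_mono) auto
          finally show "norm (W' t (h j) - A t (X t x) (W t (h j))) \<le> K * E\<^sup>2 * \<delta>' * norm (h j)"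
            by (simp add: W'_def)
        qed
      qed
      have e0: "e 0 = 0" using ch by (simp add: e_def W_def X0)
      have "norm (e u) \<le> exp L * (norm (e 0) + 2 * L * E * S * (u - 0))"
        by (rule norm_gronwall_unit[where e' = e']) (use u L E S in \<open>auto intro!: ec ed rough\<close>)
      then have s1: "norm (e u) \<le> E * (2 * L * E * S * u)"
        using e0 by (simp add: E_def)
      have "norm (e (1 - u)) \<le> exp L * (norm (e u) + K * E\<^sup>2 * \<delta>' * S * (1 - u - u))"
        by (rule norm_gronwall_unit[where e' = e']) (use u \<delta>' L K E S in \<open>auto intro!: ec ed fine\<close>)
      also have "\<dots> \<le> E * (E * (2 * L * E * S * u) + K * E\<^sup>2 * \<delta>' * S * 1)"
        unfolding E_def[symmetric] using u \<delta>' K E S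
        by (intro mult_left_mono add_mono s1) auto
      finally have s2: "norm (e (1 - u)) \<le> E * (E * (2 * L * E * S * u) + K * E\<^sup>2 * \<delta>' * S * 1)" .
      have "norm (e 1) \<le> exp L * (norm (e (1 - u)) + 2 * L * E * S * (1 - (1 - u)))"
        by (rule norm_gronwall_unit[where e' = e']) (use u L E S in \<open>auto intro!: ec ed rough\<close>)
      also have "\<dots> \<le> E * (E * (E * (2 * L * E * S * u) + K * E\<^sup>2 * \<delta>' * S * 1) + 2 * L * E * S * u)"
        unfolding E_def[symmetric] using E s2 S L u(1) by (intro mult_left_mono add_mono) auto
      also have "\<dots> = S * (E ^ 4 * (2 * L * u) + E ^ 4 * (K * \<delta>') + E ^ 2 * (2 * L * u))"
        by (simp add: power4_eq_xxxx power2_eq_square algebra_simps)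
      also have "\<dots> \<le> S * (E ^ 4 * (2 * L * u) + E ^ 4 * (K * \<delta>') + E ^ 4 * (2 * L * u))"
        using S E L u by (intro mult_left_mono add_mono order_refl mult_right_mono power_increasing) auto
      also have "\<dots> = S * (4 * L * E ^ 4 * u + K * E ^ 4 * \<delta>')"
        by (simp add: algebra_simps)
      also have "\<dots> \<le> S * (\<epsilon> / 2 + \<epsilon> / 2)"
        using S u' \<delta>'' by (intro mult_left_mono add_mono)
      finally show "norm (\<Sum>j\<in>J. c j *\<^sub>R W 1 (h j)) \<le> \<epsilon> * (\<Sum>j\<in>J. \<bar>c j\<bar> * norm (h j))"
        by (simp add: e_def S_def mult.commute)
    qed
  qed
  then obtain D where D: "(W 1 has_derivative D) (at 0)" by blast
  have "((\<lambda>y. W 1 (y - x) + X 1 x) has_derivative D) (at x)"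
    using D by (auto intro!: derivative_eq_intros has_derivative_compose[of "\<lambda>y. y - x" "\<lambda>y. y" x UNIV "W 1" D])
  then show ?thesis
    unfolding differentiable_def W_def by auto
qed

section \<open>The Gaussian interpolation flow\<close>

text \<open>Polarisation with \<open>k\<close> parallel to \<open>A h\<close> and as long as
  \<open>h\<close>: by symmetry, \<open>k \<bullet> A h\<close> is a difference of two values of the
  quadratic form.\<close>

lemma symmetric_norm_bound:
  fixes A :: "'a::euclidean_space \<Rightarrow> 'a"
  assumes "linear A" and sym: "\<And>h k. k \<bullet> A h = h \<bullet> A k"
    and quad: "\<And>h. \<bar>h \<bullet> A h\<bar> \<le> L * (h \<bullet> h)" and "L \<ge> 0"
  shows "norm (A h) \<le> L * norm h"
proof (cases "A h = 0 \<or> h = 0")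
  case True
  then show ?thesis using \<open>L \<ge> 0\<close> linear_0[OF \<open>linear A\<close>] by auto
next
  case False
  then have nz: "norm (A h) > 0" "norm h > 0" by auto
  define k where "k = (norm h / norm (A h)) *\<^sub>R A h"
  have k1: "k \<bullet> A h = norm h * norm (A h)"
    using nz by (simp add: k_def power2_norm_eq_inner[symmetric] power2_eq_square)
  have k2: "k \<bullet> k = h \<bullet> h"
    using nz by (simp add: k_def power2_norm_eq_inner[symmetric] power2_eq_square)
  have "4 * (k \<bullet> A h) = (h + k) \<bullet> A (h + k) - (h - k) \<bullet> A (h - k)"
    using sym[of h k] linear_add[OF \<open>linear A\<close>] linear_diff[OF \<open>linear A\<close>]
    by (simp add: inner_add_left inner_add_right inner_diff_left inner_diff_right)
  also have "\<dots> \<le> L * ((h + k) \<bullet> (h + k)) + L * ((h - k) \<bullet> (h - k))"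
    using quad[of "h + k"] quad[of "h - k"] by linarith
  also have "\<dots> = 2 * L * (h \<bullet> h + k \<bullet> k)"
    by (simp add: inner_add_left inner_add_right inner_diff_left inner_diff_right algebra_simps)
  also have "\<dots> = 4 * (L * (norm h * norm h))"
    by (simp only: k2) (simp add: power2_norm_eq_inner[symmetric] power2_eq_square)
  finally have "norm h * norm (A h) \<le> norm h * (L * norm h)"
    using k1 by (simp add: mult_ac)
  then show ?thesis using nz by simp
qed

text \<open>The mean value theorem is applied to the component along the segment, so a one-sided
  bound on the quadratic form is enough.\<close>

lemma inner_derivative_bound:
  fixes f :: "'a::euclidean_space \<Rightarrow> 'a"
  assumes deriv: "\<And>x. (f has_derivative A x) (at x)"
    and quad: "\<And>x h. h \<bullet> A x h \<le> c * (h \<bullet> h)"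
  shows "(x - y) \<bullet> (f x - f y) \<le> c * ((x - y) \<bullet> (x - y))"
proof -
  define h where "h = x - y"
  have d: "((\<lambda>s. h \<bullet> f (y + s *\<^sub>R h)) has_real_derivative (h \<bullet> A (y + s *\<^sub>R h) h)) (at s)" for s
  proof -
    have "((\<lambda>s. f (y + s *\<^sub>R h)) has_derivative (\<lambda>r. A (y + s *\<^sub>R h) (r *\<^sub>R h))) (at s)"
      by (rule has_derivative_compose[OF _ deriv]) (auto intro!: derivative_eq_intros)
    then have "((\<lambda>s. h \<bullet> f (y + s *\<^sub>R h)) has_derivative (\<lambda>r. h \<bullet> A (y + s *\<^sub>R h) (r *\<^sub>R h))) (at s)"
      by (rule has_derivative_inner_right)
    moreover have "linear (A (y + s *\<^sub>R h))"
      using deriv has_derivative_linear by blast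
    ultimately show ?thesis
      by (simp add: has_field_derivative_def linear_scale mult_commute_abs)
  qed
  obtain s where "h \<bullet> f (y + 1 *\<^sub>R h) - h \<bullet> f (y + 0 *\<^sub>R h) = (1 - 0) * (h \<bullet> A (y + s *\<^sub>R h) h)"
    using MVT2[of 0 1 "\<lambda>s. h \<bullet> f (y + s *\<^sub>R h)", OF _ d] by auto
  then have "h \<bullet> (f x - f y) = h \<bullet> A (y + s *\<^sub>R h) h"
    by (simp add: h_def inner_diff_right)
  then show ?thesis using quad[of h "y + s *\<^sub>R h"] by (simp add: h_def)
qed

text \<open>Supplying a solution \<open>q\<close> of \<open>q' = 2 c q\<close> replaces the
  exponential of the integrated rate, so nothing is asked of \<open>c\<close> near the endpoints.
  The rate may have either sign, which covers both directions of time.\<close>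

lemma flow_contraction:
  fixes w :: "real \<Rightarrow> 'a::euclidean_space \<Rightarrow> 'a" and X :: "real \<Rightarrow> 'a \<Rightarrow> 'a"
  assumes cont: "\<And>x. continuous_on {0..1} (\<lambda>t. X t x)"
    and ode: "\<And>x t. 0 < t \<Longrightarrow> t < 1 \<Longrightarrow> ((\<lambda>s. X s x) has_vector_derivative w t (X t x)) (at t)"
    and mono: "\<And>t x y. 0 < t \<Longrightarrow> t < 1 \<Longrightarrow> (x - y) \<bullet> (w t x - w t y) \<le> c t * ((x - y) \<bullet> (x - y))"
    and q_cont: "continuous_on {0..1} q" and q_pos: "\<And>t. 0 \<le> t \<Longrightarrow> t \<le> 1 \<Longrightarrow> q t > 0"
    and q_deriv: "\<And>t. 0 < t \<Longrightarrow> t < 1 \<Longrightarrow> (q has_real_derivative (2 * c t * q t)) (at t)"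
  shows "norm (X 1 x - X 1 y) \<le> sqrt (q 1 / q 0) * norm (X 0 x - X 0 y)"
proof -
  define e where "e t = X t x - X t y" for t
  define D where "D t = e t \<bullet> e t" for t
  have "D 1 / q 1 \<le> D 0 / q 0"
  proof (rule DERIV_nonpos_imp_decreasing_open[of 0 1 "\<lambda>t. D t / q t"])
    fix t :: real assume t: "0 < t" "t < 1"
    define e' where "e' = w t (X t x) - w t (X t y)"
    have ed: "(e has_vector_derivative e') (at t)"
      unfolding e_def[abs_def] e'_def by (intro has_vector_derivative_diff ode t)
    have "(D has_vector_derivative (e t \<bullet> e' + e' \<bullet> e t)) (at t)"
      unfolding D_def[abs_def]
      by (rule bounded_bilinear.has_vector_derivative[OF bounded_bilinear_inner ed ed])
    then have "(D has_real_derivative (2 * (e t \<bullet> e'))) (at t)"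
      by (simp add: has_real_derivative_iff_has_vector_derivative inner_commute)
    moreover have q: "q t > 0" using q_pos t by simp
    ultimately have "((\<lambda>t. D t / q t) has_real_derivative
        ((2 * (e t \<bullet> e') * q t - D t * (2 * c t * q t)) / (q t * q t))) (at t)"
      using q_deriv[OF t] by (intro DERIV_divide) auto
    moreover have "(2 * (e t \<bullet> e') * q t - D t * (2 * c t * q t)) / (q t * q t) \<le> 0"
    proof (rule divide_nonpos_nonneg)
      have "e t \<bullet> e' \<le> c t * D t"
        using mono[OF t, of "X t x" "X t y"] by (simp add: e_def e'_def D_def)
      then have "(2 * q t) * (e t \<bullet> e') \<le> (2 * q t) * (c t * D t)"
        using q by (intro mult_left_mono) auto
      then show "2 * (e t \<bullet> e') * q t - D t * (2 * c t * q t) \<le> 0"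
        by (simp add: mult_ac)
    qed simp
    ultimately show "\<exists>y. ((\<lambda>t. D t / q t) has_real_derivative y) (at t) \<and> y \<le> 0" by blast
  next
    have "\<forall>t\<in>{0..1}. q t \<noteq> 0" using q_pos by fastforce
    then show "continuous_on {0..1} (\<lambda>t. D t / q t)"
      unfolding D_def e_def by (intro continuous_intros cont q_cont)
  qed simp
  then have "D 1 \<le> q 1 / q 0 * D 0"
    using q_pos[of 0] q_pos[of 1] by (simp add: field_simps)
  then have "sqrt (D 1) \<le> sqrt (q 1 / q 0 * D 0)" by simp
  then show ?thesis
    unfolding D_def e_def by (simp only: real_sqrt_mult norm_eq_sqrt_inner)
qed

lemma lipschitz_imp_jacobian_norm_le:
  fixes f :: "'a::euclidean_space \<Rightarrow> 'a"
  assumes lip: "\<And>x y. norm (f x - f y) \<le> C * norm (x - y)" and "C \<ge> 0"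
    and diff: "f differentiable (at x)"
  shows "jacobian_norm f x \<le> C"
proof -
  define D where "D = frechet_derivative f (at x)"
  have D: "(f has_derivative D) (at x)"
    unfolding D_def using diff frechet_derivative_works by blast
  then have lin: "linear D" by (rule has_derivative_linear)
  have "norm (D h) \<le> C * norm h" for h
  proof (cases "h = 0")
    case True
    then show ?thesis using linear_0[OF lin] by simp
  next
    case False
    have "norm (D h) / norm h \<le> C"
    proof (rule field_le_epsilon)
      fix e :: real assume "e > 0"
      then obtain d where d: "d > 0" "\<And>y. norm (y - x) < d \<Longrightarrow> norm (f y - f x - D (y - x)) \<le> e * norm (y - x)"
        using D unfolding has_derivative_at_alt by blast
      define s where "s = d / (2 * norm h)"
      have s: "s > 0" "norm (s *\<^sub>R h) < d"
        using d(1) False by (auto simp: s_def)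
      have "norm (D (s *\<^sub>R h)) \<le> norm (f (x + s *\<^sub>R h) - f x) + norm (f (x + s *\<^sub>R h) - f x - D (s *\<^sub>R h))"
        using norm_triangle_ineq4[of "f (x + s *\<^sub>R h) - f x" "f (x + s *\<^sub>R h) - f x - D (s *\<^sub>R h)"] by simp
      also have "\<dots> \<le> C * norm (s *\<^sub>R h) + e * norm (s *\<^sub>R h)"
        using lip[of "x + s *\<^sub>R h" x] d(2)[of "x + s *\<^sub>R h"] s(2) by (intro add_mono) auto
      finally have "s * norm (D h) \<le> s * ((C + e) * norm h)"
        using s(1) linear_scale[OF lin] by (simp add: algebra_simps)
      then have "norm (D h) \<le> (C + e) * norm h" using s(1) by simp
      then show "norm (D h) / norm h \<le> C + e" using False by (simp add: divide_le_eq)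
    qed
    then show ?thesis using False by (simp add: divide_le_eq)
  qed
  then show ?thesis unfolding jacobian_norm_def D_def[symmetric] by (rule onorm_bound[OF \<open>C \<ge> 0\<close>])
qed

section \<open>Coefficients of the schedule\<close>

locale schedule =
  fixes a b :: "real \<Rightarrow> real"
  assumes sched: "interpolation_schedule a b"
begin

abbreviation a' :: "real \<Rightarrow> real" where "a' \<equiv> time_deriv a"
abbreviation b' :: "real \<Rightarrow> real" where "b' \<equiv> time_deriv b"

text \<open>\<open>\<sigma>\<close> and \<open>\<tau>\<close> are the parameters of the tilt at time
  \<open>t\<close>; \<open>\<gamma>\<close> is the coefficient left on the target variable once the
  Gaussian one is eliminated.\<close>

definition \<sigma> :: "real \<Rightarrow> real" where "\<sigma> t = b t / (a t)\<^sup>2"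
definition \<tau> :: "real \<Rightarrow> real" where "\<tau> t = (b t)\<^sup>2 / (a t)\<^sup>2"
definition \<gamma> :: "real \<Rightarrow> real" where "\<gamma> t = b' t - a' t * b t / a t"

lemma a'_le: "0 < t \<Longrightarrow> t < 1 \<Longrightarrow> a' t \<le> 0"
  and b'_ge: "0 < t \<Longrightarrow> t < 1 \<Longrightarrow> b' t \<ge> 0"
  and a0: "a 0 > 0" and a1: "a 1 = 0" and b1: "b 1 = 1"
  and a_pos: "0 < t \<Longrightarrow> t < 1 \<Longrightarrow> a t > 0"
  and b_pos: "0 < t \<Longrightarrow> t < 1 \<Longrightarrow> b t > 0"
  using sched unfolding interpolation_schedule_def by auto

lemma time_deriv_unique:
  assumes "0 < t" "t < 1" "(f has_real_derivative d) (at t)"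
  shows "time_deriv f t = d"
proof -
  have "at t within {0..1} = at t"
    using assms by (intro at_within_interior) auto
  then show ?thesis
    using assms(3) unfolding time_deriv_def
    by (simp add: has_real_derivative_iff_has_vector_derivative vector_derivative_at)
qed

lemma C2_time_deriv:
  assumes "C2_on {0..<1} f"
  obtains f' where "continuous_on {0..<1} f'" "\<And>t. 0 < t \<Longrightarrow> t < 1 \<Longrightarrow> f' t = time_deriv f t"
    "\<And>t. 0 < t \<Longrightarrow> t < 1 \<Longrightarrow> (f has_real_derivative f' t) (at t)"
    "continuous_on {0..<1} f"
proof -
  obtain f' where f': "\<And>t. t \<in> {0..<1} \<Longrightarrow> (f has_real_derivative f' t) (at t within {0..<1})" "C1_on {0..<1} f'"
    using assms unfolding C2_on_def by blast
  have d: "(f has_real_derivative f' t) (at t)" if "0 < t" "t < 1" for t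
  proof -
    have "t \<in> interior {0..<1}" using that by simp
    then have "at t within {0..<1} = at t" by (rule at_within_interior)
    then show ?thesis using f'(1)[of t] that by simp
  qed
  obtain f'' where "\<And>t. t \<in> {0..<1} \<Longrightarrow> (f' has_real_derivative f'' t) (at t within {0..<1})"
    using f'(2) unfolding C1_on_def by blast
  then have "continuous_on {0..<1} f'" by (meson DERIV_continuous_on)
  moreover have "continuous_on {0..<1} f" using f'(1) by (meson DERIV_continuous_on)
  moreover have "f' t = time_deriv f t" if "0 < t" "t < 1" for t
    using time_deriv_unique[OF that d[OF that]] ..
  ultimately show ?thesis using d by (intro that[of f']) auto
qed

lemma C2_a: "C2_on {0..<1} a" and C2_b: "C2_on {0..<1} b"
  using sched unfolding interpolation_schedule_def by auto

lemma DERIV_a: "0 < t \<Longrightarrow> t < 1 \<Longrightarrow> (a has_real_derivative a' t) (at t)"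
  by (rule C2_time_deriv[OF C2_a]) metis

lemma DERIV_b: "0 < t \<Longrightarrow> t < 1 \<Longrightarrow> (b has_real_derivative b' t) (at t)"
  by (rule C2_time_deriv[OF C2_b]) metis

text \<open>Time must stay away from \<open>1\<close>, where \<open>a\<close> vanishes. The interval
  is symmetric so that the same bounds serve the reversed flow.\<close>

lemma coefficient_bounds:
  assumes u: "0 < u" "u < 1 / 2"
  obtains B where "B > 0" "\<And>t. t \<in> {u..1 - u} \<Longrightarrow> \<bar>\<sigma> t\<bar> \<le> B"
    "\<And>t. t \<in> {u..1 - u} \<Longrightarrow> \<bar>\<gamma> t\<bar> \<le> B"
proof -
  obtain fa fb where fa: "continuous_on {0..<1} fa" "\<And>t. 0 < t \<Longrightarrow> t < 1 \<Longrightarrow> fa t = a' t"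
    and fb: "continuous_on {0..<1} fb" "\<And>t. 0 < t \<Longrightarrow> t < 1 \<Longrightarrow> fb t = b' t"
    and ab: "continuous_on {0..<1} a" "continuous_on {0..<1} b"
    using C2_time_deriv[OF C2_a] C2_time_deriv[OF C2_b] by metis
  have sub: "{u..1 - u} \<subseteq> {0..<1}" using u by auto
  note c = continuous_on_subset[OF fa(1) sub] continuous_on_subset[OF fb(1) sub]
    continuous_on_subset[OF ab(1) sub] continuous_on_subset[OF ab(2) sub]
  have nz: "\<forall>t\<in>{u..1 - u}. a t \<noteq> 0" "\<forall>t\<in>{u..1 - u}. (a t)\<^sup>2 \<noteq> 0"
  proof -
    have "a t \<noteq> 0" if "t \<in> {u..1 - u}" for t using a_pos[of t] u that by auto
    then show "\<forall>t\<in>{u..1 - u}. a t \<noteq> 0" "\<forall>t\<in>{u..1 - u}. (a t)\<^sup>2 \<noteq> 0" by auto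
  qed
  have "bounded ((\<lambda>t. b t / (a t)\<^sup>2) ` {u..1 - u})" "bounded ((\<lambda>t. fb t - fa t * b t / a t) ` {u..1 - u})"
    using nz by (intro compact_imp_bounded compact_continuous_image continuous_intros c; simp)+
  then obtain B1 B2 where B: "B1 > 0" "\<forall>t\<in>{u..1 - u}. \<bar>b t / (a t)\<^sup>2\<bar> \<le> B1"
    "B2 > 0" "\<forall>t\<in>{u..1 - u}. \<bar>fb t - fa t * b t / a t\<bar> \<le> B2"
    unfolding bounded_pos by auto
  show ?thesis
  proof (rule that[of "B1 + B2"])
    fix t assume t: "t \<in> {u..1 - u}"
    then have eq: "fa t = a' t" "fb t = b' t" using fa(2) fb(2) u by auto
    have "\<bar>b t / (a t)\<^sup>2\<bar> \<le> B1" "\<bar>fb t - fa t * b t / a t\<bar> \<le> B2"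
      using B(2,4) t by blast+
    then show "\<bar>\<sigma> t\<bar> \<le> B1 + B2" "\<bar>\<gamma> t\<bar> \<le> B1 + B2"
      using B(1,3) unfolding eq \<sigma>_def \<gamma>_def by linarith+
  qed (use B in simp)
qed

text \<open>For \<open>k = \<kappa>\<close> the rate \<open>\<theta>\<close> bounds the Jacobian of the velocity from above, for
  \<open>k = \<beta>\<close> from below.\<close>

definition q :: "real \<Rightarrow> real \<Rightarrow> real" where "q k t = k * (a t)\<^sup>2 + (b t)\<^sup>2"

definition \<theta> :: "real \<Rightarrow> real \<Rightarrow> real" where "\<theta> k t = (k * a t * a' t + b t * b' t) / q k t"

lemma q_1: "q k 1 = 1"
  by (simp add: q_def a1 b1)

lemma q_pos: "k > 0 \<Longrightarrow> 0 \<le> t \<Longrightarrow> t \<le> 1 \<Longrightarrow> q k t > 0"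
  using a0 a1 b1 a_pos[of t] unfolding q_def
  by (cases "t = 1") (auto intro!: add_pos_nonneg simp: le_less)

lemma q_deriv:
  assumes "k > 0" "0 < t" "t < 1"
  shows "(q k has_real_derivative (2 * \<theta> k t * q k t)) (at t)"
proof -
  have "(q k has_real_derivative (2 * (k * a t * a' t + b t * b' t))) (at t)"
    unfolding q_def[abs_def]
    by (rule derivative_eq_intros refl DERIV_a DERIV_b assms | simp add: algebra_simps)+
  moreover have "\<theta> k t * q k t = k * a t * a' t + b t * b' t"
    using q_pos[of k t] assms by (simp add: \<theta>_def)
  ultimately show ?thesis by (simp add: mult.assoc)
qed

text \<open>Only the square of \<open>a\<close> enters \<open>q\<close>, and it is continuously
  differentiable up to \<open>1\<close> even when \<open>a\<close> is not.\<close>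

lemma q_C1:
  obtains q' where "continuous_on {0..1} q'" "\<And>t. t \<in> {0..1} \<Longrightarrow> (q k has_real_derivative q' t) (at t within {0..1})"
proof -
  obtain g where g: "\<And>t. t \<in> {0..1} \<Longrightarrow> ((\<lambda>t. (a t)\<^sup>2) has_real_derivative g t) (at t within {0..1})" "continuous_on {0..1} g"
    using sched unfolding interpolation_schedule_def C1_on_def by blast
  obtain h where h: "\<And>t. t \<in> {0..1} \<Longrightarrow> (b has_real_derivative h t) (at t within {0..1})" "continuous_on {0..1} h"
    using sched unfolding interpolation_schedule_def C1_on_def by blast
  have bc: "continuous_on {0..1} b" using h(1) by (meson DERIV_continuous_on)
  show ?thesis
  proof (rule that[of "\<lambda>t. k * g t + 2 * b t * h t"])
    show "continuous_on {0..1} (\<lambda>t. k * g t + 2 * b t * h t)"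
      by (intro continuous_intros g h bc)
    show "(q k has_real_derivative (k * g t + 2 * b t * h t)) (at t within {0..1})" if "t \<in> {0..1}" for t
    proof -
      have "((\<lambda>t. k * (a t)\<^sup>2) has_real_derivative k * g t) (at t within {0..1})"
        by (intro DERIV_cmult g that)
      moreover have "((\<lambda>t. (b t)\<^sup>2) has_real_derivative 2 * b t * h t) (at t within {0..1})"
        using DERIV_power[OF h(1)[OF that], of 2] by (simp add: mult_ac)
      ultimately show ?thesis unfolding q_def[abs_def] by (rule DERIV_add)
    qed
  qed
qed

lemma q_cont: "continuous_on {0..1} (q k)"
  by (rule q_C1[of k]) (meson DERIV_continuous_on)

text \<open>Inside the interval \<open>\<theta>\<close> is half the logarithmic derivative of
  \<open>q\<close>, which is positive and continuously differentiable up to both endpoints. The term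
  \<open>a' t / a t\<close> of the Jacobian alone is unbounded near \<open>1\<close>.\<close>

lemma \<theta>_bounded:
  assumes k: "k > 0"
  obtains L where "L \<ge> 0" "\<And>t. 0 < t \<Longrightarrow> t < 1 \<Longrightarrow> \<bar>\<theta> k t\<bar> \<le> L"
proof -
  obtain q' where q': "continuous_on {0..1} q'" "\<And>t. t \<in> {0..1} \<Longrightarrow> (q k has_real_derivative q' t) (at t within {0..1})"
    using q_C1[of k] by blast
  have nz: "\<forall>t\<in>{0..1}. 2 * q k t \<noteq> 0" using q_pos[OF k] by force
  have "bounded ((\<lambda>t. q' t / (2 * q k t)) ` {0..1})"
    using nz by (intro compact_imp_bounded compact_continuous_image continuous_intros q' q_cont; simp)
  then obtain L where L: "L > 0" "\<forall>t\<in>{0..1}. \<bar>q' t / (2 * q k t)\<bar> \<le> L"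
    unfolding bounded_pos by auto
  show ?thesis
  proof (rule that[of L])
    fix t :: real assume t: "0 < t" "t < 1"
    have "at t within {0..1} = at t"
      using t by (intro at_within_interior) auto
    then have "q' t = 2 * \<theta> k t * q k t"
      using q'(2)[of t] q_deriv[OF k t] t DERIV_unique by force
    then have "q' t / (2 * q k t) = \<theta> k t"
      using nz t by auto
    moreover have "\<bar>q' t / (2 * q k t)\<bar> \<le> L" using L(2) t by simp
    ultimately show "\<bar>\<theta> k t\<bar> \<le> L" by simp
  qed (use L in simp)
qed

text \<open>For a centred Gaussian target of covariance \<open>1 / k\<close> the tilted covariance
  is exactly \<open>1 / (k + \<tau> t)\<close>, so \<open>\<theta>\<close> is the true rate in that
  extremal case and the general bounds are comparisons with it.\<close>

lemma \<theta>_eq: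
  assumes "k > 0" "0 < t" "t < 1"
  shows "a' t / a t + \<gamma> t * \<sigma> t * (1 / (k + \<tau> t)) = \<theta> k t"
proof -
  have a: "a t > 0" by (rule a_pos[OF assms(2,3)])
  have qp: "k * (a t)\<^sup>2 + (b t)\<^sup>2 > 0" using q_pos[of k t] assms by (simp add: q_def)
  have "k + \<tau> t = (k * (a t)\<^sup>2 + (b t)\<^sup>2) / (a t)\<^sup>2"
    using a by (simp add: \<tau>_def add_divide_distrib)
  then have "\<sigma> t * (1 / (k + \<tau> t)) = b t / (k * (a t)\<^sup>2 + (b t)\<^sup>2)"
    using a by (simp add: \<sigma>_def)
  then have "a' t / a t + \<gamma> t * \<sigma> t * (1 / (k + \<tau> t))
      = a' t / a t + \<gamma> t * (b t / (k * (a t)\<^sup>2 + (b t)\<^sup>2))"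
    by (simp only: mult.assoc)
  also have "\<dots> = (k * a t * a' t + b t * b' t) / (k * (a t)\<^sup>2 + (b t)\<^sup>2)"
    using a qp unfolding \<gamma>_def by (simp add: divide_simps) (simp add: algebra_simps power2_eq_square)
  finally show ?thesis by (simp add: \<theta>_def q_def)
qed

end

section \<open>Bounds on the velocity and its flows\<close>

text \<open>The underlying probability space is left behind: the velocity enters through its closed
  formula on the open time interval.\<close>

locale interpolation_velocity = schedule a b + strongly_log_concave \<nu> \<kappa>
  for a b :: "real \<Rightarrow> real" and \<nu> :: "'a::euclidean_space measure" and \<kappa> :: real +
  fixes v :: "real \<Rightarrow> 'a \<Rightarrow> 'a"
  assumes v_eq: "\<And>t x. 0 < t \<Longrightarrow> t < 1 \<Longrightarrow> v t x = (a' t / a t) *\<^sub>R x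
    + \<gamma> t *\<^sub>R tilted_mean \<nu> (\<tau> t) (\<sigma> t *\<^sub>R x)"
begin

definition Dv :: "real \<Rightarrow> 'a \<Rightarrow> 'a \<Rightarrow> 'a" where
  "Dv t x h = (a' t / a t) *\<^sub>R h + (\<gamma> t * \<sigma> t) *\<^sub>R
      tilted_cov \<nu> (\<tau> t) (\<sigma> t *\<^sub>R x) h"

lemma \<tau>_ge: "\<tau> t \<ge> 0"
  by (simp add: \<tau>_def)

lemma linear_Dv: "linear (Dv t x)"
  unfolding Dv_def[abs_def]
  by (intro linear_compose_add linear_compose_scale_right linear_tilted_cov \<tau>_ge linear_id[unfolded id_def])

lemma Dv_sym: "k \<bullet> Dv t x h = h \<bullet> Dv t x k"
  using tilted_cov_sym[OF \<tau>_ge] by (simp add: Dv_def inner_add_right inner_commute[of k h])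

lemma v_has_derivative:
  assumes t: "0 < t" "t < 1"
  shows "(v t has_derivative Dv t x) (at x)"
proof -
  let ?m = "tilted_mean \<nu> (\<tau> t)" and ?C = "tilted_cov \<nu> (\<tau> t) (\<sigma> t *\<^sub>R x)"
  have "((\<lambda>x. ?m (\<sigma> t *\<^sub>R x)) has_derivative (\<lambda>h. ?C (\<sigma> t *\<^sub>R h))) (at x)"
    by (rule has_derivative_compose[OF _ has_derivative_tilted_mean[OF \<tau>_ge]])
       (auto intro!: derivative_eq_intros)
  then have "((\<lambda>x. (a' t / a t) *\<^sub>R x + \<gamma> t *\<^sub>R ?m (\<sigma> t *\<^sub>R x)) has_derivative
      (\<lambda>h. (a' t / a t) *\<^sub>R h + \<gamma> t *\<^sub>R ?C (\<sigma> t *\<^sub>R h))) (at x)"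
    by (intro has_derivative_add has_derivative_scaleR_right has_derivative_ident)
  moreover have "(\<lambda>h. (a' t / a t) *\<^sub>R h + \<gamma> t *\<^sub>R ?C (\<sigma> t *\<^sub>R h)) = Dv t x"
    using linear_scale[OF linear_tilted_cov[OF \<tau>_ge]] by (simp add: fun_eq_iff Dv_def)
  moreover have "v t = (\<lambda>x. (a' t / a t) *\<^sub>R x + \<gamma> t *\<^sub>R ?m (\<sigma> t *\<^sub>R x))"
    using v_eq[OF t] by (simp add: fun_eq_iff)
  ultimately show ?thesis by simp
qed

text \<open>The monotonicity of the schedule enters here. This sign makes the Jacobian of the
  velocity increase with the covariance, so covariance bounds carry over without reversal.\<close>

lemma \<gamma>\<sigma>_ge:
  assumes t: "0 < t" "t < 1"
  shows "\<gamma> t * \<sigma> t \<ge> 0"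
proof -
  have "a' t * b t / a t \<le> 0"
    using a'_le[OF t] a_pos[OF t] b_pos[OF t] by (intro divide_nonpos_nonneg mult_nonpos_nonneg) auto
  then show ?thesis
    using b'_ge[OF t] b_pos[OF t] unfolding \<gamma>_def \<sigma>_def by (intro mult_nonneg_nonneg) auto
qed

lemma inner_Dv:
  "h \<bullet> Dv t x h = (a' t / a t) * (h \<bullet> h) + (\<gamma> t * \<sigma> t) *
      (h \<bullet> tilted_cov \<nu> (\<tau> t) (\<sigma> t *\<^sub>R x) h)"
  by (simp add: Dv_def inner_add_right)

lemma \<theta>_mult:
  assumes "k > 0" and t: "0 < t" "t < 1"
  shows "\<theta> k t * s = (a' t / a t) * s + (\<gamma> t * \<sigma> t) * (s / (k + \<tau> t))"
  unfolding \<theta>_eq[OF assms, symmetric] by (simp add: algebra_simps)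

lemma Dv_le:
  assumes "semi_log_concave k \<nu>" "k > 0" and t: "0 < t" "t < 1"
  shows "h \<bullet> Dv t x h \<le> \<theta> k t * (h \<bullet> h)"
proof -
  \<comment> \<open>The bound is claimed for every admissible \<open>k\<close>, so the theory of
    tilts is instantiated a second time besides the fixed \<open>\<kappa>\<close>.\<close>
  interpret k: strongly_log_concave \<nu> k by unfold_locales (use assms supp in auto)
  show ?thesis
    unfolding inner_Dv \<theta>_mult[OF assms(2) t]
    by (intro add_left_mono mult_left_mono k.tilted_cov_le \<tau>_ge \<gamma>\<sigma>_ge t)
qed

lemma Dv_ge:
  assumes "semi_log_convex k \<nu>" "k > 0" and t: "0 < t" "t < 1"
  shows "\<theta> k t * (h \<bullet> h) \<le> h \<bullet> Dv t x h"
  unfolding inner_Dv \<theta>_mult[OF assms(2) t]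
  by (intro add_left_mono mult_left_mono tilted_cov_ge \<tau>_ge \<gamma>\<sigma>_ge t assms)

text \<open>Concavity bounds the quadratic form of the Jacobian from above and convexity from below;
  symmetry turns the two into a norm bound. It is uniform in time although the coefficients are not,
  and it supplies the Lipschitz constant behind differentiability of the flow.\<close>

lemma Dv_bounded:
  assumes \<beta>: "semi_log_convex \<beta> \<nu>" "\<beta> > 0"
  obtains L where "L \<ge> 0" "\<And>t x h. 0 < t \<Longrightarrow> t < 1 \<Longrightarrow> norm (Dv t x h) \<le> L * norm h"
proof -
  obtain L1 where L1: "L1 \<ge> 0" "\<And>t. 0 < t \<Longrightarrow> t < 1 \<Longrightarrow> \<bar>\<theta> \<kappa> t\<bar> \<le> L1"
    using \<theta>_bounded[OF \<kappa>] by metis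
  obtain L2 where L2: "L2 \<ge> 0" "\<And>t. 0 < t \<Longrightarrow> t < 1 \<Longrightarrow> \<bar>\<theta> \<beta> t\<bar> \<le> L2"
    using \<theta>_bounded[OF \<beta>(2)] by metis
  show ?thesis
  proof (rule that[of "L1 + L2"])
    fix t x h assume t: "0 < (t::real)" "t < 1"
    show "norm (Dv t x h) \<le> (L1 + L2) * norm h"
    proof (rule symmetric_norm_bound[OF linear_Dv Dv_sym])
      fix h :: 'a
      have "\<theta> \<kappa> t * (h \<bullet> h) \<le> (L1 + L2) * (h \<bullet> h)" "- (L1 + L2) * (h \<bullet> h) \<le> \<theta> \<beta> t * (h \<bullet> h)"
        using L1(1) L2(1) L1(2)[OF t] L2(2)[OF t] by (intro mult_right_mono; simp)+
      then show "\<bar>h \<bullet> Dv t x h\<bar> \<le> (L1 + L2) * (h \<bullet> h)"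
        using Dv_le[OF concave \<kappa> t, of h x] Dv_ge[OF \<beta> t, of h x] by linarith
    qed (use L1 L2 in simp)
  qed (use L1 L2 in simp)
qed

lemma v_lipschitz:
  assumes "\<And>x h. norm (Dv t x h) \<le> L * norm h" "L \<ge> 0" and t: "0 < t" "t < 1"
  shows "norm (v t x - v t y) \<le> L * norm (x - y)"
  by (rule differentiable_bound[of UNIV "v t" "Dv t"])
     (use v_has_derivative[OF t] assms in \<open>auto intro!: onorm_bound\<close>)

lemma v_remainder:
  assumes "0 < u" "u < 1 / 2"
  shows "\<exists>K \<delta>. K \<ge> 0 \<and> \<delta> > 0 \<and>
      (\<forall>t\<in>{u..1 - u}. \<forall>x h. norm h \<le> \<delta> \<longrightarrow> norm (v t (x + h) - v t x - Dv t x h) \<le> K * (norm h)\<^sup>2)"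
proof -
  obtain B where B: "B > 0" "\<And>t. t \<in> {u..1 - u} \<Longrightarrow> \<bar>\<sigma> t\<bar> \<le> B"
    "\<And>t. t \<in> {u..1 - u} \<Longrightarrow> \<bar>\<gamma> t\<bar> \<le> B"
    using coefficient_bounds[OF assms] by metis
  obtain K where K: "K \<ge> 0" "\<And>\<tau> \<xi> h. \<tau> \<ge> 0 \<Longrightarrow> norm h \<le> 1 \<Longrightarrow>
      norm (tilted_mean \<nu> \<tau> (\<xi> + h) - tilted_mean \<nu> \<tau> \<xi> - tilted_cov \<nu> \<tau> \<xi> h) \<le> K * (norm h)\<^sup>2"
    using tilted_mean_expansion by metis
  show ?thesis
  \<comment> \<open>The radius \<open>1 / B\<close> keeps \<open>\<sigma> t *\<^sub>R h\<close> in
    the unit ball. One factor \<open>B\<close> bounds \<open>\<gamma>\<close>, the other two come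
    from the square of \<open>\<sigma>\<close>.\<close>
  proof (rule exI[of _ "B * (K * B\<^sup>2)"], rule exI[of _ "1 / B"], intro conjI ballI allI impI)
    fix t x and h :: 'a assume t: "t \<in> {u..1 - u}" and h: "norm h \<le> 1 / B"
    have t': "0 < t" "t < 1" using t assms by auto
    have \<sigma>h: "norm (\<sigma> t *\<^sub>R h) \<le> B * norm h"
      using mult_right_mono[OF B(2)[OF t] norm_ge_zero[of h]] by (simp only: norm_scaleR)
    also have "\<dots> \<le> 1" using h B(1) by (simp add: field_simps)
    finally have "norm (\<sigma> t *\<^sub>R h) \<le> 1" .
    then have "norm (tilted_mean \<nu> (\<tau> t) (\<sigma> t *\<^sub>R x + \<sigma> t *\<^sub>R h) - tilted_mean \<nu> (\<tau> t) (\<sigma> t *\<^sub>R x)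
        - tilted_cov \<nu> (\<tau> t) (\<sigma> t *\<^sub>R x) (\<sigma> t *\<^sub>R h)) \<le> K * (norm (\<sigma> t *\<^sub>R h))\<^sup>2" (is "norm ?r \<le> _")
      by (intro K(2) \<tau>_ge)
    also have "\<dots> \<le> K * (B * norm h)\<^sup>2"
      using \<sigma>h K(1) by (intro mult_left_mono power_mono) auto
    finally have r: "norm ?r \<le> K * B\<^sup>2 * (norm h)\<^sup>2" by (simp add: power_mult_distrib)
    have "v t (x + h) - v t x - Dv t x h = \<gamma> t *\<^sub>R ?r"
      using linear_scale[OF linear_tilted_cov[OF \<tau>_ge]] unfolding v_eq[OF t'] Dv_def
      by (simp add: scaleR_add_right scaleR_diff_right)
    then have "norm (v t (x + h) - v t x - Dv t x h) = \<bar>\<gamma> t\<bar> * norm ?r" by simp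
    also have "\<dots> \<le> B * (K * B\<^sup>2 * (norm h)\<^sup>2)"
      using B(1) B(3)[OF t] r by (intro mult_mono) auto
    finally show "norm (v t (x + h) - v t x - Dv t x h) \<le> B * (K * B\<^sup>2) * (norm h)\<^sup>2"
      by (simp add: mult.assoc)
  qed (use B K in auto)
qed

lemma flow_of_interior:
  assumes "flow_of w X"
  shows "X 0 x = x" "continuous_on {0..1} (\<lambda>t. X t x)"
    and "0 < t \<Longrightarrow> t < 1 \<Longrightarrow> ((\<lambda>s. X s x) has_vector_derivative w t (X t x)) (at t)"
proof -
  have d: "((\<lambda>s. X s x) has_vector_derivative w t (X t x)) (at t within {0..1})" if "t \<in> {0..1}" for t
    using assms that unfolding flow_of_def by auto
  show "X 0 x = x" using assms unfolding flow_of_def by auto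
  show "continuous_on {0..1} (\<lambda>t. X t x)"
    unfolding continuous_on_eq_continuous_within
    using d has_vector_derivative_continuous by blast
  assume t: "0 < t" "t < 1"
  then have "at t within {0..1} = at t"
    by (intro at_within_interior) auto
  then show "((\<lambda>s. X s x) has_vector_derivative w t (X t x)) (at t)"
    using d[of t] t by simp
qed

lemma forward_lipschitz:
  assumes X: "flow_of v X" and k: "semi_log_concave k \<nu>" "k > 0"
  shows "norm (X 1 x - X 1 y) \<le> 1 / sqrt (k * (a 0)\<^sup>2 + (b 0)\<^sup>2) * norm (x - y)"
proof -
  note X' = flow_of_interior[OF X]
  have "norm (X 1 x - X 1 y) \<le> sqrt (q k 1 / q k 0) * norm (X 0 x - X 0 y)"
  proof (rule flow_contraction[where X = X and w = v and c = "\<theta> k", OF X'(2) X'(3)])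
    show "(x - y) \<bullet> (v t x - v t y) \<le> \<theta> k t * ((x - y) \<bullet> (x - y))" if t: "0 < t" "t < 1" for t x y
      by (rule inner_derivative_bound[OF v_has_derivative[OF t] Dv_le[OF k t]])
  qed (use k q_cont q_pos q_deriv in auto)
  then show ?thesis
    by (simp add: X'(1) q_1) (simp add: q_def real_sqrt_divide)
qed

text \<open>Reversal changes the sign of the field, so the lower bound on the Jacobian becomes an
  upper one. The rate becomes \<open>- \<theta> k (1 - t)\<close> with solution
  \<open>q k (1 - t)\<close>, whose endpoint ratio is the reciprocal of the forward one.\<close>

lemma reversed_lipschitz:
  assumes X: "flow_of (\<lambda>t x. - v (1 - t) x) X" and k: "semi_log_convex k \<nu>" "k > 0"
  shows "norm (X 1 x - X 1 y) \<le> sqrt (k * (a 0)\<^sup>2 + (b 0)\<^sup>2) * norm (x - y)"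
proof -
  note X' = flow_of_interior[OF X]
  have "norm (X 1 x - X 1 y) \<le> sqrt (q k (1 - 1) / q k (1 - 0)) * norm (X 0 x - X 0 y)"
  proof (rule flow_contraction[where X = X and w = "\<lambda>t x. - v (1 - t) x" and c = "\<lambda>t. - \<theta> k (1 - t)" and q = "\<lambda>t. q k (1 - t)", OF X'(2) X'(3)])
    fix t :: real assume t: "0 < t" "t < 1"
    then have t': "0 < 1 - t" "1 - t < 1" by auto
    have "((\<lambda>x. - v (1 - t) x) has_derivative (\<lambda>h. - Dv (1 - t) x h)) (at x)" for x
      by (intro has_derivative_minus v_has_derivative t')
    then show "(x - y) \<bullet> (- v (1 - t) x - - v (1 - t) y) \<le> - \<theta> k (1 - t) * ((x - y) \<bullet> (x - y))" for x y
      by (rule inner_derivative_bound) (use Dv_ge[OF k t'] in simp)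
    show "((\<lambda>t. q k (1 - t)) has_real_derivative 2 * - \<theta> k (1 - t) * q k (1 - t)) (at t)"
      using DERIV_chain2[OF q_deriv[OF k(2) t'] DERIV_diff[OF DERIV_const DERIV_ident]] by simp
  next
    show "continuous_on {0..1} (\<lambda>t. q k (1 - t))"
      by (rule continuous_on_compose2[OF q_cont[of k]]) (auto intro!: continuous_intros)
  qed (use k q_pos in auto)
  then show ?thesis
    by (simp add: X'(1) q_1) (simp add: q_def)
qed

lemma forward_differentiable:
  assumes X: "flow_of v X" and \<beta>: "semi_log_convex \<beta> \<nu>" "\<beta> > 0"
  shows "X 1 differentiable (at x)"
proof -
  obtain L where L: "L \<ge> 0" "\<And>t x h. 0 < t \<Longrightarrow> t < 1 \<Longrightarrow> norm (Dv t x h) \<le> L * norm h"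
    using Dv_bounded[OF \<beta>] by metis
  note X' = flow_of_interior[OF X]
  show ?thesis
    by (rule flow_differentiable[where X = X and w = v and A = Dv and L = L, OF X'(1) X'(2) X'(3)])
       (use L v_lipschitz linear_Dv v_remainder in auto)
qed

lemma reversed_differentiable:
  assumes X: "flow_of (\<lambda>t x. - v (1 - t) x) X" and \<beta>: "semi_log_convex \<beta> \<nu>" "\<beta> > 0"
  shows "X 1 differentiable (at x)"
proof -
  obtain L where L: "L \<ge> 0" "\<And>t x h. 0 < t \<Longrightarrow> t < 1 \<Longrightarrow> norm (Dv t x h) \<le> L * norm h"
    using Dv_bounded[OF \<beta>] by metis
  note X' = flow_of_interior[OF X]
  show ?thesis
  proof (rule flow_differentiable[where X = X and w = "\<lambda>t x. - v (1 - t) x" and A = "\<lambda>t x h. - Dv (1 - t) x h" and L = L,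
        OF X'(1) X'(2) X'(3)])
    fix t :: real and x y :: 'a assume "0 < t" "t < 1"
    then show "norm (- v (1 - t) x - - v (1 - t) y) \<le> L * norm (x - y)"
      using v_lipschitz[of "1 - t" L y x] L by (simp add: norm_minus_commute)
  next
    fix u :: real assume "0 < u" "u < 1 / 2"
    then obtain K \<delta> where K: "K \<ge> 0" "\<delta> > 0" and r: "\<And>t x h. t \<in> {u..1 - u} \<Longrightarrow> norm h \<le> \<delta> \<Longrightarrow>
        norm (v t (x + h) - v t x - Dv t x h) \<le> K * (norm h)\<^sup>2"
      using v_remainder by metis
    show "\<exists>K \<delta>. K \<ge> 0 \<and> \<delta> > 0 \<and> (\<forall>t\<in>{u..1 - u}. \<forall>x h. norm h \<le> \<delta> \<longrightarrow>
        norm (- v (1 - t) (x + h) - - v (1 - t) x - - Dv (1 - t) x h) \<le> K * (norm h)\<^sup>2)"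
    proof (rule exI[of _ K], rule exI[of _ \<delta>], intro conjI ballI allI impI K)
      fix t x h assume "t \<in> {u..1 - u}" "norm (h::'a) \<le> \<delta>"
      then have "norm (v (1 - t) (x + h) - v (1 - t) x - Dv (1 - t) x h) \<le> K * (norm h)\<^sup>2"
        by (intro r) auto
      also have "norm (v (1 - t) (x + h) - v (1 - t) x - Dv (1 - t) x h)
          = norm (- (v (1 - t) (x + h) - v (1 - t) x - Dv (1 - t) x h))"
        by (rule norm_minus_cancel[symmetric])
      finally show "norm (- v (1 - t) (x + h) - - v (1 - t) x - - Dv (1 - t) x h) \<le> K * (norm h)\<^sup>2"
        by (simp add: algebra_simps)
    qed
  qed (use L linear_Dv in \<open>auto intro!: linear_compose_neg\<close>)
qed

end

section \<open>From conditional expectations to the flow maps\<close>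

lemma velocity_field_eq:
  fixes \<nu> :: "'a::euclidean_space measure"
  assumes M: "prob_space M" and indep: "prob_space.indep_var M borel Z borel Y"
    and laws: "distr M borel Z = std_gaussian" "distr M borel Y = \<nu>"
    and moment: "integrable \<nu> (\<lambda>y. (norm y)\<^sup>2)"
    and conc: "semi_log_concave \<kappa> \<nu>" "\<kappa> > 0" "measure_support \<nu> = UNIV"
    and v: "velocity_field a b M Z Y v" and t: "0 < t" "t < 1" and a: "a t > 0"
  shows "v t x = (time_deriv a t / a t) *\<^sub>R x + (time_deriv b t - time_deriv a t * b t / a t) *\<^sub>R
      tilted_mean \<nu> ((b t)\<^sup>2 / (a t)\<^sup>2) ((b t / (a t)\<^sup>2) *\<^sub>R x)"
proof -
  interpret prob_space M by (rule M)
  interpret strongly_log_concave \<nu> \<kappa> by unfold_locales (use conc in auto)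
  interpret N: prob_space \<nu> by (rule prob_nu)
  have meas: "(\<lambda>y. y) \<in> borel_measurable \<nu>" by measurable
  have "integrable \<nu> norm"
    by (rule N.square_integrable_imp_integrable[OF measurable_compose[OF meas borel_measurable_norm] moment])
  then have int: "integrable \<nu> (\<lambda>y. y)"
    by (simp only: integrable_norm_iff[OF meas])
  interpret gaussian_channel M Z Y \<nu> "a t" "b t"
    by unfold_locales (use indep laws int a in auto)
  let ?m = "\<lambda>x. tilted_mean \<nu> ((b t)\<^sup>2 / (a t)\<^sup>2) ((b t / (a t)\<^sup>2) *\<^sub>R x)"
  have \<tau>: "(b t)\<^sup>2 / (a t)\<^sup>2 \<ge> 0" by simp
  show ?thesis
  proof (rule continuous_cond_exp_eq)
    have "continuous_on UNIV (tilted_mean \<nu> ((b t)\<^sup>2 / (a t)\<^sup>2))"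
      using has_derivative_tilted_mean[OF \<tau>] has_derivative_continuous
      by (intro continuous_at_imp_continuous_on) blast
    then show "continuous_on UNIV ?m"
      by (rule continuous_on_compose2) (auto intro!: continuous_intros)
    \<comment> \<open>The prefactor of the kernel depends on \<open>x\<close> only and comes out of
      both integrals, leaving the identity for the tilt.\<close>
    show "(\<integral>y. gaussian_kernel (a t) (b t) x y *\<^sub>R y \<partial>\<nu>) = (\<integral>y. gaussian_kernel (a t) (b t) x y \<partial>\<nu>) *\<^sub>R ?m x" for x
      unfolding gaussian_kernel_eq_exp[OF a] scaleR_scaleR[symmetric] integral_scaleR_right
        integral_exp_scaleR_nu[OF \<tau>] by simp
    show "continuous_cond_exp_given M (\<lambda>\<omega>. time_deriv a t *\<^sub>R Z \<omega> + time_deriv b t *\<^sub>R Y \<omega>)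
        (\<lambda>\<omega>. a t *\<^sub>R Z \<omega> + b t *\<^sub>R Y \<omega>) (v t)"
      using v t unfolding velocity_field_def by auto
  qed
qed

theorem proposition30:
  fixes a b :: "real \<Rightarrow> real"
    and \<nu> :: "'a::euclidean_space measure"
    and M :: "'w measure"
    and Z Y :: "'w \<Rightarrow> 'a"
    and v X Xr :: "real \<Rightarrow> 'a \<Rightarrow> 'a"
  assumes schedule: "interpolation_schedule a b"
    and nu_prob: "prob_space \<nu>" and nu_sets: "sets \<nu> = sets borel"
    and nu_ac: "absolutely_continuous lborel \<nu>"
    and nu_moment: "integrable \<nu> (\<lambda>x. (norm x)\<^sup>2)"
    and nu_convex: "\<exists>\<beta>>0. semi_log_convex \<beta> \<nu>"
    and nu_concave: "\<exists>\<kappa>>0. semi_log_concave \<kappa> \<nu>"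
    and nu_support: "measure_support \<nu> = UNIV"
    and M_prob: "prob_space M"
    and indep: "prob_space.indep_var M borel Z borel Y"
    and Z_law: "distr M borel Z = std_gaussian"
    and Y_law: "distr M borel Y = \<nu>"
    and velocity: "velocity_field a b M Z Y v"
    and flow: "flow_of v X"
    and reversed_flow: "flow_of (\<lambda>t x. - v (1 - t) x) Xr"
  shows "(\<forall>\<kappa>>0. semi_log_concave \<kappa> \<nu> \<longrightarrow>
            (1 / sqrt (\<kappa> * (a 0)\<^sup>2 + (b 0)\<^sup>2))-lipschitz_on UNIV (X 1) \<and>
            (\<forall>x. X 1 differentiable (at x) \<and>
                 jacobian_norm (X 1) x \<le> 1 / sqrt (\<kappa> * (a 0)\<^sup>2 + (b 0)\<^sup>2)) \<and>
            (a 0 = 1 \<and> b 0 = 0 \<longrightarrow> (\<forall>x. jacobian_norm (X 1) x \<le> 1 / sqrt \<kappa>))) \<and>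
         (\<forall>\<beta>>0. semi_log_convex \<beta> \<nu> \<longrightarrow>
            (sqrt (\<beta> * (a 0)\<^sup>2 + (b 0)\<^sup>2))-lipschitz_on (measure_support \<nu>) (Xr 1) \<and>
            (\<forall>x\<in>measure_support \<nu>. Xr 1 differentiable (at x) \<and>
                 jacobian_norm (Xr 1) x \<le> sqrt (\<beta> * (a 0)\<^sup>2 + (b 0)\<^sup>2)) \<and>
            (a 0 = 1 \<and> b 0 = 0 \<longrightarrow>
               (\<forall>x\<in>measure_support \<nu>. jacobian_norm (Xr 1) x \<le> sqrt \<beta>)))"
proof -
  \<comment> \<open>These fixed bounds provide the velocity formula and differentiability of both
    maps. The Lipschitz constants are then proved for arbitrary \<open>\<kappa>\<close> and
    \<open>\<beta>\<close>, which need not be these.\<close>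
  obtain \<kappa>0 where \<kappa>0: "\<kappa>0 > 0" "semi_log_concave \<kappa>0 \<nu>" using nu_concave by blast
  obtain \<beta>0 where \<beta>0: "\<beta>0 > 0" "semi_log_convex \<beta>0 \<nu>" using nu_convex by blast
  interpret schedule a b by unfold_locales (rule schedule)
  interpret interpolation_velocity a b \<nu> \<kappa>0 v
  proof unfold_locales
    show "v t x = (a' t / a t) *\<^sub>R x + \<gamma> t *\<^sub>R tilted_mean \<nu> (\<tau> t) (\<sigma> t *\<^sub>R x)"
      if t: "0 < t" "t < 1" for t x
      unfolding \<sigma>_def \<tau>_def \<gamma>_def
      by (rule velocity_field_eq[OF M_prob indep Z_law Y_law nu_moment \<kappa>0(2,1) nu_support velocity t a_pos[OF t]])
  qed (use \<kappa>0 nu_support in auto)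
  have pos: "k * (a 0)\<^sup>2 + (b 0)\<^sup>2 > 0" if "k > 0" for k
    using q_pos[OF that, of 0] by (simp add: q_def)
  have "(1 / sqrt (\<kappa> * (a 0)\<^sup>2 + (b 0)\<^sup>2))-lipschitz_on UNIV (X 1) \<and>
      (\<forall>x. X 1 differentiable (at x) \<and> jacobian_norm (X 1) x \<le> 1 / sqrt (\<kappa> * (a 0)\<^sup>2 + (b 0)\<^sup>2))"
    if \<kappa>: "\<kappa> > 0" "semi_log_concave \<kappa> \<nu>" for \<kappa>
  proof -
    have "1 / sqrt (\<kappa> * (a 0)\<^sup>2 + (b 0)\<^sup>2) \<ge> 0" using pos[OF \<kappa>(1)] by simp
    moreover note lip = forward_lipschitz[OF flow \<kappa>(2,1)]
    moreover note diff = forward_differentiable[OF flow \<beta>0(2,1)]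
    ultimately show ?thesis
      by (auto intro!: lipschitz_onI lipschitz_imp_jacobian_norm_le simp: dist_norm)
  qed
  moreover have "(sqrt (\<beta> * (a 0)\<^sup>2 + (b 0)\<^sup>2))-lipschitz_on UNIV (Xr 1) \<and>
      (\<forall>x. Xr 1 differentiable (at x) \<and> jacobian_norm (Xr 1) x \<le> sqrt (\<beta> * (a 0)\<^sup>2 + (b 0)\<^sup>2))"
    if \<beta>: "\<beta> > 0" "semi_log_convex \<beta> \<nu>" for \<beta>
  proof -
    have "sqrt (\<beta> * (a 0)\<^sup>2 + (b 0)\<^sup>2) \<ge> 0" using pos[OF \<beta>(1)] by simp
    moreover note lip = reversed_lipschitz[OF reversed_flow \<beta>(2,1)]
    moreover note diff = reversed_differentiable[OF reversed_flow \<beta>0(2,1)]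
    ultimately show ?thesis
      by (auto intro!: lipschitz_onI lipschitz_imp_jacobian_norm_le simp: dist_norm)
  qed
  ultimately show ?thesis
    unfolding nu_support by (simp add: Ball_def) (metis mult.right_neutral power_one add.right_neutral zero_power2)
qed

end
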